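(* Fix $c\in\mathbb{C}$. For every $o(10,\mathbb{C})$-module $M$, the formulas given in the context make $\widehat{M}=\mathcal{A}\otimes_{\mathbb{C}}M$ a $\mathcal{G}^{E_6}$-module, and the assignment $M\mapsto\widehat{M}$ (with a homomorphism $g:M\to N$ sent to $\mathrm{id}_{\mathcal{A}}\otimes g$) is a functor from the category of $o(10,\mathbb{C})$-modules to the category of $\mathcal{G}^{E_6}$-modules.
   Context: **The Lie algebra $\mathcal{G}^{E_6}$.** Let $\alpha_1,\dots,\alpha_6$ be the simple roots of $E_6$, where the Dynkin diagram has edges $\{1,3\},\{3,4\},\{4,5\},\{5,6\},\{2,4\}$. Let $Q=\bigoplus_{i=1}^6\mathbb{Z}\alpha_i$ with the symmetric $\mathbb{Z}$-bilinear form $(\cdot,\cdot)$ given by $(\alpha_i,\alpha_i)=2$, $(\alpha_i,\alpha_j)=-1$ if $\{i,j\}$ is an edge, $0$ otherwise; $\Phi_{E_6}=\{\alpha\in Q:(\alpha,\alpha)=2\}$. Define $F:Q\times Q\to\{1,-1\}$ by $$F\Big(\sum_i k_i\alpha_i,\sum_j l_j\alpha_j\Big)=(-1)^{\sum_{i=1}^6k_il_i+k_1l_3+k_4l_2+k_3l_4+k_5l_4+k_6l_5}.$$ Let $H=\bigoplus_{i=1}^6\mathbb{C}\alpha_i$ with the form extended bilinearly, and $\mathcal{G}^{E_6}=H\oplus\bigoplus_{\alpha\in\Phi_{E_6}}\mathbb{C}E_\alpha$ with bracket $[H,H]=0$, $[h,E_\alpha]=-[E_\alpha,h]=(h,\alpha)E_\alpha$,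 $[E_\alpha,E_{-\alpha}]=-\alpha$, and for $\alpha+\beta\neq0$: $[E_\alpha,E_\beta]=F(\alpha,\beta)E_{\alpha+\beta}$ if $\alpha+\beta\in\Phi_{E_6}$, and $0$ if $\alpha+\beta\notin\Phi_{E_6}$. This is the simple Lie algebra of type $E_6$. Put $\Phi_{D_5}=\Phi_{E_6}\cap\sum_{i=1}^5\mathbb{Z}\alpha_i$, $\mathcal{G}^{D_5}=\sum_{i=1}^5\mathbb{C}\alpha_i+\sum_{\beta\in\Phi_{D_5}}\mathbb{C}E_\beta$, and $\mathcal{G}_0=\mathcal{G}^{D_5}+\mathbb{C}\alpha_6=\mathcal{G}^{D_5}\oplus\mathbb{C}\widehat\alpha$, where $\widehat\alpha=2\alpha_1+3\alpha_2+4\alpha_3+6\alpha_4+5\alpha_5+4\alpha_6$ commutes with $\mathcal{G}^{D_5}$. The positive roots not in $\Phi_{D_5}$ are $\beta_1=\alpha_6$, $\beta_2=\alpha_5+\alpha_6$, $\beta_3=\alpha_4+\alpha_5+\alpha_6$, $\beta_4=\alpha_3+\alpha_4+\alpha_5+\alpha_6$, $\beta_5=\alpha_2+\alpha_4+\alpha_5+\alpha_6$, $\beta_6=\alpha_2+\alpha_3+\alpha_4+\alpha_5+\alpha_6$, $\beta_7=\alpha_1+\alpha_3+\alpha_4+\alpha_5+\alpha_6$, $\beta_8=\sum_{i=1}^6\alpha_i$, $\beta_9=\alpha_2+\alpha_3+2\alpha_4+\alpha_5+\alpha_6$, $\beta_{10}=\alpha_1+\alpha_2+\alpha_3+2\alpha_4+\alpha_5+\alpha_6$,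 $\beta_{11}=\alpha_2+\alpha_3+2\alpha_4+2\alpha_5+\alpha_6$, $\beta_{12}=\alpha_1+\alpha_2+2\alpha_3+2\alpha_4+\alpha_5+\alpha_6$, $\beta_{13}=\alpha_1+\alpha_2+\alpha_3+2\alpha_4+2\alpha_5+\alpha_6$, $\beta_{14}=\alpha_1+\alpha_2+2\alpha_3+2\alpha_4+2\alpha_5+\alpha_6$, $\beta_{15}=\alpha_1+\alpha_2+2\alpha_3+3\alpha_4+2\alpha_5+\alpha_6$, $\beta_{16}=\alpha_1+2\alpha_2+2\alpha_3+3\alpha_4+2\alpha_5+\alpha_6$. Set $\xi_i=E_{\beta_i}$, $\eta_i=E_{-\beta_i}$, $\mathcal{G}_+=\sum_i\mathbb{C}\xi_i$, $\mathcal{G}_-=\sum_i\mathbb{C}\eta_i$; then $\mathcal{G}^{E_6}=\mathcal{G}_-\oplus\mathcal{G}_0\oplus\mathcal{G}_+$ and $[\xi_r,\eta_i]\in\mathcal{G}_0$. **The isomorphism $\nu$.** $o(10,\mathbb{C})$ is the Lie algebra of $10\times10$ matrices spanned by $E_{i,j}-E_{5+j,5+i}$ ($1\le i,j\le5$), $E_{p,5+q}-E_{q,5+p}$ and $E_{5+p,q}-E_{5+q,p}$ ($1\le p<q\le5$). The Lie algebra isomorphism $\nu:o(10,\mathbb{C})\to\mathcal{G}^{D_5}$ is determined by $E_{1,2}-E_{7,6}\mapsto E_{\alpha_1}$, $E_{2,3}-E_{8,7}\mapsto E_{\alpha_3}$, $E_{3,4}-E_{9,8}\mapsto E_{\alpha_4}$,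 $E_{4,5}-E_{10,9}\mapsto E_{\alpha_5}$, $E_{4,10}-E_{5,9}\mapsto E_{\alpha_2}$, $E_{2,1}-E_{6,7}\mapsto -E_{-\alpha_1}$, $E_{3,2}-E_{7,8}\mapsto -E_{-\alpha_3}$, $E_{4,3}-E_{8,9}\mapsto -E_{-\alpha_4}$, $E_{5,4}-E_{9,10}\mapsto -E_{-\alpha_5}$, $E_{10,4}-E_{9,5}\mapsto -E_{-\alpha_2}$. **Differential operators.** $\mathcal{A}=\mathbb{C}[x_1,\dots,x_{16}]$. For $u\in\mathcal{G}_0$ write $[u,\eta_i]=\sum_{j}\varphi_{i,j}(u)\eta_j$ and set $u|_{\mathcal{A}}=\sum_{i,j=1}^{16}\varphi_{i,j}(u)x_j\partial_{x_i}$. Let $D=\sum_{i=1}^{16}x_i\partial_{x_i}$ and $\zeta_1=x_1x_{11}+x_2x_9-x_3x_6+x_4x_5$, $\zeta_2=x_1x_{13}+x_2x_{10}-x_3x_8+x_5x_7$, $\zeta_3=x_1x_{14}+x_2x_{12}-x_4x_8+x_6x_7$, $\zeta_4=x_1x_{15}-x_3x_{12}+x_4x_{10}-x_7x_9$, $\zeta_5=-x_2x_{15}-x_3x_{14}+x_4x_{13}-x_7x_{11}$, $\zeta_6=x_7x_{16}+x_8x_{15}+x_{10}x_{14}-x_{12}x_{13}$, $\zeta_7=-x_4x_{16}-x_6x_{15}-x_9x_{14}+x_{11}x_{12}$, $\zeta_8=x_3x_{16}+x_5x_{15}+x_9x_{13}-x_{10}x_{11}$, $\zeta_9=x_2x_{16}-x_5x_{14}+x_6x_{13}-x_8x_{11}$,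 $\zeta_{10}=x_1x_{16}+x_5x_{12}-x_6x_{10}+x_8x_9$, $$P_i=x_iD-\sum_{k=1}^{10}\zeta_k\sum_{j=1}^{16}\frac{\partial^2\zeta_k}{\partial x_i\partial x_j}\,\partial_{x_j}\qquad(1\le i\le16).$$ **The action on $\widehat M$.** Let $M$ be an $o(10,\mathbb{C})$-module, $\widehat M=\mathcal{A}\otimes_{\mathbb{C}}M$, and write $fv=f\otimes v$. Let $\varrho_c:\mathcal{G}_0\to\mathrm{End}(M)$ be the linear map with $\varrho_c(u)v=\nu^{-1}(u)v$ for $u\in\mathcal{G}^{D_5}$ and $\varrho_c(\widehat\alpha)=2c\,\mathrm{id}_M$. The elements of $\mathcal{G}^{E_6}$ act on $\widehat M$ by $$\xi_i(fv)=\partial_{x_i}(f)\,v,\qquad u(fv)=(u|_{\mathcal{A}}f)\,v+f\,\varrho_c(u)v\ \ (u\in\mathcal{G}_0),\qquad \eta_i(fv)=P_i(f)\,v+\sum_{r=1}^{16}x_rf\,\varrho_c([\xi_r,\eta_i])v,$$ for $f\in\mathcal{A}$, $v\in M$, $1\le i\le16$. *)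

theory Defs
  imports "HOL-Analysis.Analysis" "HOL-Library.Poly_Mapping"
begin

section \<open>Complex vector spaces\<close>

class complex_vector = ab_group_add +
  fixes scaleC :: "complex \<Rightarrow> 'a \<Rightarrow> 'a"  (infixr \<open>*\<^sub>C\<close> 75)
  assumes scaleC_add_right: "c *\<^sub>C (x + y) = c *\<^sub>C x + c *\<^sub>C y"
    and scaleC_add_left: "(c + d) *\<^sub>C x = c *\<^sub>C x + d *\<^sub>C x"
    and scaleC_scaleC: "c *\<^sub>C d *\<^sub>C x = (c * d) *\<^sub>C x"
    and scaleC_one: "1 *\<^sub>C x = x"

interpretation complex_vector: vector_space "scaleC :: complex \<Rightarrow> 'a \<Rightarrow> 'a :: complex_vector"
  by unfold_locales (simp_all add: scaleC_add_right scaleC_add_left scaleC_scaleC scaleC_one)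

abbreviation clinear :: "('a::complex_vector \<Rightarrow> 'b::complex_vector) \<Rightarrow> bool"
  where "clinear \<equiv> Vector_Spaces.linear scaleC scaleC"

abbreviation cspan :: "'a::complex_vector set \<Rightarrow> 'a set"
  where "cspan \<equiv> module.span scaleC"

abbreviation csubspace :: "'a::complex_vector set \<Rightarrow> bool"
  where "csubspace \<equiv> module.subspace scaleC"

instantiation complex :: complex_vector
begin
definition scaleC_complex :: "complex \<Rightarrow> complex \<Rightarrow> complex"
  where "scaleC_complex = (*)"
instance by standard (simp_all add: scaleC_complex_def algebra_simps)
end

instantiation prod :: (complex_vector, complex_vector) complex_vector
begin
definition scaleC_prod :: "complex \<Rightarrow> 'a \<times> 'b \<Rightarrow> 'a \<times> 'b"
  where "scaleC_prod c x = (c *\<^sub>C fst x, c *\<^sub>C snd x)"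
instance
  by standard
    (simp_all add: scaleC_prod_def prod_eq_iff scaleC_add_right scaleC_add_left scaleC_scaleC scaleC_one)
end

instantiation vec :: (complex_vector, finite) complex_vector
begin
definition scaleC_vec :: "complex \<Rightarrow> 'a ^ 'b \<Rightarrow> 'a ^ 'b"
  where "scaleC_vec c x = (\<chi> i. c *\<^sub>C x $ i)"
instance
  by standard
    (simp_all add: scaleC_vec_def vec_eq_iff scaleC_add_right scaleC_add_left scaleC_scaleC scaleC_one)
end

instantiation poly_mapping :: (type, complex_vector) complex_vector
begin
definition scaleC_poly_mapping :: "complex \<Rightarrow> ('a \<Rightarrow>\<^sub>0 'b) \<Rightarrow> 'a \<Rightarrow>\<^sub>0 'b"
  where "scaleC_poly_mapping c p = Poly_Mapping.map (scaleC c) p"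

lemma lookup_scaleC: "Poly_Mapping.lookup (c *\<^sub>C p) k = c *\<^sub>C Poly_Mapping.lookup p k"
  for p :: "'a \<Rightarrow>\<^sub>0 'b"
  by (simp add: scaleC_poly_mapping_def Poly_Mapping.map.rep_eq when_def)

instance
  by standard
    (rule poly_mapping_eqI, simp add: lookup_scaleC lookup_add
      scaleC_add_right scaleC_add_left scaleC_scaleC scaleC_one)+
end


section \<open>Tensor products over the complex numbers\<close>

definition tensor_relations :: "(('a::complex_vector \<times> 'b::complex_vector) \<Rightarrow>\<^sub>0 complex) set"
  where "tensor_relations = cspan
    ({Poly_Mapping.single (a + a', b) 1 - Poly_Mapping.single (a, b) 1 - Poly_Mapping.single (a', b) 1
        |a a' b. True}
     \<union> {Poly_Mapping.single (a, b + b') 1 - Poly_Mapping.single (a, b) 1 - Poly_Mapping.single (a, b') 1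
        |a b b'. True}
     \<union> {Poly_Mapping.single (z *\<^sub>C a, b) 1 - z *\<^sub>C Poly_Mapping.single (a, b) 1 |z a b. True}
     \<union> {Poly_Mapping.single (a, z *\<^sub>C b) 1 - z *\<^sub>C Poly_Mapping.single (a, b) 1 |z a b. True})"

lemma subspace_tensor_relations: "csubspace tensor_relations"
  unfolding tensor_relations_def by (rule complex_vector.subspace_span)

definition tensor_rel ::
  "(('a::complex_vector \<times> 'b::complex_vector) \<Rightarrow>\<^sub>0 complex) \<Rightarrow> (('a \<times> 'b) \<Rightarrow>\<^sub>0 complex) \<Rightarrow> bool"
  where "tensor_rel p q \<longleftrightarrow> p - q \<in> tensor_relations"

lemma equivp_tensor_rel:
  "equivp (tensor_rel :: (('a::complex_vector \<times> 'b::complex_vector) \<Rightarrow>\<^sub>0 complex) \<Rightarrow> _)"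
proof (rule equivpI)
  show "reflp (tensor_rel :: (('a \<times> 'b) \<Rightarrow>\<^sub>0 complex) \<Rightarrow> _)"
    by (auto simp: reflp_def tensor_rel_def complex_vector.subspace_0[OF subspace_tensor_relations])
  show "symp (tensor_rel :: (('a \<times> 'b) \<Rightarrow>\<^sub>0 complex) \<Rightarrow> _)"
  proof (rule sympI)
    fix p q :: "('a \<times> 'b) \<Rightarrow>\<^sub>0 complex"
    assume "tensor_rel p q"
    then have "- (p - q) \<in> tensor_relations"
      unfolding tensor_rel_def by (rule complex_vector.subspace_neg[OF subspace_tensor_relations])
    then show "tensor_rel q p" by (simp add: tensor_rel_def)
  qed
  show "transp (tensor_rel :: (('a \<times> 'b) \<Rightarrow>\<^sub>0 complex) \<Rightarrow> _)"
  proof (rule transpI)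
    fix p q r :: "('a \<times> 'b) \<Rightarrow>\<^sub>0 complex"
    assume "tensor_rel p q" "tensor_rel q r"
    then have "(p - q) + (q - r) \<in> tensor_relations"
      unfolding tensor_rel_def by (rule complex_vector.subspace_add[OF subspace_tensor_relations])
    then show "tensor_rel p r" by (simp add: tensor_rel_def)
  qed
qed

quotient_type (overloaded) ('a, 'b) tensor =
  "('a::complex_vector \<times> 'b::complex_vector) \<Rightarrow>\<^sub>0 complex" / tensor_rel
  by (rule equivp_tensor_rel)

instantiation tensor :: (complex_vector, complex_vector) complex_vector
begin

lift_definition zero_tensor :: "('a, 'b) tensor" is 0 .

lift_definition plus_tensor :: "('a, 'b) tensor \<Rightarrow> ('a, 'b) tensor \<Rightarrow> ('a, 'b) tensor" is "(+)"
  unfolding tensor_rel_def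
  by (metis add_diff_add complex_vector.subspace_add[OF subspace_tensor_relations])

lift_definition uminus_tensor :: "('a, 'b) tensor \<Rightarrow> ('a, 'b) tensor" is uminus
  unfolding tensor_rel_def
  by (metis minus_diff_minus complex_vector.subspace_neg[OF subspace_tensor_relations])

lift_definition minus_tensor :: "('a, 'b) tensor \<Rightarrow> ('a, 'b) tensor \<Rightarrow> ('a, 'b) tensor" is "(-)"
proof -
  fix p p' q q' :: "('a \<times> 'b) \<Rightarrow>\<^sub>0 complex"
  assume "tensor_rel p p'" "tensor_rel q q'"
  then have "(p - p') - (q - q') \<in> tensor_relations"
    unfolding tensor_rel_def by (rule complex_vector.subspace_diff[OF subspace_tensor_relations])
  then show "tensor_rel (p - q) (p' - q')"
    by (simp add: tensor_rel_def algebra_simps)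
qed

lift_definition scaleC_tensor :: "complex \<Rightarrow> ('a, 'b) tensor \<Rightarrow> ('a, 'b) tensor" is scaleC
  unfolding tensor_rel_def
  by (metis complex_vector.scale_right_diff_distrib
      complex_vector.subspace_scale[OF subspace_tensor_relations])

instance
proof
  have refl: "tensor_rel p q" if "p = q" for p q :: "('a \<times> 'b) \<Rightarrow>\<^sub>0 complex"
    using that equivp_reflp[OF equivp_tensor_rel] by blast
  fix x y z :: "('a, 'b) tensor" and c d :: complex
  show "x + y + z = x + (y + z)" by transfer (simp add: refl add.assoc)
  show "x + y = y + x" by transfer (simp add: refl add.commute)
  show "0 + x = x" by transfer (simp add: refl)
  show "- x + x = 0" by transfer (simp add: refl)
  show "x - y = x + - y" by transfer (simp add: refl)
  show "c *\<^sub>C (x + y) = c *\<^sub>C x + c *\<^sub>C y" by transfer (simp add: refl scaleC_add_right)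
  show "(c + d) *\<^sub>C x = c *\<^sub>C x + d *\<^sub>C x" by transfer (simp add: refl scaleC_add_left)
  show "c *\<^sub>C d *\<^sub>C x = (c * d) *\<^sub>C x" by transfer (simp add: refl scaleC_scaleC)
  show "1 *\<^sub>C x = x" by transfer (simp add: refl scaleC_one)
qed

end

lift_definition tensor :: "'a::complex_vector \<Rightarrow> 'b::complex_vector \<Rightarrow> ('a, 'b) tensor"
    (infixr \<open>\<otimes>\<^sub>C\<close> 72)
  is "\<lambda>a b. Poly_Mapping.single (a, b) 1" .

definition tensor_map :: "('a::complex_vector \<Rightarrow> 'c::complex_vector) \<Rightarrow> ('b::complex_vector \<Rightarrow> 'd::complex_vector)
    \<Rightarrow> ('a, 'b) tensor \<Rightarrow> ('c, 'd) tensor"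
  where "tensor_map f g = (THE t. clinear t \<and> (\<forall>a b. t (a \<otimes>\<^sub>C b) = f a \<otimes>\<^sub>C g b))"


section \<open>Lie algebras, modules, homomorphisms\<close>

text \<open>A Lie algebra is a subspace \<open>L\<close> of an ambient complex vector space together with a bracket
  defined (at least) on \<open>L\<close>; the underlying space of a module is a whole type of class
  \<^class>\<open>complex_vector\<close>.\<close>

locale lie_algebra =
  fixes L :: "'l::complex_vector set" and br :: "'l \<Rightarrow> 'l \<Rightarrow> 'l"
  assumes subspace: "csubspace L"
    and bracket_closed: "\<lbrakk>x \<in> L; y \<in> L\<rbrakk> \<Longrightarrow> br x y \<in> L"
    and bracket_add_left: "\<lbrakk>x \<in> L; y \<in> L; z \<in> L\<rbrakk> \<Longrightarrow> br (x + y) z = br x z + br y z"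
    and bracket_add_right: "\<lbrakk>x \<in> L; y \<in> L; z \<in> L\<rbrakk> \<Longrightarrow> br x (y + z) = br x y + br x z"
    and bracket_scale_left: "\<lbrakk>x \<in> L; y \<in> L\<rbrakk> \<Longrightarrow> br (a *\<^sub>C x) y = a *\<^sub>C br x y"
    and bracket_scale_right: "\<lbrakk>x \<in> L; y \<in> L\<rbrakk> \<Longrightarrow> br x (a *\<^sub>C y) = a *\<^sub>C br x y"
    and bracket_self: "x \<in> L \<Longrightarrow> br x x = 0"
    and jacobi: "\<lbrakk>x \<in> L; y \<in> L; z \<in> L\<rbrakk> \<Longrightarrow> br x (br y z) + br y (br z x) + br z (br x y) = 0"

locale lie_module = lie_algebra L br
  for L :: "'l::complex_vector set" and br :: "'l \<Rightarrow> 'l \<Rightarrow> 'l" +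
  fixes act :: "'l \<Rightarrow> 'v::complex_vector \<Rightarrow> 'v"
  assumes act_linear: "x \<in> L \<Longrightarrow> clinear (act x)"
    and act_add: "\<lbrakk>x \<in> L; y \<in> L\<rbrakk> \<Longrightarrow> act (x + y) v = act x v + act y v"
    and act_scale: "x \<in> L \<Longrightarrow> act (a *\<^sub>C x) v = a *\<^sub>C act x v"
    and act_bracket: "\<lbrakk>x \<in> L; y \<in> L\<rbrakk> \<Longrightarrow> act (br x y) v = act x (act y v) - act y (act x v)"

locale lie_module_hom = M: lie_module L br actM + N: lie_module L br actN
  for L :: "'l::complex_vector set" and br :: "'l \<Rightarrow> 'l \<Rightarrow> 'l"
    and actM :: "'l \<Rightarrow> 'v::complex_vector \<Rightarrow> 'v" and actN :: "'l \<Rightarrow> 'w::complex_vector \<Rightarrow> 'w" +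
  fixes g :: "'v \<Rightarrow> 'w"
  assumes hom_linear: "clinear g"
    and hom_act: "x \<in> L \<Longrightarrow> g (actM x v) = actN x (g v)"

locale lie_algebra_iso = A: lie_algebra L br + B: lie_algebra L' br'
  for L :: "'l::complex_vector set" and br :: "'l \<Rightarrow> 'l \<Rightarrow> 'l"
    and L' :: "'k::complex_vector set" and br' :: "'k \<Rightarrow> 'k \<Rightarrow> 'k" +
  fixes f :: "'l \<Rightarrow> 'k"
  assumes bij: "bij_betw f L L'"
    and iso_add: "\<lbrakk>x \<in> L; y \<in> L\<rbrakk> \<Longrightarrow> f (x + y) = f x + f y"
    and iso_scale: "x \<in> L \<Longrightarrow> f (a *\<^sub>C x) = a *\<^sub>C f x"
    and iso_bracket: "\<lbrakk>x \<in> L; y \<in> L\<rbrakk> \<Longrightarrow> f (br x y) = br' (f x) (f y)"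


section \<open>The Lie algebra of type E6\<close>

text \<open>Throughout, objects numbered \<open>1, \<dots>, n\<close> are addressed by natural numbers, which are
  cast by \<^const>\<open>of_nat\<close> into the index type with \<open>n\<close> elements. In the index type
  \<open>6\<close> (likewise \<open>10\<close>, \<open>16\<close>) arithmetic is modulo 6, so \<open>6\<close> is the element \<open>0\<close>
  and \<open>1, \<dots>, 6\<close> enumerate it.\<close>

definition E6_edges :: "6 set set"
  where "E6_edges = {{1,3}, {3,4}, {4,5}, {5,6}, {2,4}}"

definition E6_cartan :: "6 \<Rightarrow> 6 \<Rightarrow> int"
  where "E6_cartan i j = (if i = j then 2 else if {i, j} \<in> E6_edges then -1 else 0)"

text \<open>Polymorphic, so that it is both the form on \<open>Q\<close> and its bilinear extension to \<open>H\<close>.\<close>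

definition E6_form :: "'a::comm_ring_1 ^ 6 \<Rightarrow> 'a ^ 6 \<Rightarrow> 'a"
  where "E6_form x y = (\<Sum>i\<in>UNIV. \<Sum>j\<in>UNIV. of_int (E6_cartan i j) * x $ i * y $ j)"

definition Phi_E6 :: "(int ^ 6) set"
  where "Phi_E6 = {\<alpha>. E6_form \<alpha> \<alpha> = 2}"

definition simple_root :: "nat \<Rightarrow> int ^ 6"
  where "simple_root i = axis (of_nat i) 1"

definition E6_cocycle :: "int ^ 6 \<Rightarrow> int ^ 6 \<Rightarrow> complex"
  where "E6_cocycle k l =
    (-1) powi ((\<Sum>i\<in>UNIV. k $ i * l $ i) + k $ 1 * l $ 3 + k $ 4 * l $ 2 + k $ 3 * l $ 4
               + k $ 5 * l $ 4 + k $ 6 * l $ 5)"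

lemma simple_root_in_Phi_E6: "simple_root i \<in> Phi_E6"
proof -
  have "E6_form (simple_root i) (simple_root i)
      = (\<Sum>a\<in>(UNIV::6 set). \<Sum>b\<in>(UNIV::6 set). if b = of_nat i then (if a = of_nat i then 2 else 0 :: int) else 0)"
    unfolding E6_form_def simple_root_def
    by (rule sum.cong, rule refl, rule sum.cong, rule refl) (auto simp: axis_def E6_cartan_def)
  then show ?thesis by (simp add: Phi_E6_def)
qed

typedef E6_root = Phi_E6
  morphisms root_vec Root
  using simple_root_in_Phi_E6 by blast

text \<open>\<open>H \<oplus> \<Oplus>\<^sub>\<alpha> \<complex>E\<^sub>\<alpha>\<close>, where \<open>H = \<complex>\<^sup>6\<close> in the basis of simple roots.\<close>

type_synonym E6 = "(complex ^ 6) \<times> (E6_root \<Rightarrow>\<^sub>0 complex)"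

definition complexify :: "int ^ 6 \<Rightarrow> complex ^ 6"
  where "complexify \<alpha> = (\<chi> i. of_int (\<alpha> $ i))"

definition cartan_elt :: "complex ^ 6 \<Rightarrow> E6"
  where "cartan_elt h = (h, 0)"

definition root_elt :: "E6_root \<Rightarrow> E6"
  where "root_elt a = (0, Poly_Mapping.single a 1)"

definition root_vector :: "int ^ 6 \<Rightarrow> E6"
  where "root_vector \<alpha> = root_elt (Root \<alpha>)"  \<comment> \<open>meaningful only for \<open>\<alpha> \<in> \<Phi>\<close>\<close>

definition bracket_roots :: "E6_root \<Rightarrow> E6_root \<Rightarrow> E6"
  where "bracket_roots a b =
    (let \<alpha> = root_vec a; \<beta> = root_vec b in
     if \<alpha> + \<beta> = 0 then - cartan_elt (complexify \<alpha>)
     else if \<alpha> + \<beta> \<in> Phi_E6 then E6_cocycle \<alpha> \<beta> *\<^sub>C root_vector (\<alpha> + \<beta>)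
     else 0)"

definition E6_bracket :: "E6 \<Rightarrow> E6 \<Rightarrow> E6"
  where "E6_bracket x y =
    (\<Sum>b\<in>Poly_Mapping.keys (snd y).
       (Poly_Mapping.lookup (snd y) b * E6_form (fst x) (complexify (root_vec b))) *\<^sub>C root_elt b)
    - (\<Sum>a\<in>Poly_Mapping.keys (snd x).
       (Poly_Mapping.lookup (snd x) a * E6_form (fst y) (complexify (root_vec a))) *\<^sub>C root_elt a)
    + (\<Sum>a\<in>Poly_Mapping.keys (snd x). \<Sum>b\<in>Poly_Mapping.keys (snd y).
         (Poly_Mapping.lookup (snd x) a * Poly_Mapping.lookup (snd y) b) *\<^sub>C bracket_roots a b)"

definition Phi_D5 :: "(int ^ 6) set"
  where "Phi_D5 = Phi_E6 \<inter> {\<Sum>i=1..5. k i *s simple_root i |k. True}"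

definition G_D5 :: "E6 set"
  where "G_D5 = cspan ((\<lambda>i. cartan_elt (complexify (simple_root i))) ` {1..5} \<union> root_vector ` Phi_D5)"

definition G_0 :: "E6 set"
  where "G_0 = {u + z *\<^sub>C cartan_elt (complexify (simple_root 6)) |u z. u \<in> G_D5}"

definition alpha_hat :: E6
  where "alpha_hat = cartan_elt (complexify
    (2 *s simple_root 1 + 3 *s simple_root 2 + 4 *s simple_root 3
     + 6 *s simple_root 4 + 5 *s simple_root 5 + 4 *s simple_root 6))"

definition beta :: "nat \<Rightarrow> int ^ 6"
  where "beta i = (let a1 = simple_root 1; a2 = simple_root 2; a3 = simple_root 3;
                       a4 = simple_root 4; a5 = simple_root 5; a6 = simple_root 6 in
    [a6,
     a5 + a6,
     a4 + a5 + a6,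
     a3 + a4 + a5 + a6,
     a2 + a4 + a5 + a6,
     a2 + a3 + a4 + a5 + a6,
     a1 + a3 + a4 + a5 + a6,
     a1 + a2 + a3 + a4 + a5 + a6,
     a2 + a3 + 2 *s a4 + a5 + a6,
     a1 + a2 + a3 + 2 *s a4 + a5 + a6,
     a2 + a3 + 2 *s a4 + 2 *s a5 + a6,
     a1 + a2 + 2 *s a3 + 2 *s a4 + a5 + a6,
     a1 + a2 + a3 + 2 *s a4 + 2 *s a5 + a6,
     a1 + a2 + 2 *s a3 + 2 *s a4 + 2 *s a5 + a6,
     a1 + a2 + 2 *s a3 + 3 *s a4 + 2 *s a5 + a6,
     a1 + 2 *s a2 + 2 *s a3 + 3 *s a4 + 2 *s a5 + a6] ! (i - 1))"

definition xi :: "nat \<Rightarrow> E6"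
  where "xi i = root_vector (beta i)"

definition eta :: "nat \<Rightarrow> E6"
  where "eta i = root_vector (- beta i)"


section \<open>The orthogonal Lie algebra and its identification with the D5 subalgebra\<close>

definition matrix_unit :: "nat \<Rightarrow> nat \<Rightarrow> complex ^ 10 ^ 10"
  where "matrix_unit p q = (\<chi> r s. if r = of_nat p \<and> s = of_nat q then 1 else 0)"

definition o10 :: "(complex ^ 10 ^ 10) set"
  where "o10 = cspan
    ({matrix_unit i j - matrix_unit (5 + j) (5 + i) |i j. i \<in> {1..5} \<and> j \<in> {1..5}}
     \<union> {matrix_unit p (5 + q) - matrix_unit q (5 + p) |p q. 1 \<le> p \<and> p < q \<and> q \<le> 5}
     \<union> {matrix_unit (5 + p) q - matrix_unit (5 + q) p |p q. 1 \<le> p \<and> p < q \<and> q \<le> 5})"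

definition commutator :: "complex ^ 'n ^ 'n \<Rightarrow> complex ^ 'n ^ 'n \<Rightarrow> complex ^ 'n ^ 'n"
  where "commutator A B = A ** B - B ** A"

definition is_nu :: "(complex ^ 10 ^ 10 \<Rightarrow> E6) \<Rightarrow> bool"
  where "is_nu f \<longleftrightarrow> lie_algebra_iso o10 commutator G_D5 E6_bracket f
    \<and> f (matrix_unit 1 2 - matrix_unit 7 6) = root_vector (simple_root 1)
    \<and> f (matrix_unit 2 3 - matrix_unit 8 7) = root_vector (simple_root 3)
    \<and> f (matrix_unit 3 4 - matrix_unit 9 8) = root_vector (simple_root 4)
    \<and> f (matrix_unit 4 5 - matrix_unit 10 9) = root_vector (simple_root 5)
    \<and> f (matrix_unit 4 10 - matrix_unit 5 9) = root_vector (simple_root 2)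
    \<and> f (matrix_unit 2 1 - matrix_unit 6 7) = - root_vector (- simple_root 1)
    \<and> f (matrix_unit 3 2 - matrix_unit 7 8) = - root_vector (- simple_root 3)
    \<and> f (matrix_unit 4 3 - matrix_unit 8 9) = - root_vector (- simple_root 4)
    \<and> f (matrix_unit 5 4 - matrix_unit 9 10) = - root_vector (- simple_root 5)
    \<and> f (matrix_unit 10 4 - matrix_unit 9 5) = - root_vector (- simple_root 2)"

text \<open>The prescribed values, on Lie algebra generators, determine the isomorphism on \<^const>\<open>o10\<close>;
  its (irrelevant) values on other matrices are left to the choice operator.\<close>

definition nu :: "complex ^ 10 ^ 10 \<Rightarrow> E6"
  where "nu = (SOME f. is_nu f)"


section \<open>Polynomials in 16 variables and the differential operators\<close>

type_synonym poly16 = "(16 \<Rightarrow>\<^sub>0 nat) \<Rightarrow>\<^sub>0 complex"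

definition x_var :: "nat \<Rightarrow> poly16"
  where "x_var i = Poly_Mapping.single (Poly_Mapping.single (of_nat i) 1) 1"

definition pd :: "nat \<Rightarrow> poly16 \<Rightarrow> poly16"
  where "pd i f = (\<Sum>m\<in>Poly_Mapping.keys f.
    Poly_Mapping.single (m - Poly_Mapping.single (of_nat i) 1)
      (of_nat (Poly_Mapping.lookup m (of_nat i)) * Poly_Mapping.lookup f m))"

text \<open>For \<open>u \<in> \<G>\<^sub>0\<close> the bracket \<open>[u, \<eta>\<^sub>i]\<close> lies in the span of the \<open>\<eta>\<^sub>j = E\<^bsub>-\<beta>\<^sub>j\<^esub>\<close>, and
  \<open>\<phi>\<^sub>i\<^sub>,\<^sub>j(u)\<close> is its \<open>\<eta>\<^sub>j\<close>-coefficient.\<close>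

definition phi :: "nat \<Rightarrow> nat \<Rightarrow> E6 \<Rightarrow> complex"
  where "phi i j u = Poly_Mapping.lookup (snd (E6_bracket u (eta i))) (Root (- beta j))"

definition restr_A :: "E6 \<Rightarrow> poly16 \<Rightarrow> poly16"
  where "restr_A u f = (\<Sum>i=1..16. \<Sum>j=1..16. phi i j u *\<^sub>C (x_var j * pd i f))"

definition euler_D :: "poly16 \<Rightarrow> poly16"
  where "euler_D f = (\<Sum>i=1..16. x_var i * pd i f)"

definition zeta :: "nat \<Rightarrow> poly16"
  where "zeta k =
    [x_var 1 * x_var 11 + x_var 2 * x_var 9 - x_var 3 * x_var 6 + x_var 4 * x_var 5,
     x_var 1 * x_var 13 + x_var 2 * x_var 10 - x_var 3 * x_var 8 + x_var 5 * x_var 7,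
     x_var 1 * x_var 14 + x_var 2 * x_var 12 - x_var 4 * x_var 8 + x_var 6 * x_var 7,
     x_var 1 * x_var 15 - x_var 3 * x_var 12 + x_var 4 * x_var 10 - x_var 7 * x_var 9,
     - (x_var 2 * x_var 15) - x_var 3 * x_var 14 + x_var 4 * x_var 13 - x_var 7 * x_var 11,
     x_var 7 * x_var 16 + x_var 8 * x_var 15 + x_var 10 * x_var 14 - x_var 12 * x_var 13,
     - (x_var 4 * x_var 16) - x_var 6 * x_var 15 - x_var 9 * x_var 14 + x_var 11 * x_var 12,
     x_var 3 * x_var 16 + x_var 5 * x_var 15 + x_var 9 * x_var 13 - x_var 10 * x_var 11,
     x_var 2 * x_var 16 - x_var 5 * x_var 14 + x_var 6 * x_var 13 - x_var 8 * x_var 11,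
     x_var 1 * x_var 16 + x_var 5 * x_var 12 - x_var 6 * x_var 10 + x_var 8 * x_var 9] ! (k - 1)"

definition P_op :: "nat \<Rightarrow> poly16 \<Rightarrow> poly16"
  where "P_op i f = x_var i * euler_D f
    - (\<Sum>k=1..10. zeta k * (\<Sum>j=1..16. pd i (pd j (zeta k)) * pd j f))"


section \<open>The induced module\<close>

text \<open>In \<open>\<G>\<^sub>0 = \<G>\<^sup>D\<^sup>5 \<oplus> \<complex>\<alpha>\<close>, with \<open>\<alpha>\<close> for \<^const>\<open>alpha_hat\<close>, only \<open>\<alpha>\<close> has a component along
  the sixth simple root, which gives the coefficient of \<open>\<alpha>\<close> in \<open>u\<close>.\<close>

definition alpha_hat_coeff :: "E6 \<Rightarrow> complex"
  where "alpha_hat_coeff u = fst u $ 6 / fst alpha_hat $ 6"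

definition varrho :: "complex \<Rightarrow> (complex ^ 10 ^ 10 \<Rightarrow> 'm \<Rightarrow> 'm) \<Rightarrow> E6 \<Rightarrow> 'm::complex_vector \<Rightarrow> 'm"
  where "varrho c \<rho> u v = (let a = alpha_hat_coeff u in
    \<rho> (inv_into o10 nu (u - a *\<^sub>C alpha_hat)) v + a *\<^sub>C (2 * c) *\<^sub>C v)"

definition hat_formulas :: "complex \<Rightarrow> (complex ^ 10 ^ 10 \<Rightarrow> 'm \<Rightarrow> 'm)
    \<Rightarrow> (E6 \<Rightarrow> (poly16, 'm::complex_vector) tensor \<Rightarrow> (poly16, 'm) tensor) \<Rightarrow> bool"
  where "hat_formulas c \<rho> T \<longleftrightarrow>
    (\<forall>u. clinear (T u)) \<and> (\<forall>w. clinear (\<lambda>u. T u w)) \<and>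
    (\<forall>i\<in>{1..16}. \<forall>f v. T (xi i) (f \<otimes>\<^sub>C v) = pd i f \<otimes>\<^sub>C v) \<and>
    (\<forall>u\<in>G_0. \<forall>f v. T u (f \<otimes>\<^sub>C v) = restr_A u f \<otimes>\<^sub>C v + f \<otimes>\<^sub>C varrho c \<rho> u v) \<and>
    (\<forall>i\<in>{1..16}. \<forall>f v. T (eta i) (f \<otimes>\<^sub>C v) =
       P_op i f \<otimes>\<^sub>C v + (\<Sum>r=1..16. (x_var r * f) \<otimes>\<^sub>C varrho c \<rho> (E6_bracket (xi r) (eta i)) v))"

definition hat_act :: "complex \<Rightarrow> (complex ^ 10 ^ 10 \<Rightarrow> 'm \<Rightarrow> 'm)
    \<Rightarrow> E6 \<Rightarrow> (poly16, 'm::complex_vector) tensor \<Rightarrow> (poly16, 'm) tensor"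
  where "hat_act c \<rho> = (THE T. hat_formulas c \<rho> T)"

end

theory Submission
  imports Defs
begin

text \<open>Only the brackets of \<open>\<xi>\<close>'s and of \<open>\<G>\<^sub>0\<close> with each other, and \<open>[\<xi>\<^sub>r, \<eta>\<^sub>i]\<close>, need to be
  verified on \<open>\<A> \<otimes> M\<close>. Indeed, for \<open>y = \<eta>\<^sub>i\<close> and \<open>u\<close> in \<open>\<G>\<^sub>0\<close> or \<open>u = \<eta>\<^sub>j\<close>, the Jacobi identity shows
  that the defect \<open>u y - y u - [u, y]\<close> commutes with every \<open>\<partial>\<^sub>r\<close>; since it raises the polynomial degree,
  Euler's identity kills it by induction on the degree. The relation for \<open>[\<xi>\<^sub>r, \<eta>\<^sub>i]\<close> is equivalent to
  \<open>\<phi>\<^sub>s\<^sub>j([\<xi>\<^sub>r, \<eta>\<^sub>i]) = \<delta>\<^sub>i\<^sub>r \<delta>\<^sub>s\<^sub>j + \<delta>\<^sub>i\<^sub>j \<delta>\<^sub>s\<^sub>r - \<Sum>\<^sub>k \<partial>\<^sub>i\<partial>\<^sub>s\<zeta>\<^sub>k \<cdot> \<partial>\<^sub>r\<partial>\<^sub>j\<zeta>\<^sub>k\<close>. If \<open>(\<beta>\<^sub>i, \<beta>\<^sub>s) > 0\<close> no \<open>\<zeta>\<^sub>k\<close> contains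
  \<open>x\<^sub>i x\<^sub>s\<close> and this follows from the root relations; otherwise exactly one does, and it remains to compare
  signs for pairs of monomials of the same \<open>\<zeta>\<^sub>k\<close>. The Jacobi identity of \<open>\<G>\<close> is the usual consequence of
  the bimultiplicativity of \<open>F\<close>, and \<open>\<nu>\<close> is written down on a basis.\<close>

section \<open>The root lattice\<close>

text \<open>A direct check of the brackets [u, \<eta>_i] and [\<eta>_i, \<eta>_j] would mix
  high-degree polynomial identities with an arbitrary \<rho>. The annihilation argument avoids this
  but needs a defect of positive degree, so the brackets of total degree at most 0 are exactly those
  computed by hand. The quadrics have a structural origin. The sixteen \<beta>_i are the weights of
  a half-spin representation of D5, up to their \<alpha>_6 part; among them there are 40 unordered
  orthogonal pairs, whose sums take ten values, four pairs each. One \<zeta>_k collects the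
  monomials x_i x_s with a given \<beta>_i + \<beta>_s, so a Hessian entry is nonzero exactly on an
  orthogonal pair and is then a sign. Grades are read off from one element: \<open>alpha_hat\<close>
  multiplies \<open>E_\<alpha>\<close> by three times the \<alpha>_6-coefficient of \<alpha>, which
  turns membership and closure into eigenvalue statements. Both \<open>nu\<close> and
  \<open>hat_act\<close> are descriptions, so nothing can be derived from them before explicit
  witnesses exist.\<close>

lemma UNIV_6: "(UNIV :: 6 set) = {1, 2, 3, 4, 5, 6}"
proof -
  have "x \<in> {1, 2, 3, 4, 5, 6}" for x :: 6
  proof (cases x)
    case (of_int z)
    \<comment> \<open>The representatives are 0 to 5, and in this type \<open>0\<close> and
      \<open>6\<close> are the same element.\<close>
    then have "z \<in> {0, 1, 2, 3, 4, 5}" by auto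
    then show ?thesis using of_int by auto
  qed
  then show ?thesis by auto
qed

lemma sum_6: "(\<Sum>i\<in>(UNIV :: 6 set). f i) = f 1 + f 2 + f 3 + f 4 + f 5 + (f 6 :: 'a::comm_monoid_add)"
  unfolding UNIV_6 by (simp add: add.assoc)

lemma forall_6: "(\<forall>i :: 6. P i) \<longleftrightarrow> P 1 \<and> P 2 \<and> P 3 \<and> P 4 \<and> P 5 \<and> P 6"
  by (metis UNIV_6 UNIV_I insertE singletonD)

lemma E6_form_6:
  "E6_form x y = 2 * (x $ 1 * y $ 1 + x $ 2 * y $ 2 + x $ 3 * y $ 3 + x $ 4 * y $ 4 + x $ 5 * y $ 5 + x $ 6 * y $ 6)
    - (x $ 1 * y $ 3 + x $ 3 * y $ 1) - (x $ 3 * y $ 4 + x $ 4 * y $ 3) - (x $ 4 * y $ 5 + x $ 5 * y $ 4)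
    - (x $ 5 * y $ 6 + x $ 6 * y $ 5) - (x $ 2 * y $ 4 + x $ 4 * y $ 2)"
  unfolding E6_form_def
  by (simp add: sum_6 E6_cartan_def E6_edges_def doubleton_eq_iff algebra_simps)

lemma E6_form_add_left: "E6_form (x + y) z = E6_form x z + E6_form y z"
  and E6_form_add_right: "E6_form z (x + y) = E6_form z x + E6_form z y"
  and E6_form_diff_left: "E6_form (x - y) z = E6_form x z - E6_form y z"
  and E6_form_diff_right: "E6_form z (x - y) = E6_form z x - E6_form z y"
  and E6_form_minus_left: "E6_form (- x) z = - E6_form x z"
  and E6_form_minus_right: "E6_form z (- x) = - E6_form z x"
  and E6_form_zero_left: "E6_form 0 z = 0"
  and E6_form_zero_right: "E6_form z 0 = 0"
  by (simp_all add: E6_form_6 algebra_simps)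

lemmas E6_form_simps = E6_form_add_left E6_form_add_right E6_form_diff_left E6_form_diff_right
  E6_form_minus_left E6_form_minus_right E6_form_zero_left E6_form_zero_right

lemma E6_form_scale_left: "E6_form (a *\<^sub>C x) z = a * E6_form x z"
  by (simp add: E6_form_6 scaleC_vec_def scaleC_complex_def algebra_simps)

lemma E6_form_commute: "E6_form x y = E6_form y x"
  by (simp add: E6_form_6 algebra_simps)

lemma complexify_add: "complexify (x + y) = complexify x + complexify y"
  and complexify_minus: "complexify (- x) = - complexify x"
  and complexify_diff: "complexify (x - y) = complexify x - complexify y"
  and complexify_zero: "complexify 0 = 0"
  by (simp_all add: complexify_def vec_eq_iff)

lemma E6_form_complexify: "E6_form (complexify x) (complexify y) = of_int (E6_form x y)"
  by (simp add: E6_form_6 complexify_def)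

text \<open>Completing squares in an orthogonal basis of the \<open>D\<^sub>5\<close> sublattice.\<close>

lemma E6_form_squares:
  fixes k :: "int ^ 6"
  shows "4 * E6_form k k = (2 * k $ 1 - k $ 6)\<^sup>2 + (2 * (k $ 3 - k $ 1) - k $ 6)\<^sup>2
    + (2 * (k $ 4 - k $ 3) - k $ 6)\<^sup>2 + (2 * (k $ 5 + k $ 2 - k $ 4) - k $ 6)\<^sup>2
    + (2 * (k $ 2 - k $ 5) + k $ 6)\<^sup>2 + 3 * (k $ 6)\<^sup>2"
  by (simp add: E6_form_6 power2_eq_square algebra_simps)

lemma E6_form_nonneg: "E6_form k k \<ge> 0" for k :: "int ^ 6"
proof -
  have "4 * E6_form k k \<ge> 0" unfolding E6_form_squares by simp
  then show ?thesis by simp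
qed

lemma E6_form_eq_0_iff: "E6_form k k = 0 \<longleftrightarrow> k = 0" for k :: "int ^ 6"
proof
  have squares: "a = 0 \<and> b = 0 \<and> c = 0 \<and> d = 0 \<and> e = 0 \<and> f = 0"
    if "a\<^sup>2 + b\<^sup>2 + c\<^sup>2 + d\<^sup>2 + e\<^sup>2 + 3 * f\<^sup>2 = 0" for a b c d e f :: int
    using that by (simp add: add_nonneg_eq_0_iff)
  assume "E6_form k k = 0"
  then have "4 * E6_form k k = 0" by simp
  note squares[OF this[unfolded E6_form_squares]]
  then show "k = 0" by (auto simp: vec_eq_iff forall_6)
qed (simp add: E6_form_zero_left)

lemma Phi_E6_uminus: "\<alpha> \<in> Phi_E6 \<Longrightarrow> - \<alpha> \<in> Phi_E6"
  by (simp add: Phi_E6_def E6_form_simps)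

lemma zero_notin_Phi_E6: "0 \<notin> Phi_E6"
  by (simp add: Phi_E6_def E6_form_simps)

text \<open>The norms of \<alpha> + \<beta> and \<alpha> - \<beta> are 4 + 2(\<alpha>, \<beta>) and
  4 - 2(\<alpha>, \<beta>); positive definiteness bounds the form, and the extreme values occur when
  one of these vectors vanishes.\<close>

lemma Phi_E6_form_range:
  assumes "\<alpha> \<in> Phi_E6" "\<beta> \<in> Phi_E6"
  shows "E6_form \<alpha> \<beta> \<in> {-2, -1, 0, 1, 2}"
    and "E6_form \<alpha> \<beta> = -2 \<longleftrightarrow> \<alpha> + \<beta> = 0"
    and "E6_form \<alpha> \<beta> = 2 \<longleftrightarrow> \<alpha> = \<beta>"
    and "\<alpha> + \<beta> \<in> Phi_E6 \<longleftrightarrow> E6_form \<alpha> \<beta> = -1"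
proof -
  have p: "E6_form (\<alpha> + \<beta>) (\<alpha> + \<beta>) = 4 + 2 * E6_form \<alpha> \<beta>"
    and m: "E6_form (\<alpha> - \<beta>) (\<alpha> - \<beta>) = 4 - 2 * E6_form \<alpha> \<beta>"
    using assms E6_form_commute[of \<alpha> \<beta>] by (simp_all add: Phi_E6_def E6_form_simps)
  show "E6_form \<alpha> \<beta> \<in> {-2, -1, 0, 1, 2}"
    using p m E6_form_nonneg[of "\<alpha> + \<beta>"] E6_form_nonneg[of "\<alpha> - \<beta>"] by auto
  show "E6_form \<alpha> \<beta> = -2 \<longleftrightarrow> \<alpha> + \<beta> = 0"
    using p E6_form_eq_0_iff[of "\<alpha> + \<beta>"] by auto
  show "E6_form \<alpha> \<beta> = 2 \<longleftrightarrow> \<alpha> = \<beta>"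
    using m E6_form_eq_0_iff[of "\<alpha> - \<beta>"] by auto
  show "\<alpha> + \<beta> \<in> Phi_E6 \<longleftrightarrow> E6_form \<alpha> \<beta> = -1"
    using p by (auto simp: Phi_E6_def)
qed

section \<open>The cocycle as a bimultiplicative sign\<close>

lemma minus_one_powi_add: "(-1 :: complex) powi (a + b) = (-1) powi a * (-1) powi b"
  by (rule power_int_add) simp

lemma minus_one_powi_minus: "(-1 :: complex) powi (- a) = (-1) powi a"
  by (simp add: power_int_minus_left)

lemma E6_cocycle_add_left: "E6_cocycle (x + y) z = E6_cocycle x z * E6_cocycle y z"
  unfolding E6_cocycle_def minus_one_powi_add[symmetric]
  by (rule arg_cong[where f = "\<lambda>n. (-1) powi n"]) (simp add: sum.distrib algebra_simps)

lemma E6_cocycle_add_right: "E6_cocycle z (x + y) = E6_cocycle z x * E6_cocycle z y"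
  unfolding E6_cocycle_def minus_one_powi_add[symmetric]
  by (rule arg_cong[where f = "\<lambda>n. (-1) powi n"]) (simp add: sum.distrib algebra_simps)

lemma E6_cocycle_minus_left: "E6_cocycle (- x) y = E6_cocycle x y"
  unfolding E6_cocycle_def
  by (subst (2) minus_one_powi_minus[symmetric]) (simp add: sum_negf algebra_simps)

lemma E6_cocycle_minus_right: "E6_cocycle x (- y) = E6_cocycle x y"
  unfolding E6_cocycle_def
  by (subst (2) minus_one_powi_minus[symmetric]) (simp add: sum_negf algebra_simps)

lemma E6_cocycle_diff_left: "E6_cocycle (x - y) z = E6_cocycle x z * E6_cocycle y z"
  using E6_cocycle_add_left[of x "- y" z] by (simp add: E6_cocycle_minus_left)

lemma E6_cocycle_diff_right: "E6_cocycle z (x - y) = E6_cocycle z x * E6_cocycle z y"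
  using E6_cocycle_add_right[of z x "- y"] by (simp add: E6_cocycle_minus_right)

lemmas E6_cocycle_simps = E6_cocycle_add_left E6_cocycle_add_right E6_cocycle_minus_left
  E6_cocycle_minus_right E6_cocycle_diff_left E6_cocycle_diff_right

lemma E6_cocycle_cases: "E6_cocycle x y = 1 \<or> E6_cocycle x y = -1"
  unfolding E6_cocycle_def by (subst (1 2) power_int_minus_left) simp

text \<open>The mixed terms of the exponent use each edge of the diagram once, in one orientation.
  At (\<alpha>, \<alpha>) the exponent is therefore congruent modulo 2 to half the norm, which is 1
  for a root.\<close>

lemma E6_cocycle_self: "\<alpha> \<in> Phi_E6 \<Longrightarrow> E6_cocycle \<alpha> \<alpha> = -1"
proof -
  assume "\<alpha> \<in> Phi_E6"
  then have *: "(\<alpha> $ 1 * \<alpha> $ 1 + \<alpha> $ 2 * \<alpha> $ 2 + \<alpha> $ 3 * \<alpha> $ 3 + \<alpha> $ 4 * \<alpha> $ 4 + \<alpha> $ 5 * \<alpha> $ 5 + \<alpha> $ 6 * \<alpha> $ 6)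
      = 1 + \<alpha> $ 1 * \<alpha> $ 3 + \<alpha> $ 3 * \<alpha> $ 4 + \<alpha> $ 4 * \<alpha> $ 5 + \<alpha> $ 5 * \<alpha> $ 6 + \<alpha> $ 2 * \<alpha> $ 4"
    by (simp add: Phi_E6_def E6_form_6 algebra_simps)
  have "(\<Sum>i\<in>UNIV. \<alpha> $ i * \<alpha> $ i) + \<alpha> $ 1 * \<alpha> $ 3 + \<alpha> $ 4 * \<alpha> $ 2 + \<alpha> $ 3 * \<alpha> $ 4
               + \<alpha> $ 5 * \<alpha> $ 4 + \<alpha> $ 6 * \<alpha> $ 5
     = 1 + 2 * (\<alpha> $ 1 * \<alpha> $ 3 + \<alpha> $ 3 * \<alpha> $ 4 + \<alpha> $ 4 * \<alpha> $ 5 + \<alpha> $ 5 * \<alpha> $ 6 + \<alpha> $ 2 * \<alpha> $ 4)" (is "_ = 1 + 2 * ?s")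
    unfolding sum_6 * by (simp add: algebra_simps)
  moreover have "(-1 :: complex) powi (1 + 2 * ?s) = -1"
    by (subst power_int_minus_left) simp
  ultimately show ?thesis unfolding E6_cocycle_def by simp
qed

text \<open>Adding the exponents for the two orders makes the diagonal terms even and uses each edge
  in both orientations, which is the form modulo 2.\<close>

lemma E6_cocycle_commute: "E6_cocycle y x = (-1) powi (E6_form x y) * E6_cocycle x y"
proof -
  have per: "(-1 :: complex) powi a = (-1) powi b" if "even (a - b)" for a b
    using that by (subst (1 2) power_int_minus_left) auto
  show ?thesis
    unfolding E6_cocycle_def minus_one_powi_add[symmetric]
    by (rule per) (simp add: E6_form_6 sum_6 algebra_simps)
qed

section \<open>The Lie algebra\<close>

interpretation clinear: vector_space_pair
  "scaleC :: complex \<Rightarrow> 'a \<Rightarrow> 'a::complex_vector" "scaleC :: complex \<Rightarrow> 'b \<Rightarrow> 'b::complex_vector"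
  by unfold_locales

lemma clinearI:
  assumes "\<And>x y. f (x + y) = f x + f y" "\<And>z x. f (z *\<^sub>C x) = z *\<^sub>C f x"
  shows "clinear f"
  unfolding Vector_Spaces.linear_iff by (intro conjI allI complex_vector.vector_space_axioms assms)

section \<open>Finiteness of the root system\<close>

lemma Phi_E6_bounds:
  assumes "k \<in> Phi_E6"
  shows "\<bar>2 * k $ 1 - k $ 6\<bar> \<le> 2" "\<bar>2 * (k $ 3 - k $ 1) - k $ 6\<bar> \<le> 2"
    "\<bar>2 * (k $ 4 - k $ 3) - k $ 6\<bar> \<le> 2" "\<bar>2 * (k $ 5 + k $ 2 - k $ 4) - k $ 6\<bar> \<le> 2"
    "\<bar>2 * (k $ 2 - k $ 5) + k $ 6\<bar> \<le> 2" "\<bar>k $ 6\<bar> \<le> 1"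
proof -
  \<comment> \<open>With total 8, each of the first five squares is at most 8, and so is three times
    the last one.\<close>
  have *: "(2 * k $ 1 - k $ 6)\<^sup>2 + (2 * (k $ 3 - k $ 1) - k $ 6)\<^sup>2
    + (2 * (k $ 4 - k $ 3) - k $ 6)\<^sup>2 + (2 * (k $ 5 + k $ 2 - k $ 4) - k $ 6)\<^sup>2
    + (2 * (k $ 2 - k $ 5) + k $ 6)\<^sup>2 + 3 * (k $ 6)\<^sup>2 = 8"
    using assms E6_form_squares[of k] by (simp add: Phi_E6_def)
  have small: "\<bar>a\<bar> \<le> 2 \<and> \<bar>b\<bar> \<le> 2 \<and> \<bar>c\<bar> \<le> 2 \<and> \<bar>d\<bar> \<le> 2 \<and> \<bar>e\<bar> \<le> 2 \<and> \<bar>f\<bar> \<le> 1"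
    if "a\<^sup>2 + b\<^sup>2 + c\<^sup>2 + d\<^sup>2 + e\<^sup>2 + 3 * f\<^sup>2 = 8" for a b c d e f :: int
  proof -
    have nn: "0 \<le> a\<^sup>2" "0 \<le> b\<^sup>2" "0 \<le> c\<^sup>2" "0 \<le> d\<^sup>2" "0 \<le> e\<^sup>2" "0 \<le> f\<^sup>2" by simp_all
    have 2: "\<bar>x\<bar> \<le> 2" if "x\<^sup>2 \<le> 8" for x :: int
    proof (rule ccontr)
      assume "\<not> \<bar>x\<bar> \<le> 2" then have "3\<^sup>2 \<le> \<bar>x\<bar>\<^sup>2" by (intro power_mono) auto
      with that show False by simp
    qed
    have 1: "\<bar>x\<bar> \<le> 1" if "3 * x\<^sup>2 \<le> 8" for x :: int
    proof (rule ccontr)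
      assume "\<not> \<bar>x\<bar> \<le> 1" then have "2\<^sup>2 \<le> \<bar>x\<bar>\<^sup>2" by (intro power_mono) auto
      with that show False by simp
    qed
    show ?thesis by (intro conjI 1 2) (use nn that in linarith)+
  qed
  show "\<bar>2 * k $ 1 - k $ 6\<bar> \<le> 2" "\<bar>2 * (k $ 3 - k $ 1) - k $ 6\<bar> \<le> 2"
    "\<bar>2 * (k $ 4 - k $ 3) - k $ 6\<bar> \<le> 2" "\<bar>2 * (k $ 5 + k $ 2 - k $ 4) - k $ 6\<bar> \<le> 2"
    "\<bar>2 * (k $ 2 - k $ 5) + k $ 6\<bar> \<le> 2" "\<bar>k $ 6\<bar> \<le> 1"
    using small[OF *] by blast+
qed

text \<open>Makes \<open>E6_root\<close> a finite type, so that elements of the algebra are sums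
  over all roots and the bracket need not refer to supports. The box below is generous: successive
  bounds on the differences of coordinates give smaller ones.\<close>

lemma finite_Phi_E6: "finite Phi_E6"
proof -
  have "Phi_E6 \<subseteq> {k. \<forall>i. k $ i \<in> {-6..6}}"
  proof
    fix k :: "int ^ 6" assume "k \<in> Phi_E6"
    note b = Phi_E6_bounds[OF this, unfolded abs_le_iff, THEN conjunct1]
      Phi_E6_bounds[OF this, unfolded abs_le_iff, THEN conjunct2]
    show "k \<in> {k. \<forall>i. k $ i \<in> {-6..6}}"
      unfolding mem_Collect_eq forall_6 atLeastAtMost_iff
      using b by (smt (verit))
  qed
  moreover have "finite {k :: int ^ 6. \<forall>i. k $ i \<in> {-6..6}}"
  proof -
    have "inj_on (\<lambda>k :: int ^ 6. ($) k) A" for A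
      by (auto simp: inj_on_def vec_eq_iff)
    moreover have "(\<lambda>k :: int ^ 6. ($) k) ` {k. \<forall>i. k $ i \<in> {-6..6}} \<subseteq> PiE UNIV (\<lambda>_. {-6..6})"
      by auto
    ultimately show ?thesis
      by (meson finite_PiE finite finite_atLeastAtMost_int inj_on_finite)
  qed
  ultimately show ?thesis by (rule finite_subset)
qed

lemma finite_UNIV_E6_root: "finite (UNIV :: E6_root set)"
proof -
  have "(UNIV :: E6_root set) = Root ` Phi_E6"
    by (metis Root_cases UNIV_eq_I image_eqI)
  then show ?thesis by (metis finite_Phi_E6 finite_imageI)
qed

instance E6_root :: finite
  by standard (rule finite_UNIV_E6_root)

lemma root_vec_in [simp]: "root_vec a \<in> Phi_E6"
  by (rule root_vec)

section \<open>The bracket in coordinates\<close>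

lemma cartan_elt_add: "cartan_elt (h + h') = cartan_elt h + cartan_elt h'"
  and cartan_elt_minus: "cartan_elt (- h) = - cartan_elt h"
  and cartan_elt_diff: "cartan_elt (h - h') = cartan_elt h - cartan_elt h'"
  and cartan_elt_zero: "cartan_elt 0 = 0"
  and cartan_elt_scaleC: "cartan_elt (z *\<^sub>C h) = z *\<^sub>C cartan_elt h"
  by (simp_all add: cartan_elt_def prod_eq_iff scaleC_prod_def)

lemma fst_scaleC: "fst (z *\<^sub>C u) = z *\<^sub>C fst u"
  and snd_scaleC: "snd (z *\<^sub>C u) = z *\<^sub>C snd u"
  by (simp_all add: scaleC_prod_def)

lemma E6_coeff_sum: "Poly_Mapping.lookup (snd (\<Sum>i\<in>I. f i)) b = (\<Sum>i\<in>I. Poly_Mapping.lookup (snd (f i)) b)" for f :: "_ \<Rightarrow> E6"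
  by (induction I rule: infinite_finite_induct) (simp_all add: lookup_add)

abbreviation E6_coeff :: "E6 \<Rightarrow> E6_root \<Rightarrow> complex"
  where "E6_coeff u \<equiv> Poly_Mapping.lookup (snd u)"

lemma E6_coeff_scaleC: "E6_coeff (z *\<^sub>C u) a = z * E6_coeff u a"
  by (simp add: snd_scaleC lookup_scaleC scaleC_complex_def)

lemma E6_coeff_root_elt: "E6_coeff (root_elt a) b = (if a = b then 1 else 0)"
  by (simp add: root_elt_def lookup_single when_def)

lemma E6_expansion: "u = cartan_elt (fst u) + (\<Sum>a\<in>UNIV. E6_coeff u a *\<^sub>C root_elt a)"
proof (rule prod_eqI)
  have "fst (\<Sum>a\<in>A. E6_coeff u a *\<^sub>C root_elt a) = 0" for A
    by (induction A rule: infinite_finite_induct) (simp_all add: fst_scaleC root_elt_def)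
  then show "fst u = fst (cartan_elt (fst u) + (\<Sum>a\<in>UNIV. E6_coeff u a *\<^sub>C root_elt a))"
    by (simp add: cartan_elt_def)
  show "snd u = snd (cartan_elt (fst u) + (\<Sum>a\<in>UNIV. E6_coeff u a *\<^sub>C root_elt a))"
    by (rule poly_mapping_eqI)
      (simp add: lookup_add E6_coeff_sum E6_coeff_scaleC E6_coeff_root_elt cartan_elt_def if_distrib
        sum.delta cong: if_cong)
qed

text \<open>Linear induction over a spanning set: multilinear identities need checking only on
  Cartan elements and root vectors.\<close>

lemma E6_induct [case_names cartan root add scaleC]:
  assumes "\<And>h. P (cartan_elt h)"
    and "\<And>\<alpha>. \<alpha> \<in> Phi_E6 \<Longrightarrow> P (root_vector \<alpha>)"
    and "\<And>x y. P x \<Longrightarrow> P y \<Longrightarrow> P (x + y)"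
    and "\<And>z x. P x \<Longrightarrow> P (z *\<^sub>C x)"
  shows "P u"
proof -
  have 0: "P 0" using assms(1)[of 0] by (simp add: cartan_elt_zero)
  have "P (\<Sum>a\<in>A. E6_coeff u a *\<^sub>C root_elt a)" for A
  proof (induction A rule: infinite_finite_induct)
    case (insert a A)
    have "P (root_elt a)"
      using assms(2)[of "root_vec a"] by (simp add: root_vector_def root_vec_inverse)
    then show ?case using insert by (simp add: assms(3,4))
  qed (simp_all add: 0)
  then show ?thesis by (subst E6_expansion) (intro assms(3) assms(1))
qed

text \<open>Terms outside the supports have coefficient 0. With index sets independent of x and y,
  bilinearity becomes a termwise computation.\<close>

lemma E6_bracket_UNIV:
  "E6_bracket x y =
    (\<Sum>b\<in>UNIV. (E6_coeff y b * E6_form (fst x) (complexify (root_vec b))) *\<^sub>C root_elt b)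
    - (\<Sum>a\<in>UNIV. (E6_coeff x a * E6_form (fst y) (complexify (root_vec a))) *\<^sub>C root_elt a)
    + (\<Sum>a\<in>UNIV. \<Sum>b\<in>UNIV. (E6_coeff x a * E6_coeff y b) *\<^sub>C bracket_roots a b)"
proof -
  have *: "(\<Sum>a\<in>Poly_Mapping.keys f. g a) = (\<Sum>a\<in>UNIV. g a)"
    if "\<And>a. Poly_Mapping.lookup f a = 0 \<Longrightarrow> g a = 0" for f :: "E6_root \<Rightarrow>\<^sub>0 complex" and g :: "E6_root \<Rightarrow> E6"
    by (rule sum.mono_neutral_left) (auto intro: that simp: in_keys_iff)
  have "(\<Sum>a\<in>Poly_Mapping.keys (snd x). \<Sum>b\<in>Poly_Mapping.keys (snd y). (E6_coeff x a * E6_coeff y b) *\<^sub>C bracket_roots a b)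
    = (\<Sum>a\<in>UNIV. \<Sum>b\<in>UNIV. (E6_coeff x a * E6_coeff y b) *\<^sub>C bracket_roots a b)"
    by (subst *) (auto intro!: sum.cong * sum.neutral)
  then show ?thesis
    unfolding E6_bracket_def by (auto intro!: arg_cong2[of _ _ _ _ "(+)"] arg_cong2[of _ _ _ _ "(-)"] *)
qed

lemma E6_bracket_add_left: "E6_bracket (x + y) z = E6_bracket x z + E6_bracket y z"
  unfolding E6_bracket_UNIV
  by (simp add: lookup_add E6_form_simps distrib_left distrib_right scaleC_add_left sum.distrib algebra_simps)

lemma E6_bracket_add_right: "E6_bracket z (x + y) = E6_bracket z x + E6_bracket z y"
  unfolding E6_bracket_UNIV
  by (simp add: lookup_add E6_form_simps distrib_left distrib_right scaleC_add_left sum.distrib algebra_simps)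

lemma E6_bracket_scale_left: "E6_bracket (a *\<^sub>C x) y = a *\<^sub>C E6_bracket x y"
  unfolding E6_bracket_UNIV
  by (simp add: E6_coeff_scaleC fst_scaleC E6_form_scale_left scaleC_add_right
      complex_vector.scale_right_diff_distrib complex_vector.scale_sum_right mult_ac)

lemma E6_bracket_scale_right: "E6_bracket y (a *\<^sub>C x) = a *\<^sub>C E6_bracket y x"
  unfolding E6_bracket_UNIV
  by (simp add: E6_coeff_scaleC fst_scaleC E6_form_scale_left scaleC_add_right
      complex_vector.scale_right_diff_distrib complex_vector.scale_sum_right mult_ac)

lemma linear_E6_bracket_right: "clinear (E6_bracket x)"
  by (rule clinearI) (simp_all add: E6_bracket_add_right E6_bracket_scale_right)

lemma linear_E6_bracket_left: "clinear (\<lambda>x. E6_bracket x y)"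
  by (rule clinearI) (simp_all add: E6_bracket_add_left E6_bracket_scale_left)

lemmas E6_bracket_zero_right [simp] = linear_E6_bracket_right[THEN clinear.linear_0]
lemmas E6_bracket_minus_right = linear_E6_bracket_right[THEN clinear.linear_neg]
lemmas E6_bracket_diff_right = linear_E6_bracket_right[THEN clinear.linear_diff]
lemmas E6_bracket_sum_right = linear_E6_bracket_right[THEN clinear.linear_sum]
lemmas E6_bracket_zero_left [simp] = linear_E6_bracket_left[THEN clinear.linear_0]
lemmas E6_bracket_minus_left = linear_E6_bracket_left[THEN clinear.linear_neg]
lemmas E6_bracket_diff_left = linear_E6_bracket_left[THEN clinear.linear_diff]

lemma bracket_cartan_cartan: "E6_bracket (cartan_elt h) (cartan_elt h') = 0"
  by (simp add: E6_bracket_UNIV cartan_elt_def complex_vector.scale_zero_left)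

lemma bracket_cartan_root:
  assumes "\<alpha> \<in> Phi_E6"
  shows "E6_bracket (cartan_elt h) (root_vector \<alpha>) = E6_form h (complexify \<alpha>) *\<^sub>C root_vector \<alpha>"
  using assms
  by (simp add: E6_bracket_UNIV cartan_elt_def complex_vector.scale_zero_left root_vector_def root_elt_def E6_form_zero_left
      lookup_single when_def if_distrib[of "\<lambda>z. z * _"] if_distrib[of "\<lambda>z. z *\<^sub>C _"] Root_inverse cong: if_cong)

lemma bracket_root_cartan:
  assumes "\<alpha> \<in> Phi_E6"
  shows "E6_bracket (root_vector \<alpha>) (cartan_elt h) = - (E6_form h (complexify \<alpha>) *\<^sub>C root_vector \<alpha>)"
  using assms
  by (simp add: E6_bracket_UNIV cartan_elt_def complex_vector.scale_zero_left root_vector_def root_elt_def E6_form_zero_left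
      lookup_single when_def if_distrib[of "\<lambda>z. z * _"] if_distrib[of "\<lambda>z. z *\<^sub>C _"] Root_inverse cong: if_cong)

text \<open>The condition that \<alpha> + \<beta> is a root is replaced by a value of the form,
  which is additive in each argument and so can be evaluated in nested brackets.\<close>

lemma bracket_root_root:
  assumes "\<alpha> \<in> Phi_E6" "\<beta> \<in> Phi_E6"
  shows "E6_bracket (root_vector \<alpha>) (root_vector \<beta>) =
    (if \<alpha> + \<beta> = 0 then - cartan_elt (complexify \<alpha>)
     else if E6_form \<alpha> \<beta> = -1 then E6_cocycle \<alpha> \<beta> *\<^sub>C root_vector (\<alpha> + \<beta>) else 0)"
proof -
  have if_sum: "(\<Sum>b\<in>UNIV. if Q then g b else 0) = (if Q then \<Sum>b\<in>UNIV. g b else 0)"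
    for Q and g :: "E6_root \<Rightarrow> E6" by simp
  have "E6_bracket (root_vector \<alpha>) (root_vector \<beta>) = bracket_roots (Root \<alpha>) (Root \<beta>)"
    by (simp add: if_sum E6_bracket_UNIV complex_vector.scale_zero_left root_vector_def root_elt_def E6_form_zero_left
      lookup_single when_def if_distrib[of "\<lambda>z. z * _"] if_distrib[of "\<lambda>z. z *\<^sub>C _"] scaleC_one cong: if_cong)
  also have "\<dots> = (if \<alpha> + \<beta> = 0 then - cartan_elt (complexify \<alpha>)
     else if E6_form \<alpha> \<beta> = -1 then E6_cocycle \<alpha> \<beta> *\<^sub>C root_vector (\<alpha> + \<beta>) else 0)"
    using assms by (simp add: bracket_roots_def Root_inverse Let_def Phi_E6_form_range(4))
  finally show ?thesis .
qed

section \<open>Antisymmetry and the Jacobi identity\<close>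

lemma E6_cocycle_square: "E6_cocycle x y * E6_cocycle x y = 1"
  using E6_cocycle_cases[of x y] by auto

text \<open>For two root vectors with nonzero bracket and \<alpha> + \<beta> different from 0,
  (\<alpha>, \<beta>) = -1 is odd, so exchanging the arguments changes the sign of the
  cocycle.\<close>

lemma E6_bracket_antisym: "E6_bracket y x = - E6_bracket x y"
proof (induction x rule: E6_induct)
  case (cartan h)
  show ?case
    by (induction y rule: E6_induct)
      (simp_all add: bracket_cartan_cartan bracket_cartan_root bracket_root_cartan E6_bracket_add_left
       E6_bracket_add_right E6_bracket_scale_left E6_bracket_scale_right)
next
  case (root \<alpha>)
  show ?case
  proof (induction y rule: E6_induct)
    case (root \<beta>)
    show ?case
    proof (cases "\<alpha> + \<beta> = 0")
      case True
      then have "\<beta> = - \<alpha>" by (metis add_eq_0_iff)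
      then show ?thesis
        using root \<open>\<alpha> \<in> Phi_E6\<close> by (simp add: bracket_root_root complexify_minus cartan_elt_minus)
    next
      case False
      then show ?thesis
        using root \<open>\<alpha> \<in> Phi_E6\<close> E6_cocycle_commute[of \<beta> \<alpha>] E6_form_commute[of \<alpha> \<beta>]
        by (simp add: bracket_root_root add.commute)
    qed
  qed (simp_all add: root bracket_cartan_root bracket_root_cartan E6_bracket_add_left
       E6_bracket_add_right E6_bracket_scale_left E6_bracket_scale_right)
qed (simp_all add: E6_bracket_add_left E6_bracket_add_right E6_bracket_scale_left E6_bracket_scale_right)

definition E6_jacobiator :: "E6 \<Rightarrow> E6 \<Rightarrow> E6 \<Rightarrow> E6"
  where "E6_jacobiator x y z
    = E6_bracket x (E6_bracket y z) + E6_bracket y (E6_bracket z x) + E6_bracket z (E6_bracket x y)"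

lemma E6_jacobiator_rotate: "E6_jacobiator x y z = E6_jacobiator y z x"
  by (simp add: E6_jacobiator_def)

text \<open>The first summand is (\<alpha>, \<beta>) times the root vector of \<alpha>. For
  (\<alpha>, \<beta>) = -1 or 1 exactly one further summand survives and cancels it because
  F(\<beta>, \<beta>) = -1; for the values -2 and 2 the cancelling term comes from a Cartan element;
  for 0 nothing survives.\<close>

lemma E6_jacobiator_roots_opposite:
  assumes "\<alpha> \<in> Phi_E6" "\<beta> \<in> Phi_E6"
  shows "E6_jacobiator (root_vector \<alpha>) (root_vector \<beta>) (root_vector (- \<beta>)) = 0"
proof -
  note b = bracket_root_root bracket_cartan_root bracket_root_cartan Phi_E6_uminus
  let ?c = "E6_form \<alpha> \<beta>"
  have sym: "E6_form \<beta> \<alpha> = ?c" by (rule E6_form_commute)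
  have bb: "E6_form \<beta> \<beta> = 2" using assms by (simp add: Phi_E6_def)
  \<comment> \<open>Rules out \<beta> + \<beta> = 0, so that the bracket of a root vector with
    itself falls into the branch with value 0.\<close>
  have nz: "2 * \<beta> \<noteq> 0" unfolding mult_2 using Phi_E6_form_range(2)[OF assms(2) assms(2)] bb by linarith
  have nz': "\<alpha> \<noteq> 0" using assms zero_notin_Phi_E6 by auto
  have first: "E6_bracket (root_vector \<alpha>) (E6_bracket (root_vector \<beta>) (root_vector (- \<beta>)))
      = of_int ?c *\<^sub>C root_vector \<alpha>"
    using assms by (simp add: b E6_bracket_minus_right E6_form_complexify sym)
  consider "?c = -2" | "?c = -1" | "?c = 0" | "?c = 1" | "?c = 2"
    using Phi_E6_form_range(1)[OF assms] by auto
  then show ?thesis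
  proof cases
    case 1
    then have "\<alpha> = - \<beta>" using Phi_E6_form_range(2)[OF assms] by (simp add: eq_neg_iff_add_eq_0)
    then show ?thesis
      using assms bb nz by (simp add: E6_jacobiator_def b E6_form_simps E6_bracket_minus_right
          E6_form_complexify complexify_minus cartan_elt_minus E6_bracket_minus_left)
  next
    case 2
    have "\<alpha> + \<beta> \<in> Phi_E6" using 2 Phi_E6_form_range(4)[OF assms] by simp
    moreover have "\<alpha> + \<beta> \<noteq> 0" "\<alpha> \<noteq> \<beta>" using 2 assms Phi_E6_form_range[OF assms] by auto
    ultimately show ?thesis
      using assms bb nz' 2 sym E6_cocycle_self[OF assms(2)] E6_cocycle_commute[of \<beta> \<alpha>] E6_cocycle_square[of \<alpha> \<beta>]
        first
      by (simp add: E6_jacobiator_def b E6_form_simps E6_cocycle_simps E6_bracket_scale_right scaleC_scaleC)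
  next
    case 3
    have "\<alpha> + \<beta> \<noteq> 0" "\<alpha> \<noteq> \<beta>" using 3 assms Phi_E6_form_range[OF assms] by auto
    then show ?thesis
      using assms 3 sym first
      by (simp add: E6_jacobiator_def b E6_form_simps E6_cocycle_simps)
  next
    case 4
    have "\<alpha> - \<beta> \<in> Phi_E6" using 4 Phi_E6_form_range(4)[OF assms(1) Phi_E6_uminus[OF assms(2)]] by (simp add: E6_form_simps)
    moreover have "\<alpha> + \<beta> \<noteq> 0" "\<alpha> \<noteq> \<beta>" using 4 assms Phi_E6_form_range[OF assms] by auto
    ultimately show ?thesis
      using assms bb nz' 4 sym E6_cocycle_self[OF assms(2)] E6_cocycle_square[of \<beta> \<alpha>] first
      by (simp add: E6_jacobiator_def b E6_form_simps E6_cocycle_simps E6_bracket_scale_right scaleC_scaleC)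
  next
    case 5
    then have "\<alpha> = \<beta>" using Phi_E6_form_range(3)[OF assms] by simp
    then show ?thesis
      using assms bb nz by (simp add: E6_jacobiator_def b E6_form_simps E6_bracket_minus_right
          E6_form_complexify complexify_minus cartan_elt_minus E6_bracket_minus_left)
  qed
qed


lemma E6_jacobiator_roots:
  assumes \<alpha>: "\<alpha> \<in> Phi_E6" and \<beta>: "\<beta> \<in> Phi_E6" and \<gamma>: "\<gamma> \<in> Phi_E6"
  shows "E6_jacobiator (root_vector \<alpha>) (root_vector \<beta>) (root_vector \<gamma>) = 0"
proof -
  consider "\<beta> + \<gamma> = 0" | "\<gamma> + \<alpha> = 0" | "\<alpha> + \<beta> = 0" | "\<alpha> + \<beta> + \<gamma> = 0"
    | "\<beta> + \<gamma> \<noteq> 0" "\<gamma> + \<alpha> \<noteq> 0" "\<alpha> + \<beta> \<noteq> 0" "\<alpha> + \<beta> + \<gamma> \<noteq> 0" by blast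
  then show ?thesis
  proof cases
    case 1
    then have "\<gamma> = - \<beta>" by (metis add_eq_0_iff)
    then show ?thesis using E6_jacobiator_roots_opposite \<alpha> \<beta> by simp
  next
    case 2
    then have "\<alpha> = - \<gamma>" by (metis add_eq_0_iff)
    then show ?thesis using E6_jacobiator_roots_opposite[of \<beta> \<gamma>] E6_jacobiator_rotate \<beta> \<gamma> by metis
  next
    case 3
    then have "\<beta> = - \<alpha>" by (metis add_eq_0_iff)
    then show ?thesis using E6_jacobiator_roots_opposite[of \<gamma> \<alpha>] E6_jacobiator_rotate \<gamma> \<alpha> by metis
  next
    case 4
    then have \<gamma>_eq: "\<gamma> = - (\<alpha> + \<beta>)" by (metis add_eq_0_iff)
    have "E6_form \<gamma> \<gamma> = 4 + 2 * E6_form \<alpha> \<beta>"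
      using \<alpha> \<beta> E6_form_commute[of \<alpha> \<beta>] unfolding \<gamma>_eq by (simp add: Phi_E6_def E6_form_simps)
    then have c: "E6_form \<alpha> \<beta> = -1" using \<gamma> by (simp add: Phi_E6_def)
    have s: "E6_form \<beta> \<alpha> = -1" using c E6_form_commute by metis
    have n: "E6_form \<alpha> \<alpha> = 2" "E6_form \<beta> \<beta> = 2" using \<alpha> \<beta> by (auto simp: Phi_E6_def)
    have sum: "\<alpha> + \<beta> \<in> Phi_E6" using c Phi_E6_form_range(4)[OF \<alpha> \<beta>] by simp
    have nz: "\<alpha> \<noteq> 0" "\<beta> \<noteq> 0" "\<alpha> + \<beta> \<noteq> 0" using \<alpha> \<beta> sum zero_notin_Phi_E6 by auto
    \<comment> \<open>The cocycle values of (\<alpha>, \<beta>), (\<beta>, \<gamma>) and (\<gamma>,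
      \<alpha>) coincide here. Each summand is the same multiple of the Cartan element of its outer
      root, and these roots add up to 0.\<close>
    have F: "E6_cocycle \<beta> \<alpha> = - E6_cocycle \<alpha> \<beta>" using c E6_cocycle_commute[of \<beta> \<alpha>] by simp
    have "- \<alpha> - \<beta> \<in> Phi_E6" using \<gamma> \<gamma>_eq by (simp add: algebra_simps)
    then show ?thesis
      using \<alpha> \<beta> c s n sum nz F E6_cocycle_self[OF \<alpha>] E6_cocycle_self[OF \<beta>] unfolding \<gamma>_eq
      by (simp add: E6_jacobiator_def bracket_root_root Phi_E6_uminus E6_form_simps E6_cocycle_simps
          E6_bracket_scale_right complexify_minus complexify_add complexify_diff cartan_elt_minus
          cartan_elt_add cartan_elt_diff
          complex_vector.scale_right_diff_distrib scaleC_add_right)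
  next
    case 5
    define F where "F = E6_cocycle \<alpha> \<beta> * E6_cocycle \<beta> \<gamma> * E6_cocycle \<alpha> \<gamma>"
    \<comment> \<open>No partial sum vanishes, so no Cartan elements occur, and the three nested
      brackets are multiples of one root vector; only their coefficients remain to be added.\<close>
    have nested: "E6_bracket (root_vector a) (E6_bracket (root_vector b) (root_vector c))
        = (if E6_form b c = -1 \<and> E6_form a b + E6_form a c = -1
           then (E6_cocycle b c * E6_cocycle a b * E6_cocycle a c) *\<^sub>C root_vector (a + b + c) else 0)"
      if "a \<in> Phi_E6" "b \<in> Phi_E6" "c \<in> Phi_E6" "b + c \<noteq> 0" "a + b + c \<noteq> 0" for a b c
    proof (cases "E6_form b c = -1")
      case True
      then have "b + c \<in> Phi_E6" using Phi_E6_form_range(4)[of b c] that by simp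
      with True that show ?thesis
        by (simp add: bracket_root_root E6_bracket_scale_right E6_form_simps E6_cocycle_simps
            scaleC_scaleC add.assoc mult.assoc)
    qed (use that in \<open>simp add: bracket_root_root\<close>)
    let ?a = "E6_form \<beta> \<gamma>" and ?b = "E6_form \<gamma> \<alpha>" and ?c = "E6_form \<alpha> \<beta>"
    have rot: "\<beta> + \<gamma> + \<alpha> = \<alpha> + \<beta> + \<gamma>" "\<gamma> + \<alpha> + \<beta> = \<alpha> + \<beta> + \<gamma>" by (simp_all add: ac_simps)
    then have rv: "root_vector (\<beta> + \<gamma> + \<alpha>) = root_vector (\<alpha> + \<beta> + \<gamma>)"
      "root_vector (\<gamma> + \<alpha> + \<beta>) = root_vector (\<alpha> + \<beta> + \<gamma>)" by (simp_all only:)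
    have range: "?a \<in> {-1, 0, 1, 2}" "?b \<in> {-1, 0, 1, 2}" "?c \<in> {-1, 0, 1, 2}"
      using Phi_E6_form_range(1,2)[OF \<beta> \<gamma>] Phi_E6_form_range(1,2)[OF \<gamma> \<alpha>]
        Phi_E6_form_range(1,2)[OF \<alpha> \<beta>] 5 by auto
    have sym: "E6_form \<gamma> \<beta> = ?a" "E6_form \<alpha> \<gamma> = ?b" "E6_form \<beta> \<alpha> = ?c"
      by (rule E6_form_commute)+
    have F: "E6_cocycle \<gamma> \<beta> = (-1) powi ?a * E6_cocycle \<beta> \<gamma>"
      "E6_cocycle \<alpha> \<gamma> = (-1) powi ?b * E6_cocycle \<gamma> \<alpha>"
      "E6_cocycle \<beta> \<alpha> = (-1) powi ?c * E6_cocycle \<alpha> \<beta>"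
      by (rule E6_cocycle_commute)+
    have "E6_jacobiator (root_vector \<alpha>) (root_vector \<beta>) (root_vector \<gamma>)
      = ((if ?a = -1 \<and> ?c + ?b = -1 then E6_cocycle \<beta> \<gamma> * E6_cocycle \<alpha> \<beta> * E6_cocycle \<alpha> \<gamma> else 0)
       + (if ?b = -1 \<and> ?a + ?c = -1 then E6_cocycle \<gamma> \<alpha> * E6_cocycle \<beta> \<gamma> * E6_cocycle \<beta> \<alpha> else 0)
       + (if ?c = -1 \<and> ?b + ?a = -1 then E6_cocycle \<alpha> \<beta> * E6_cocycle \<gamma> \<alpha> * E6_cocycle \<gamma> \<beta> else 0))
        *\<^sub>C root_vector (\<alpha> + \<beta> + \<gamma>)"
      unfolding E6_jacobiator_def
      using nested[OF \<alpha> \<beta> \<gamma>] nested[OF \<beta> \<gamma> \<alpha>] nested[OF \<gamma> \<alpha> \<beta>] 5 rot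
      by (simp add: sym rv scaleC_add_left)
    also have "\<dots> = 0"
    proof -
      define p q r where "p = E6_cocycle \<beta> \<gamma>" and "q = E6_cocycle \<gamma> \<alpha>" and "r = E6_cocycle \<alpha> \<beta>"
      \<comment> \<open>A surviving term forces the three forms to be -1, -1, 0 in some order. Then
        exactly two terms survive, and the powers of -1 give them opposite signs.\<close>
      have "(if a = -1 \<and> c + b = -1 then p * r * ((-1) powi b * q) else 0)
        + (if b = -1 \<and> a + c = -1 then q * p * ((-1) powi c * r) else 0)
        + (if c = -1 \<and> b + a = -1 then r * q * ((-1) powi a * p) else 0) = 0"
        if "a \<in> {-1, 0, 1, 2}" "b \<in> {-1, 0, 1, 2}" "c \<in> {-1, 0, 1, 2}" for a b c :: int
        using that by (elim insertE; simp)
      from this[OF range] show ?thesis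
        unfolding F p_def q_def r_def by (simp only: complex_vector.scale_zero_left)
    qed
    finally show ?thesis .
  qed
qed

text \<open>The jacobiator is linear in its first argument, and rotation brings each argument there
  in turn, so the spanning elements suffice.\<close>

lemma E6_jacobi: "E6_jacobiator x y z = 0"
proof -
  have rot: "E6_jacobiator y z x = E6_jacobiator x y z" for x y z
    by (rule E6_jacobiator_rotate[symmetric])
  note lin = E6_jacobiator_def E6_bracket_add_left E6_bracket_add_right E6_bracket_scale_left
    E6_bracket_scale_right
  have add: "E6_jacobiator (x + x') y z = E6_jacobiator x y z + E6_jacobiator x' y z" for x x' y z
    by (simp add: lin)
  have scale: "E6_jacobiator (a *\<^sub>C x) y z = a *\<^sub>C E6_jacobiator x y z" for a x y z
    by (simp add: lin scaleC_add_right)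
  note br = bracket_cartan_cartan bracket_cartan_root bracket_root_cartan E6_bracket_scale_right
    E6_bracket_minus_right
  have hhr: "E6_jacobiator (cartan_elt h) (cartan_elt h') (root_vector \<alpha>) = 0" if "\<alpha> \<in> Phi_E6" for h h' \<alpha>
    using that by (simp add: E6_jacobiator_def br scaleC_scaleC mult.commute)
  have hrr: "E6_jacobiator (cartan_elt h) (root_vector \<alpha>) (root_vector \<beta>) = 0"
    if ab: "\<alpha> \<in> Phi_E6" "\<beta> \<in> Phi_E6" for h \<alpha> \<beta>
  proof -
    consider "\<beta> = - \<alpha>" | "E6_form \<alpha> \<beta> = -1" "\<alpha> + \<beta> \<noteq> 0" "\<alpha> + \<beta> \<in> Phi_E6" | "\<alpha> + \<beta> \<noteq> 0" "E6_form \<alpha> \<beta> \<noteq> -1"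
      using Phi_E6_form_range[OF ab] by (metis add_eq_0_iff)
    then show ?thesis
    proof cases
      case 1
      with ab show ?thesis
        by (simp add: E6_jacobiator_def br bracket_root_root complexify_minus E6_form_simps E6_bracket_minus_left
            cartan_elt_minus)
    next
      case 2
      with ab show ?thesis
        using E6_form_commute[of \<alpha> \<beta>] E6_cocycle_commute[of \<beta> \<alpha>]
        by (simp add: E6_jacobiator_def br bracket_root_root E6_form_simps complexify_add add.commute
            scaleC_scaleC scaleC_add_left complex_vector.scale_left_diff_distrib algebra_simps)
    next
      case 3
      with ab show ?thesis
        using E6_form_commute[of \<alpha> \<beta>] 
        by (simp add: E6_jacobiator_def br bracket_root_root add.commute)
    qed
  qed
  let ?G = "range cartan_elt \<union> root_vector ` Phi_E6"
  have basis: "E6_jacobiator x y z = 0" if "x \<in> ?G" "y \<in> ?G" "z \<in> ?G" for x y z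
  proof -
    have hhh: "E6_jacobiator (cartan_elt h) (cartan_elt h') (cartan_elt h'') = 0" for h h' h''
      by (simp add: E6_jacobiator_def br)
    from that show ?thesis
      using hhh hhr hrr E6_jacobiator_roots by (elim UnE imageE; hypsubst; metis rot)
  qed
  have 1: "E6_jacobiator x y z = 0" if "y \<in> ?G" "z \<in> ?G" for x y z
    by (induction x rule: E6_induct) (use that basis in \<open>simp_all add: add scale\<close>)
  then have 1: "E6_jacobiator y z x = 0" if "y \<in> ?G" "z \<in> ?G" for x y z
    using that rot by metis
  have 2: "E6_jacobiator y z x = 0" if "z \<in> ?G" for x y z
    by (induction y rule: E6_induct) (use that 1 in \<open>simp_all add: add scale\<close>)
  then have 2: "E6_jacobiator z x y = 0" if "z \<in> ?G" for x y z
    using that rot by metis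
  show ?thesis
    by (induction x rule: E6_induct) (use 2 in \<open>simp_all add: add scale\<close>)
qed

text \<open>The Jacobi identity as a derivation rule; with x = \<open>alpha_hat\<close> it makes
  eigenvalues add under the bracket.\<close>

lemma E6_bracket_bracket:
  "E6_bracket x (E6_bracket y z) = E6_bracket (E6_bracket x y) z + E6_bracket y (E6_bracket x z)"
  using E6_jacobi[of x y z] E6_bracket_antisym[of z "E6_bracket x y"] E6_bracket_antisym[of x z]
  by (simp add: E6_jacobiator_def E6_bracket_minus_right algebra_simps)

lemma lie_algebra_E6: "lie_algebra UNIV E6_bracket"
proof
  show "E6_bracket x x = 0" for x
  proof -
    have "2 *\<^sub>C E6_bracket x x = 0"
      using E6_bracket_antisym[of x x] scaleC_add_left[of 1 1 "E6_bracket x x"]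
      by (simp add: scaleC_one) (metis add.right_inverse)
    then show ?thesis by simp
  qed
qed (use E6_jacobi in \<open>simp_all add: E6_bracket_add_left E6_bracket_add_right E6_bracket_scale_left
  E6_bracket_scale_right E6_jacobiator_def\<close>)

section \<open>The tensor product\<close>

lemma poly_mapping_sum_singles:
  fixes f :: "'k \<Rightarrow>\<^sub>0 'b::comm_monoid_add"
  shows "(\<Sum>k\<in>Poly_Mapping.keys f. Poly_Mapping.single k (Poly_Mapping.lookup f k)) = f"
proof (rule poly_mapping_eqI)
  fix l
  have "Poly_Mapping.lookup (\<Sum>k\<in>K. Poly_Mapping.single k (Poly_Mapping.lookup f k)) l
    = (if l \<in> K then Poly_Mapping.lookup f l else 0)" if "finite K" for K
    using that by induction (auto simp: lookup_add lookup_single when_def)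
  then show "Poly_Mapping.lookup (\<Sum>k\<in>Poly_Mapping.keys f. Poly_Mapping.single k (Poly_Mapping.lookup f k)) l
      = Poly_Mapping.lookup f l"
    by (simp add: in_keys_iff)
qed

lemma poly_mapping_induct [case_names single add]:
  fixes f :: "'k \<Rightarrow>\<^sub>0 'b::comm_monoid_add"
  assumes single: "\<And>k z. P (Poly_Mapping.single k z)"
    and add: "\<And>f g. P f \<Longrightarrow> P g \<Longrightarrow> P (f + g)"
  shows "P f"
proof -
  have "P (\<Sum>k\<in>K. Poly_Mapping.single k (Poly_Mapping.lookup f k))" if "finite K" for K
    using that
  proof induction
    case empty
    then show ?case using single[of undefined 0] by simp
  qed (simp add: single add)
  then show ?thesis by (metis finite_keys poly_mapping_sum_singles)
qed

lemma tensor_relations_generators: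
  "Poly_Mapping.single (a + a', b) 1 - Poly_Mapping.single (a, b) 1 - Poly_Mapping.single (a', b) 1 \<in> tensor_relations"
  "Poly_Mapping.single (a, b + b') 1 - Poly_Mapping.single (a, b) 1 - Poly_Mapping.single (a, b') 1 \<in> tensor_relations"
  "Poly_Mapping.single (z *\<^sub>C a, b) 1 - z *\<^sub>C Poly_Mapping.single (a, b) 1 \<in> tensor_relations"
  "Poly_Mapping.single (a, z *\<^sub>C b) 1 - z *\<^sub>C Poly_Mapping.single (a, b) 1 \<in> tensor_relations"
  unfolding tensor_relations_def by (rule complex_vector.span_base, blast)+

lemma tensor_add_left: "(a + a') \<otimes>\<^sub>C b = a \<otimes>\<^sub>C b + a' \<otimes>\<^sub>C b"
  by transfer (use tensor_relations_generators(1) in \<open>simp add: tensor_rel_def algebra_simps\<close>)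

lemma tensor_add_right: "a \<otimes>\<^sub>C (b + b') = a \<otimes>\<^sub>C b + a \<otimes>\<^sub>C b'"
  by transfer (use tensor_relations_generators(2) in \<open>simp add: tensor_rel_def algebra_simps\<close>)

lemma tensor_scale_left: "(z *\<^sub>C a) \<otimes>\<^sub>C b = z *\<^sub>C (a \<otimes>\<^sub>C b)"
  by transfer (use tensor_relations_generators(3) in \<open>simp add: tensor_rel_def\<close>)

lemma tensor_scale_right: "a \<otimes>\<^sub>C (z *\<^sub>C b) = z *\<^sub>C (a \<otimes>\<^sub>C b)"
  by transfer (use tensor_relations_generators(4) in \<open>simp add: tensor_rel_def\<close>)

lemma clinear_tensor_left: "clinear (\<lambda>a. a \<otimes>\<^sub>C b)"
  by (rule clinearI) (rule tensor_add_left tensor_scale_left)+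

lemma clinear_tensor_right: "clinear (\<lambda>b. a \<otimes>\<^sub>C b)"
  by (rule clinearI) (rule tensor_add_right tensor_scale_right)+

lemmas tensor_zero_left [simp] = clinear_tensor_left[THEN clinear.linear_0]
lemmas tensor_zero_right [simp] = clinear_tensor_right[THEN clinear.linear_0]
lemmas tensor_minus_left = clinear_tensor_left[THEN clinear.linear_neg]
lemmas tensor_diff_left = clinear_tensor_left[THEN clinear.linear_diff]
lemmas tensor_sum_left = clinear_tensor_left[THEN clinear.linear_sum]
lemmas tensor_diff_right = clinear_tensor_right[THEN clinear.linear_diff]

lemma ex_abs_tensor: "\<exists>p. x = abs_tensor p"
  by (rule exI, rule Quotient3_abs_rep[OF Quotient3_tensor, symmetric])

lemma tensor_induct [case_names pure add scaleC]:
  assumes "\<And>a b. P (a \<otimes>\<^sub>C b)"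
    and "\<And>x y. P x \<Longrightarrow> P y \<Longrightarrow> P (x + y)"
    and "\<And>z x. P x \<Longrightarrow> P (z *\<^sub>C x)"
  shows "P x"
proof -
  obtain p where x: "x = abs_tensor p" using ex_abs_tensor by blast
  have add: "abs_tensor (p + q) = abs_tensor p + abs_tensor q" for p q :: "('a \<times> 'b) \<Rightarrow>\<^sub>0 complex"
    by (simp add: plus_tensor.abs_eq)
  have 0: "P (abs_tensor 0)" using assms(3)[of "undefined \<otimes>\<^sub>C undefined" 0, OF assms(1)]
    by (simp add: zero_tensor.abs_eq)
  have single: "P (abs_tensor (Poly_Mapping.single k z))" for k z
  proof -
    have "Poly_Mapping.single k z = z *\<^sub>C Poly_Mapping.single k 1"
      by (rule poly_mapping_eqI) (simp add: lookup_scaleC lookup_single scaleC_complex_def when_def)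
    then have "abs_tensor (Poly_Mapping.single k z) = z *\<^sub>C (fst k \<otimes>\<^sub>C snd k)"
      by (simp add: scaleC_tensor.abs_eq tensor.abs_eq)
    then show ?thesis by (simp add: assms)
  qed
  have "P (abs_tensor (\<Sum>k\<in>K. Poly_Mapping.single k (Poly_Mapping.lookup p k)))" if "finite K" for K
    using that by (induction K) (simp_all add: 0 add assms(2) single)
  then show ?thesis unfolding x by (metis finite_keys poly_mapping_sum_singles)
qed

lemma clinear_eq_tensorI:
  assumes "clinear s" "clinear t" "\<And>a b. s (a \<otimes>\<^sub>C b) = t (a \<otimes>\<^sub>C b)"
  shows "s x = t x"
  by (induction x rule: tensor_induct)
    (simp_all add: assms(3) clinear.linear_add[OF assms(1)] clinear.linear_add[OF assms(2)]
      clinear.linear_scale[OF assms(1)] clinear.linear_scale[OF assms(2)])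

text \<open>Universal property of the free vector space on a set.\<close>

lemma ex_clinear_on_poly_mapping:
  fixes B :: "'k \<Rightarrow> 'c::complex_vector"
  shows "\<exists>F :: ('k \<Rightarrow>\<^sub>0 complex) \<Rightarrow> 'c. clinear F \<and> (\<forall>k z. F (Poly_Mapping.single k z) = z *\<^sub>C B k)"
proof -
  define F where "F p = (\<Sum>k\<in>Poly_Mapping.keys p. Poly_Mapping.lookup p k *\<^sub>C B k)" for p
  have F: "F p = (\<Sum>k\<in>K. Poly_Mapping.lookup p k *\<^sub>C B k)" if "finite K" "Poly_Mapping.keys p \<subseteq> K" for p K
    unfolding F_def using that by (intro sum.mono_neutral_left) (auto simp: in_keys_iff)
  have "clinear F"
  proof (rule clinearI)
    fix p q :: "'k \<Rightarrow>\<^sub>0 complex" and z :: complex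
    let ?K = "Poly_Mapping.keys p \<union> Poly_Mapping.keys q"
    have "F (p + q) = (\<Sum>k\<in>?K. Poly_Mapping.lookup (p + q) k *\<^sub>C B k)"
      by (rule F) (auto dest: keys_add[THEN subsetD])
    also have "\<dots> = (\<Sum>k\<in>?K. Poly_Mapping.lookup p k *\<^sub>C B k) + (\<Sum>k\<in>?K. Poly_Mapping.lookup q k *\<^sub>C B k)"
      by (simp add: lookup_add scaleC_add_left sum.distrib)
    also have "\<dots> = F p + F q" by (subst (1 2) F[of ?K]) auto
    finally show "F (p + q) = F p + F q" .
    have "F (z *\<^sub>C p) = (\<Sum>k\<in>Poly_Mapping.keys p. Poly_Mapping.lookup (z *\<^sub>C p) k *\<^sub>C B k)"
      by (rule F) (auto simp: in_keys_iff lookup_scaleC scaleC_complex_def)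
    then show "F (z *\<^sub>C p) = z *\<^sub>C F p"
      by (simp add: F_def lookup_scaleC scaleC_complex_def complex_vector.scale_sum_right scaleC_scaleC)
  qed
  moreover have "F (Poly_Mapping.single k z) = z *\<^sub>C B k" for k z
    by (subst F[of "{k}"]) auto
  ultimately show ?thesis by blast
qed

text \<open>Universal property of the tensor product: bilinearity makes the extension to the free
  space vanish on the spanning relations, so it descends to the quotient.\<close>

lemma ex_clinear_tensor:
  fixes B :: "'a::complex_vector \<Rightarrow> 'b::complex_vector \<Rightarrow> 'c::complex_vector"
  assumes right: "\<And>a. clinear (B a)" and left: "\<And>b. clinear (\<lambda>a. B a b)"
  shows "\<exists>t. clinear t \<and> (\<forall>a b. t (a \<otimes>\<^sub>C b) = B a b)"
proof -
  obtain F :: "('a \<times> 'b \<Rightarrow>\<^sub>0 complex) \<Rightarrow> 'c"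
    where F: "clinear F" and single: "\<And>k z. F (Poly_Mapping.single k z) = z *\<^sub>C B (fst k) (snd k)"
    using ex_clinear_on_poly_mapping[of "\<lambda>k. B (fst k) (snd k)"] by blast
  have "F r = 0" if "r \<in> tensor_relations" for r
    using that unfolding tensor_relations_def
  proof (induction rule: complex_vector.span_induct)
    case base
    show ?case
      by (rule complex_vector.subspaceI)
        (simp_all add: clinear.linear_0[OF F] clinear.linear_add[OF F] clinear.linear_scale[OF F])
  next
    case (step r)
    then show ?case
      by (auto simp: clinear.linear_diff[OF F] clinear.linear_scale[OF F] single scaleC_one
          clinear.linear_add[OF right] clinear.linear_add[OF left] clinear.linear_scale[OF right]
          clinear.linear_scale[OF left])
  qed
  then have rel: "F p = F q" if "tensor_rel p q" for p q
    using that by (fastforce simp: tensor_rel_def clinear.linear_diff[OF F])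
  define t where "t x = F (rep_tensor x)" for x
  have t: "t (abs_tensor p) = F p" for p
    unfolding t_def by (rule rel) (metis tensor.abs_eq_iff Quotient3_abs_rep Quotient3_tensor)
  have "clinear t"
  proof (rule clinearI)
    fix x y :: "('a, 'b) tensor" and z :: complex
    obtain p q where "x = abs_tensor p" "y = abs_tensor q" using ex_abs_tensor by blast
    then show "t (x + y) = t x + t y" "t (z *\<^sub>C x) = z *\<^sub>C t x"
      by (simp_all add: plus_tensor.abs_eq scaleC_tensor.abs_eq t clinear.linear_add[OF F]
          clinear.linear_scale[OF F])
  qed
  moreover have "t (a \<otimes>\<^sub>C b) = B a b" for a b
    by (simp add: tensor.abs_eq t single scaleC_one)
  ultimately show ?thesis by blast
qed

text \<open>\<open>tensor_map\<close> is a definite description. Existence comes from the universal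
  property, uniqueness from the pure tensors spanning the product.\<close>

lemma tensor_map:
  assumes f: "clinear f" and g: "clinear g"
  shows clinear_tensor_map: "clinear (tensor_map f g)"
    and tensor_map_pure: "tensor_map f g (a \<otimes>\<^sub>C b) = f a \<otimes>\<^sub>C g b"
proof -
  have "\<exists>t. clinear t \<and> (\<forall>a b. t (a \<otimes>\<^sub>C b) = f a \<otimes>\<^sub>C g b)"
    by (rule ex_clinear_tensor; rule clinearI)
      (simp_all add: clinear.linear_add[OF f] clinear.linear_scale[OF f] clinear.linear_add[OF g]
        clinear.linear_scale[OF g] tensor_add_left tensor_add_right tensor_scale_left tensor_scale_right)
  then have "\<exists>!t. clinear t \<and> (\<forall>a b. t (a \<otimes>\<^sub>C b) = f a \<otimes>\<^sub>C g b)"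
    by (elim exE, intro ex1I) (assumption, rule ext, rule clinear_eq_tensorI, auto)
  from theI'[OF this] show "clinear (tensor_map f g)" "tensor_map f g (a \<otimes>\<^sub>C b) = f a \<otimes>\<^sub>C g b"
    unfolding tensor_map_def by blast+
qed

lemma clinear_id: "clinear (id :: 'a::complex_vector \<Rightarrow> 'a)"
  by (rule clinearI) simp_all

lemma clinear_comp: "clinear f \<Longrightarrow> clinear g \<Longrightarrow> clinear (\<lambda>x. f (g x))"
  by (rule clinearI) (simp_all add: clinear.linear_add clinear.linear_scale)

lemma tensor_map_id: "tensor_map (id :: 'a::complex_vector \<Rightarrow> 'a) (id :: 'b::complex_vector \<Rightarrow> 'b) = id"
  by (rule ext, rule clinear_eq_tensorI[of "tensor_map id id" id])
    (simp_all only: clinear_tensor_map clinear_id tensor_map_pure id_apply)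

lemma tensor_map_comp:
  assumes "clinear f" "clinear f'" "clinear g" "clinear g'"
  shows "tensor_map (f' \<circ> f) (g' \<circ> g) = tensor_map f' g' \<circ> tensor_map f g"
proof
  fix x
  have c: "clinear (f' \<circ> f)" "clinear (g' \<circ> g)"
    using assms by (simp_all add: clinear_comp comp_def)
  show "tensor_map (f' \<circ> f) (g' \<circ> g) x = (tensor_map f' g' \<circ> tensor_map f g) x"
    by (rule clinear_eq_tensorI)
      (use assms c in \<open>simp_all add: clinear_tensor_map tensor_map_pure clinear_comp comp_def\<close>)
qed

section \<open>Derivations of the polynomial ring\<close>

lemma atLeastAtMost_5: "{1..5 :: nat} = {1, 2, 3, 4, 5}"
  by (rule set_eqI, unfold atLeastAtMost_iff insert_iff empty_iff, presburger)

lemma of_nat_16: "\<exists>i\<in>{1..16}. k = (of_nat i :: 16)"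
proof (cases k)
  case (of_int z)
  then have z: "0 \<le> z" "z < 16" by auto
  show ?thesis
  proof (cases "z = 0")
    case True
    \<comment> \<open>The representative 0 has to be named by the index 16, not by 0.\<close>
    then have "k = of_nat 16" using of_int by simp
    then show ?thesis by (intro bexI[of _ 16]) auto
  next
    case False
    then have "nat z \<in> {1..16}" "k = of_nat (nat z)" using z of_int by (auto simp: of_nat_nat)
    then show ?thesis by blast
  qed
qed

lemma bij_betw_of_nat_16: "bij_betw (of_nat :: nat \<Rightarrow> 16) {1..16} UNIV"
proof (rule bij_betw_imageI)
  show surj: "(of_nat :: nat \<Rightarrow> 16) ` {1..16} = UNIV"
    using of_nat_16 by (metis UNIV_eq_I image_eqI)
  show "inj_on (of_nat :: nat \<Rightarrow> 16) {1..16}"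
    by (rule eq_card_imp_inj_on) (simp_all add: surj del: One_nat_def)
qed

lemma of_nat_16_eq_iff:
  assumes "i \<in> {1..16}" "j \<in> {1..16}"
  shows "(of_nat i :: 16) = of_nat j \<longleftrightarrow> i = j"
  using bij_betw_imp_inj_on[OF bij_betw_of_nat_16] assms by (auto dest: inj_onD)

section \<open>Monomials, degree and induction on polynomials\<close>

definition const_poly :: "complex \<Rightarrow> poly16"
  where "const_poly z = Poly_Mapping.single 0 z"

lemma scaleC_poly_eq: "z *\<^sub>C f = const_poly z * f" for f :: poly16
proof (induction f rule: poly_mapping_induct)
  case (single m a)
  show ?case
    by (rule poly_mapping_eqI)
      (simp add: const_poly_def mult_single lookup_scaleC lookup_single scaleC_complex_def when_def)
qed (simp add: scaleC_add_right distrib_left)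

lemma mult_scaleC_left: "(z *\<^sub>C f) * g = z *\<^sub>C (f * g)" for f g :: poly16
  by (simp add: scaleC_poly_eq mult.assoc)

lemma mult_scaleC_right: "f * (z *\<^sub>C g) = z *\<^sub>C (f * g)" for f g :: poly16
  by (simp add: scaleC_poly_eq mult_ac)

definition monomial_degree :: "(16 \<Rightarrow>\<^sub>0 nat) \<Rightarrow> nat"
  where "monomial_degree m = (\<Sum>k\<in>UNIV. Poly_Mapping.lookup m k)"

lemma monomial_degree_add: "monomial_degree (m + n) = monomial_degree m + monomial_degree n"
  by (simp add: monomial_degree_def lookup_add sum.distrib)

lemma monomial_degree_single: "monomial_degree (Poly_Mapping.single k a) = a"
  by (simp add: monomial_degree_def lookup_single when_def)

text \<open>Subtraction of exponents is truncated, hence the hypothesis that the variable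
  occurs.\<close>

lemma decompose_monomial:
  assumes "Poly_Mapping.lookup m k \<noteq> 0"
  shows "m = (m - Poly_Mapping.single k 1) + Poly_Mapping.single k (1 :: nat)"
  by (rule poly_mapping_eqI) (use assms in \<open>auto simp: lookup_add lookup_minus lookup_single when_def\<close>)

text \<open>Constants and variables generate the ring: a monomial of positive degree is a smaller
  one times a variable.\<close>

lemma poly16_algebra_induct [case_names const var add mult]:
  assumes const: "\<And>z. P (const_poly z)" and var: "\<And>i. i \<in> {1..16} \<Longrightarrow> P (x_var i)"
    and add: "\<And>f g. P f \<Longrightarrow> P g \<Longrightarrow> P (f + g)"
    and mult: "\<And>f g. P f \<Longrightarrow> P g \<Longrightarrow> P (f * g)"
  shows "P f"
proof (induction f rule: poly_mapping_induct)
  case (single m z)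
  show ?case
  proof (induction "monomial_degree m" arbitrary: m)
    case 0
    then have "m = 0"
      by (intro poly_mapping_eqI) (simp add: monomial_degree_def)
    then show ?case using const by (simp add: const_poly_def)
  next
    case (Suc d)
    then obtain k where k: "Poly_Mapping.lookup m k \<noteq> 0"
      by (metis monomial_degree_def sum.neutral nat.distinct(1))
    obtain i where i: "i \<in> {1..16}" "k = of_nat i" using of_nat_16 by blast
    let ?m = "m - Poly_Mapping.single k 1"
    have m: "m = ?m + Poly_Mapping.single k 1" using k by (rule decompose_monomial)
    have "d = monomial_degree ?m"
      using Suc(2) by (subst (asm) m) (simp add: monomial_degree_add monomial_degree_single)
    then have "P (Poly_Mapping.single ?m z)" by (rule Suc(1))
    then have "P (Poly_Mapping.single ?m z * x_var i)" using var i(1) mult by blast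
    also have "Poly_Mapping.single ?m z * x_var i = Poly_Mapping.single m z"
      using m i by (simp add: x_var_def mult_single)
    finally show ?case .
  qed
qed (rule add)

lemma
  shows clinear_pd: "clinear (pd i)"
    and pd_single: "pd i (Poly_Mapping.single m z) = Poly_Mapping.single (m - Poly_Mapping.single (of_nat i) 1)
      (of_nat (Poly_Mapping.lookup m (of_nat i)) * z)"
proof -
  \<comment> \<open>Linearity is not visible from a sum over the support of f, so \<open>pd\<close>
    is identified with the linear extension of its values on monomials.\<close>
  let ?B = "\<lambda>m. Poly_Mapping.single (m - Poly_Mapping.single (of_nat i) 1)
      (of_nat (Poly_Mapping.lookup m (of_nat i))) :: poly16"
  obtain F where F: "clinear F" and single: "\<And>m z. F (Poly_Mapping.single m z) = z *\<^sub>C ?B m"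
    using ex_clinear_on_poly_mapping[of ?B] by blast
  have z_B: "z *\<^sub>C ?B m = Poly_Mapping.single (m - Poly_Mapping.single (of_nat i) 1)
      (of_nat (Poly_Mapping.lookup m (of_nat i)) * z)" for m z
    by (rule poly_mapping_eqI) (simp add: lookup_scaleC lookup_single scaleC_complex_def when_def)
  have "pd i f = F f" for f
  proof -
    have "F f = F (\<Sum>m\<in>Poly_Mapping.keys f. Poly_Mapping.single m (Poly_Mapping.lookup f m))"
      by (simp add: poly_mapping_sum_singles)
    also have "\<dots> = pd i f"
      by (simp add: clinear.linear_sum[OF F] single z_B pd_def del: One_nat_def)
    finally show ?thesis by simp
  qed
  then have "pd i = F" by blast
  then show "clinear (pd i)" "pd i (Poly_Mapping.single m z) = Poly_Mapping.single (m - Poly_Mapping.single (of_nat i) 1)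
      (of_nat (Poly_Mapping.lookup m (of_nat i)) * z)"
    using F single z_B by simp_all
qed

lemmas pd_add = clinear_pd[THEN clinear.linear_add]
lemmas pd_scaleC = clinear_pd[THEN clinear.linear_scale]
lemmas pd_diff = clinear_pd[THEN clinear.linear_diff]
lemmas pd_sum = clinear_pd[THEN clinear.linear_sum]
lemmas pd_zero = clinear_pd[THEN clinear.linear_0]

lemma pd_mult: "pd i (f * g) = f * pd i g + pd i f * g"
proof (induction f rule: poly_mapping_induct)
  case m: (single m a)
  show ?case
  proof (induction g rule: poly_mapping_induct)
    case (single n b)
    let ?k = "of_nat i :: 16"
    let ?e = "Poly_Mapping.single ?k 1 :: 16 \<Rightarrow>\<^sub>0 nat"
    \<comment> \<open>Truncated subtraction can be moved onto v when the variable occurs in v;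
      otherwise the coefficient on both sides is 0.\<close>
    have shift: "Poly_Mapping.single (u + v - ?e) (of_nat (Poly_Mapping.lookup v ?k) * z)
      = Poly_Mapping.single (u + (v - ?e)) (of_nat (Poly_Mapping.lookup v ?k) * z)" for u v and z :: complex
    proof (cases "Poly_Mapping.lookup v ?k = 0")
      case False
      then have "u + v - ?e = u + (v - ?e)"
        by (intro poly_mapping_eqI) (auto simp: lookup_add lookup_minus lookup_single when_def)
      then show ?thesis by simp
    qed simp
    show ?case
      using shift[of m n "a * b"] shift[of n m "a * b"]
      by (simp add: mult_single pd_single lookup_add distrib_right single_add algebra_simps)
  qed (simp add: distrib_left pd_add algebra_simps)
qed (simp add: distrib_right pd_add algebra_simps)

lemma pd_x_var:
  assumes "i \<in> {1..16}" "j \<in> {1..16}"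
  shows "pd i (x_var j) = (if i = j then 1 else 0)"
  using of_nat_16_eq_iff[OF assms(2,1)] by (auto simp: x_var_def pd_single lookup_single when_def)

lemma pd_of_int: "pd i (of_int a) = 0"
proof -
  have 1: "pd i 1 = 0" using pd_mult[of i 1 1] by simp
  have n: "pd i (of_nat n) = 0" for n by (induction n) (simp_all add: pd_add 1 pd_zero)
  show ?thesis by (cases a rule: int_diff_cases) (simp add: pd_diff n)
qed

section \<open>Derivations and vector fields\<close>

definition derivation :: "(poly16 \<Rightarrow> poly16) \<Rightarrow> bool"
  where "derivation d \<longleftrightarrow> clinear d \<and> (\<forall>f g. d (f * g) = f * d g + d f * g)"

lemma derivation_pd: "derivation (pd i)"
  by (simp add: derivation_def clinear_pd pd_mult)

lemma derivation_const:
  assumes "derivation d"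
  shows "d (const_poly z) = 0"
proof -
  have "d 1 = d 1 + d 1" using assms by (metis derivation_def mult_1 mult_1_right)
  then have "d 1 = 0" by simp
  moreover have "const_poly z = z *\<^sub>C 1" by (simp add: scaleC_poly_eq)
  ultimately show ?thesis using assms clinear.linear_scale[of d z 1] by (simp add: derivation_def)
qed

text \<open>Derivations vanish on constants and obey the product rule, so sixteen values determine
  them. Since a commutator of derivations is a derivation, every operator identity below is checked
  on variables only.\<close>

lemma derivation_eqI:
  assumes d: "derivation d" and e: "derivation e" and "\<And>i. i \<in> {1..16} \<Longrightarrow> d (x_var i) = e (x_var i)"
  shows "d f = e f"
proof (induction f rule: poly16_algebra_induct)
  case (const z)
  then show ?case by (simp add: derivation_const d e)
next
  case (add f g)
  then show ?case using d e by (simp add: derivation_def clinear.linear_add)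
next
  case (mult f g)
  then show ?case using d e by (simp add: derivation_def)
qed (rule assms)

lemma derivation_commutator:
  assumes d: "derivation d" and e: "derivation e"
  shows "derivation (\<lambda>f. d (e f) - e (d f))"
proof -
  have lin: "clinear d" "clinear e" using assms by (simp_all add: derivation_def)
  have "clinear (\<lambda>f. d (e f) - e (d f))"
    by (rule clinearI) (simp_all add: clinear.linear_add[OF lin(1)] clinear.linear_add[OF lin(2)]
      clinear.linear_scale[OF lin(1)] clinear.linear_scale[OF lin(2)]
      complex_vector.scale_right_diff_distrib)
  then show ?thesis
    using d e by (simp add: derivation_def clinear.linear_add algebra_simps)
qed

definition vector_field :: "(nat \<Rightarrow> poly16) \<Rightarrow> poly16 \<Rightarrow> poly16"
  where "vector_field a f = (\<Sum>j=1..16. a j * pd j f)"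

lemma derivation_vector_field: "derivation (vector_field a)"
  unfolding derivation_def
proof (intro conjI allI clinearI)
  fix f g z
  show "vector_field a (f + g) = vector_field a f + vector_field a g"
    by (simp add: vector_field_def pd_add distrib_left sum.distrib)
  show "vector_field a (z *\<^sub>C f) = z *\<^sub>C vector_field a f"
    by (simp add: vector_field_def pd_scaleC mult_scaleC_right complex_vector.scale_sum_right)
  show "vector_field a (f * g) = f * vector_field a g + vector_field a f * g"
    by (simp add: vector_field_def pd_mult sum.distrib sum_distrib_left sum_distrib_right algebra_simps)
qed

lemma vector_field_x_var: "i \<in> {1..16} \<Longrightarrow> vector_field a (x_var i) = a i"
  by (simp add: vector_field_def pd_x_var if_distrib cong: if_cong sum.cong_simp)

lemma euler_D_eq: "euler_D = vector_field x_var"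
  by (simp add: fun_eq_iff euler_D_def vector_field_def)

lemma restr_A_eq: "restr_A u = vector_field (\<lambda>i. \<Sum>j=1..16. phi i j u *\<^sub>C x_var j)"
  by (simp add: fun_eq_iff restr_A_def vector_field_def sum_distrib_right mult_scaleC_left)

lemma P_op_eq: "P_op i = vector_field (\<lambda>s. x_var i * x_var s - (\<Sum>k=1..10. zeta k * pd i (pd s (zeta k))))"
proof
  fix f
  have "(\<Sum>k=1..10. zeta k * (\<Sum>j=1..16. pd i (pd j (zeta k)) * pd j f))
    = (\<Sum>j=1..16. (\<Sum>k=1..10. zeta k * pd i (pd j (zeta k))) * pd j f)"
    by (simp add: sum_distrib_left sum_distrib_right mult.assoc) (rule sum.swap)
  then show "P_op i f = vector_field (\<lambda>s. x_var i * x_var s - (\<Sum>k=1..10. zeta k * pd i (pd s (zeta k)))) f"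
    by (simp add: P_op_def euler_D_def vector_field_def left_diff_distrib sum_subtractf sum_distrib_left mult.assoc)
qed

lemma euler_D_monomial: "euler_D (Poly_Mapping.single m z) = of_nat (monomial_degree m) *\<^sub>C Poly_Mapping.single m z"
proof -
  have 1: "x_var i * pd i (Poly_Mapping.single m z) = of_nat (Poly_Mapping.lookup m (of_nat i)) *\<^sub>C Poly_Mapping.single m z" for i
  proof (cases "Poly_Mapping.lookup m (of_nat i) = 0")
    case True
    then show ?thesis by (simp add: pd_single)
  next
    case False
    have "of_nat a *\<^sub>C Poly_Mapping.single m z = Poly_Mapping.single m (of_nat a * z)" for a
      by (rule poly_mapping_eqI) (simp add: lookup_scaleC lookup_single scaleC_complex_def when_def)
    with decompose_monomial[OF False] show ?thesis
      by (simp add: pd_single x_var_def mult_single add.commute)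
  qed
  have "monomial_degree m = (\<Sum>i=1..16. Poly_Mapping.lookup m (of_nat i))"
    unfolding monomial_degree_def by (rule sum.reindex_bij_betw[OF bij_betw_of_nat_16, symmetric])
  then show ?thesis
    by (simp add: euler_D_def 1 complex_vector.scale_sum_left)
qed


text \<open>An executable copy of the quadrics for proofs by evaluation: (c, a, b) stands for c x_a
  x_b.\<close>

definition zeta_terms :: "nat \<Rightarrow> (int \<times> nat \<times> nat) list"
  where "zeta_terms k = [
    [(1, 1, 11), (1, 2, 9), (-1, 3, 6), (1, 4, 5)],
    [(1, 1, 13), (1, 2, 10), (-1, 3, 8), (1, 5, 7)],
    [(1, 1, 14), (1, 2, 12), (-1, 4, 8), (1, 6, 7)],
    [(1, 1, 15), (-1, 3, 12), (1, 4, 10), (-1, 7, 9)],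
    [(-1, 2, 15), (-1, 3, 14), (1, 4, 13), (-1, 7, 11)],
    [(1, 7, 16), (1, 8, 15), (1, 10, 14), (-1, 12, 13)],
    [(-1, 4, 16), (-1, 6, 15), (-1, 9, 14), (1, 11, 12)],
    [(1, 3, 16), (1, 5, 15), (1, 9, 13), (-1, 10, 11)],
    [(1, 2, 16), (-1, 5, 14), (1, 6, 13), (-1, 8, 11)],
    [(1, 1, 16), (1, 5, 12), (-1, 6, 10), (1, 8, 9)]] ! (k - 1)"

lemma atLeastAtMost_10: "{1..10 :: nat} = {1, 2, 3, 4, 5, 6, 7, 8, 9, 10}"
  by (rule set_eqI, unfold atLeastAtMost_iff insert_iff empty_iff, presburger)

lemma zeta_terms: "k \<in> {1..10} \<Longrightarrow> zeta k = (\<Sum>(c, a, b)\<leftarrow>zeta_terms k. of_int c * (x_var a * x_var b))"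
  unfolding atLeastAtMost_10
  by (elim insertE emptyE; hypsubst; simp add: zeta_def zeta_terms_def)

lemma zeta_terms_range: "k \<in> {1..10} \<Longrightarrow> \<forall>(c, a, b)\<in>set (zeta_terms k). a \<in> {1..16} \<and> b \<in> {1..16}"
  unfolding atLeastAtMost_10
  by (elim insertE emptyE; hypsubst; simp add: zeta_terms_def)

text \<open>The second derivatives of the quadrics are constants, kept as integers so that they can
  be evaluated.\<close>

definition zeta_hessian :: "nat \<Rightarrow> nat \<Rightarrow> nat \<Rightarrow> int"
  where "zeta_hessian k i j = (\<Sum>(c, a, b)\<leftarrow>zeta_terms k.
    if i = a \<and> j = b \<or> i = b \<and> j = a then c else 0)"

lemma clinear_sum_list:
  fixes L :: "poly16 \<Rightarrow> 'a::complex_vector"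
  assumes "clinear L"
  shows "L (\<Sum>x\<leftarrow>xs. f x) = (\<Sum>x\<leftarrow>xs. L (f x))"
  by (induction xs) (simp_all add: clinear.linear_0[OF assms] clinear.linear_add[OF assms])

lemma pd_zeta:
  assumes "k \<in> {1..10}" "r \<in> {1..16}"
  shows "pd r (zeta k) = (\<Sum>j=1..16. of_int (zeta_hessian k r j) * x_var j)"
proof -
  \<comment> \<open>No squares of variables occur, so no factor 2 appears in the Hessian.\<close>
  have neq: "a \<noteq> b" if "(c, a, b) \<in> set (zeta_terms k)" for c a b
    using assms(1) that unfolding atLeastAtMost_10
    by (elim insertE emptyE; hypsubst; force simp add: zeta_terms_def)
  have "(\<Sum>(c, a, b)\<leftarrow>xs. pd r (of_int c * (x_var a * x_var b)))
      = (\<Sum>j=1..16. of_int (\<Sum>(c, a, b)\<leftarrow>xs. if r = a \<and> j = b \<or> r = b \<and> j = a then c else 0) * x_var j)"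
    if "set xs \<subseteq> set (zeta_terms k)" for xs
    using that
  proof (induction xs)
    case (Cons x xs)
    obtain c a b where x: "x = (c, a, b)" by (cases x)
    have ab: "a \<in> {1..16}" "b \<in> {1..16}" "a \<noteq> b"
      using zeta_terms_range[OF assms(1)] neq[of c a b] Cons.prems x by auto
    have "pd r (of_int c * (x_var a * x_var b)) = of_int c * ((if r = b then x_var a else 0) + (if r = a then x_var b else 0))"
      using ab assms(2) by (simp add: pd_mult pd_of_int pd_x_var)
    also have "\<dots> = (\<Sum>j=1..16. of_int (if r = a \<and> j = b \<or> r = b \<and> j = a then c else 0) * x_var j)"
    proof -
      have "(\<Sum>j=1..16. of_int (if r = a \<and> j = b \<or> r = b \<and> j = a then c else 0) * x_var j)
        = (\<Sum>j=1..16. (if j = b then (if r = a then of_int c * x_var b else 0) else 0)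
            + (if j = a then (if r = b then of_int c * x_var a else 0) else 0))"
        by (rule sum.cong) (use ab in auto)
      also have "\<dots> = of_int c * ((if r = b then x_var a else 0) + (if r = a then x_var b else 0))"
        unfolding sum.distrib using ab by (simp add: distrib_left)
      finally show ?thesis by simp
    qed
    finally show ?case
      using Cons x by (simp add: sum.distrib distrib_right)
  qed simp
  from this[OF subset_refl] show ?thesis
    unfolding zeta_terms[OF assms(1)] clinear_sum_list[OF clinear_pd]
    by (simp add: zeta_hessian_def case_prod_unfold)
qed

lemma pd_pd_zeta:
  assumes "k \<in> {1..10}" "r \<in> {1..16}" "i \<in> {1..16}"
  shows "pd i (pd r (zeta k)) = of_int (zeta_hessian k r i)"
  using assms(3)
  by (simp add: pd_zeta[OF assms(1,2)] pd_sum pd_mult pd_of_int pd_x_var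
      if_distrib[of "\<lambda>z. _ * z"] cong: if_cong sum.cong_simp)

lemma zeta_hessian_commute: "zeta_hessian k i j = zeta_hessian k j i"
  by (simp add: zeta_hessian_def disj_commute conj_commute)

lemma P_op_x_var:
  assumes "i \<in> {1..16}" "s \<in> {1..16}"
  shows "P_op i (x_var s) = x_var i * x_var s - (\<Sum>k=1..10. of_int (zeta_hessian k i s) * zeta k)"
  using assms unfolding P_op_eq
  by (simp add: vector_field_x_var pd_pd_zeta zeta_hessian_commute[of _ i s] mult.commute[of "zeta _"] del: One_nat_def)

text \<open>P_i maps variables to quadratic forms, so this derivative is linear. Its coefficients
  are what the numbers \<open>phi s j\<close> of [\<xi>_r, \<eta>_i] have to match.\<close>

lemma pd_P_op_x_var:
  assumes "i \<in> {1..16}" "s \<in> {1..16}" "r \<in> {1..16}"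
  shows "pd r (P_op i (x_var s)) = (\<Sum>j=1..16. of_int ((if i = r \<and> s = j then 1 else 0) + (if i = j \<and> s = r then 1 else 0)
    - (\<Sum>k=1..10. zeta_hessian k i s * zeta_hessian k r j)) * x_var j)"
proof -
  have "(\<Sum>j=1..16. of_int ((if i = r \<and> s = j then 1 else 0) + (if i = j \<and> s = r then 1 else 0)
      - (\<Sum>k=1..10. zeta_hessian k i s * zeta_hessian k r j)) * x_var j)
    = (\<Sum>j=1..16. (if s = j then (if i = r then x_var s else 0) else 0))
      + (\<Sum>j=1..16. (if i = j then (if s = r then x_var i else 0) else 0))
      - (\<Sum>j=1..16. \<Sum>k=1..10. of_int (zeta_hessian k i s) * (of_int (zeta_hessian k r j) * x_var j))"
    unfolding sum.distrib[symmetric] sum_subtractf[symmetric]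
    by (rule sum.cong) (auto simp: distrib_right left_diff_distrib sum_distrib_right mult.assoc)
  also have "\<dots> = (if i = r then x_var s else 0) + (if s = r then x_var i else 0)
      - (\<Sum>k=1..10. of_int (zeta_hessian k i s) * pd r (zeta k))"
    using assms by (subst sum.swap[of _ "{1..10}"]) (simp add: pd_zeta sum_distrib_left del: One_nat_def)
  also have "\<dots> = pd r (P_op i (x_var s))"
    using assms by (simp add: P_op_x_var pd_diff pd_sum pd_mult pd_of_int pd_x_var del: One_nat_def)
  finally show ?thesis by simp
qed

section \<open>Explicit roots\<close>

type_synonym int6 = "int \<times> int \<times> int \<times> int \<times> int \<times> int"

text \<open>Integer tuples, unlike vectors over an index type, can be evaluated. All finite checks
  on roots are carried out on tuples, with \<open>lattice_form\<close> and
  \<open>lattice_sign\<close> as counterparts of the form and the cocycle, and are transported along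
  this map.\<close>

definition lattice_vec :: "int6 \<Rightarrow> int ^ 6"
  where "lattice_vec = (\<lambda>(k1, k2, k3, k4, k5, k6).
    \<chi> i. if i = 1 then k1 else if i = 2 then k2 else if i = 3 then k3 else if i = 4 then k4
      else if i = 5 then k5 else k6)"

lemma lattice_vec_nth [simp]:
  "lattice_vec (k1, k2, k3, k4, k5, k6) $ 1 = k1" "lattice_vec (k1, k2, k3, k4, k5, k6) $ 2 = k2"
  "lattice_vec (k1, k2, k3, k4, k5, k6) $ 3 = k3" "lattice_vec (k1, k2, k3, k4, k5, k6) $ 4 = k4"
  "lattice_vec (k1, k2, k3, k4, k5, k6) $ 5 = k5" "lattice_vec (k1, k2, k3, k4, k5, k6) $ 6 = k6"
  by (simp_all add: lattice_vec_def)

lemma lattice_vec_coords: "lattice_vec (k $ 1, k $ 2, k $ 3, k $ 4, k $ 5, k $ 6) = k"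
  by (simp add: vec_eq_iff forall_6)

lemma lattice_vec_eq_iff: "lattice_vec x = lattice_vec y \<longleftrightarrow> x = y"
  by (cases x; cases y) (auto simp: vec_eq_iff forall_6)

lemma simple_root_nth:
  "simple_root 1 = lattice_vec (1, 0, 0, 0, 0, 0)" "simple_root 2 = lattice_vec (0, 1, 0, 0, 0, 0)"
  "simple_root 3 = lattice_vec (0, 0, 1, 0, 0, 0)" "simple_root 4 = lattice_vec (0, 0, 0, 1, 0, 0)"
  "simple_root 5 = lattice_vec (0, 0, 0, 0, 1, 0)" "simple_root 6 = lattice_vec (0, 0, 0, 0, 0, 1)"
  by (simp_all add: vec_eq_iff forall_6 simple_root_def axis_def)

definition lattice_form :: "int6 \<Rightarrow> int6 \<Rightarrow> int"
  where "lattice_form = (\<lambda>(a1, a2, a3, a4, a5, a6) (b1, b2, b3, b4, b5, b6).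
   2 * (a1 * b1 + a2 * b2 + a3 * b3 + a4 * b4 + a5 * b5 + a6 * b6) - (a1 * b3 + a3 * b1)
   - (a3 * b4 + a4 * b3) - (a4 * b5 + a5 * b4) - (a5 * b6 + a6 * b5) - (a2 * b4 + a4 * b2))"

definition lattice_sign :: "int6 \<Rightarrow> int6 \<Rightarrow> int"
  where "lattice_sign = (\<lambda>(a1, a2, a3, a4, a5, a6) (b1, b2, b3, b4, b5, b6).
   if even (a1 * b1 + a2 * b2 + a3 * b3 + a4 * b4 + a5 * b5 + a6 * b6
     + a1 * b3 + a4 * b2 + a3 * b4 + a5 * b4 + a6 * b5) then 1 else -1)"

lemma E6_form_lattice_vec: "E6_form (lattice_vec x) (lattice_vec y) = lattice_form x y"
  by (cases x; cases y) (simp add: E6_form_6 lattice_form_def)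

lemma E6_cocycle_lattice_vec: "E6_cocycle (lattice_vec x) (lattice_vec y) = of_int (lattice_sign x y)"
proof -
  have sign: "(-1 :: complex) powi n = of_int (if even n then 1 else -1)" for n
    by (simp add: power_int_minus_left)
  show ?thesis
    by (cases x; cases y) (simp add: E6_cocycle_def sum_6 lattice_sign_def sign del: even_add even_mult_iff)
qed

definition beta_table :: "int6 list"
  where "beta_table =
    [(0, 0, 0, 0, 0, 1),
     (0, 0, 0, 0, 1, 1),
     (0, 0, 0, 1, 1, 1),
     (0, 0, 1, 1, 1, 1),
     (0, 1, 0, 1, 1, 1),
     (0, 1, 1, 1, 1, 1),
     (1, 0, 1, 1, 1, 1),
     (1, 1, 1, 1, 1, 1),
     (0, 1, 1, 2, 1, 1),
     (1, 1, 1, 2, 1, 1),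
     (0, 1, 1, 2, 2, 1),
     (1, 1, 2, 2, 1, 1),
     (1, 1, 1, 2, 2, 1),
     (1, 1, 2, 2, 2, 1),
     (1, 1, 2, 3, 2, 1),
     (1, 2, 2, 3, 2, 1)]"

lemma beta_Suc_lattice_vec: "\<forall>i\<in>{..<16}. beta (Suc i) = lattice_vec (beta_table ! i)"
proof -
  have "{..<16 :: nat} = {0, 1, 2, 3, 4, 5, 6, 7, 8, 9, 10, 11, 12, 13, 14, 15}"
    by (rule set_eqI, unfold lessThan_iff insert_iff empty_iff, presburger)
  then show ?thesis
    by (simp add: beta_def beta_table_def Let_def simple_root_nth simple_root_nth(1)[unfolded One_nat_def]
        vec_eq_iff forall_6)
qed

definition beta_coords :: "nat \<Rightarrow> int6"
  where "beta_coords i = beta_table ! (i - 1)"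

lemma beta_lattice_vec: "i \<in> {1..16} \<Longrightarrow> beta i = lattice_vec (beta_coords i)"
  using beta_Suc_lattice_vec[rule_format, of "i - 1"] by (cases i) (auto simp: beta_coords_def)

abbreviation index_16 :: "nat list" where "index_16 \<equiv> [1..<17]"

lemma set_index_16: "set index_16 = {1..16}"
  by auto

lemma set_index_10: "set [1..<11] = {1..10 :: nat}"
  by auto

lemma beta_in_Phi_E6: "i \<in> {1..16} \<Longrightarrow> beta i \<in> Phi_E6"
proof -
  have "list_all (\<lambda>i. lattice_form (beta_coords i) (beta_coords i) = 2) index_16" by code_simp
  then have "lattice_form (beta_coords i) (beta_coords i) = 2" if "i \<in> {1..16}" for i
    using that unfolding list_all_iff set_index_16 by blast
  then show "i \<in> {1..16} \<Longrightarrow> beta i \<in> Phi_E6"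
    by (simp add: Phi_E6_def beta_lattice_vec E6_form_lattice_vec del: One_nat_def)
qed

lemma beta_6: "i \<in> {1..16} \<Longrightarrow> beta i $ 6 = 1"
proof -
  have "list_all (\<lambda>i. snd (snd (snd (snd (snd (beta_coords i))))) = 1) index_16" by code_simp
  then have "snd (snd (snd (snd (snd (beta_coords i))))) = 1" if "i \<in> {1..16}" for i
    using that unfolding list_all_iff set_index_16 by blast
  note this[of i]
  then show "i \<in> {1..16} \<Longrightarrow> beta i $ 6 = 1"
    by (cases "beta_coords i") (simp add: beta_lattice_vec del: One_nat_def)
qed

lemma beta_eq_iff:
  assumes "i \<in> {1..16}" "j \<in> {1..16}"
  shows "beta i = beta j \<longleftrightarrow> i = j"
proof -
  have "list_all (\<lambda>i. list_all (\<lambda>j. beta_coords i = beta_coords j \<longrightarrow> i = j) index_16) index_16" by code_simp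
  then have "beta_coords i = beta_coords j \<longrightarrow> i = j"
    using assms unfolding list_all_iff set_index_16 by blast
  then show ?thesis
    using assms by (auto simp: beta_lattice_vec lattice_vec_eq_iff simp del: One_nat_def)
qed

text \<open>Each monomial is listed in both orders, so that the pairs for k are exactly the
  positions of the nonzero Hessian entries of that quadric.\<close>

definition zeta_pairs :: "nat \<Rightarrow> (int \<times> nat \<times> nat) list"
  where "zeta_pairs k = concat (map (\<lambda>(c, a, b). [(c, a, b), (c, b, a)]) (zeta_terms k))"

lemma zeta_hessian_pairs:
  assumes "k \<in> {1..10}" "i \<in> {1..16}" "j \<in> {1..16}" "zeta_hessian k i j \<noteq> 0"
  shows "(zeta_hessian k i j, i, j) \<in> set (zeta_pairs k)"
proof -
  have "list_all (\<lambda>k. list_all (\<lambda>i. list_all (\<lambda>j. let c = zeta_hessian k i j in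
    c = 0 \<or> (c, i, j) \<in> set (zeta_pairs k)) index_16) index_16) [1..<11]"
    by code_simp
  note this[unfolded list_all_iff set_index_10 set_index_16 Let_def, THEN bspec, OF assms(1),
      THEN bspec, OF assms(2), THEN bspec, OF assms(3)]
  then show ?thesis using assms(4) by blast
qed

lemma zeta_pairs_hessian:
  assumes "k \<in> {1..10}" "(c, i, j) \<in> set (zeta_pairs k)"
  shows "zeta_hessian k i j = c" "c * c = 1" "i \<in> {1..16}" "j \<in> {1..16}"
proof -
  have "list_all (\<lambda>k. list_all (\<lambda>(c, i, j). zeta_hessian k i j = c \<and> c * c = 1
    \<and> 1 \<le> i \<and> i \<le> 16 \<and> 1 \<le> j \<and> j \<le> 16) (zeta_pairs k)) [1..<11]"
    by code_simp
  note this[unfolded list_all_iff set_index_10, THEN bspec, OF assms(1), THEN bspec, OF assms(2), unfolded prod.case]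
  then show "zeta_hessian k i j = c" "c * c = 1" "i \<in> {1..16}" "j \<in> {1..16}" by auto
qed

text \<open>The 40 monomials of the ten quadrics are the 40 unordered orthogonal pairs of the
  \<beta>'s, each occurring once; verified by evaluating all 256 ordered pairs.\<close>

lemma beta_form_eq_0:
  assumes "i \<in> {1..16}" "j \<in> {1..16}"
  shows "E6_form (beta i) (beta j) \<in> {0, 1, 2}"
    and "E6_form (beta i) (beta j) = 0 \<Longrightarrow>
      \<exists>k\<in>{1..10}. zeta_hessian k i j \<noteq> 0 \<and> (\<forall>l\<in>{1..10}. l \<noteq> k \<longrightarrow> zeta_hessian l i j = 0)"
    and "E6_form (beta i) (beta j) \<noteq> 0 \<Longrightarrow> k \<in> {1..10} \<Longrightarrow> zeta_hessian k i j = 0"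
proof -
  have "list_all (\<lambda>i. list_all (\<lambda>j. let g = lattice_form (beta_coords i) (beta_coords j);
      hs = map (\<lambda>k. (k, zeta_hessian k i j)) [1..<11]
    in g = 0 \<and> list_ex (\<lambda>(k, h). h \<noteq> 0 \<and> list_all (\<lambda>(l, h'). l \<noteq> k \<longrightarrow> h' = 0) hs) hs
      \<or> (g = 1 \<or> g = 2) \<and> list_all (\<lambda>(k, h). h = 0) hs) index_16) index_16"
    by code_simp
  note this[unfolded list_all_iff list_ex_iff Let_def set_index_16 set_map set_index_10, THEN bspec, OF assms(1),
      THEN bspec, OF assms(2)]
  then have *: "E6_form (beta i) (beta j) = 0 \<and>
        (\<exists>k\<in>{1..10}. zeta_hessian k i j \<noteq> 0 \<and> (\<forall>l\<in>{1..10}. l \<noteq> k \<longrightarrow> zeta_hessian l i j = 0))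
      \<or> (E6_form (beta i) (beta j) = 1 \<or> E6_form (beta i) (beta j) = 2) \<and> (\<forall>k\<in>{1..10}. zeta_hessian k i j = 0)"
    using assms
    by (simp add: beta_lattice_vec E6_form_lattice_vec del: One_nat_def)
  show "E6_form (beta i) (beta j) \<in> {0, 1, 2}" using * by auto
  show "E6_form (beta i) (beta j) = 0 \<Longrightarrow>
      \<exists>k\<in>{1..10}. zeta_hessian k i j \<noteq> 0 \<and> (\<forall>l\<in>{1..10}. l \<noteq> k \<longrightarrow> zeta_hessian l i j = 0)"
    using * by linarith
  show "E6_form (beta i) (beta j) \<noteq> 0 \<Longrightarrow> k \<in> {1..10} \<Longrightarrow> zeta_hessian k i j = 0"
    using * by blast
qed

definition int6_add :: "int6 \<Rightarrow> int6 \<Rightarrow> int6"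
  where "int6_add = (\<lambda>(a1, a2, a3, a4, a5, a6) (b1, b2, b3, b4, b5, b6).
    (a1 + b1, a2 + b2, a3 + b3, a4 + b4, a5 + b5, a6 + b6))"

lemma lattice_vec_add: "lattice_vec x + lattice_vec y = lattice_vec (int6_add x y)"
  by (cases x; cases y) (simp add: vec_eq_iff forall_6 int6_add_def)

text \<open>The common root sum characterises a quadric as a weight vector. The second part ties the
  signs chosen in the quadrics to the cocycle, and is the only place where those signs enter in the
  comparison of different monomials.\<close>

lemma zeta_pairs_roots:
  assumes "k \<in> {1..10}" "(c, i, s) \<in> set (zeta_pairs k)" "(d, r, j) \<in> set (zeta_pairs k)"
  shows "beta i + beta s = beta r + beta j"
    and "r \<noteq> i \<Longrightarrow> r \<noteq> s \<Longrightarrow> E6_form (beta r) (beta i) = 1 \<and> E6_form (beta r) (beta s) = 1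
      \<and> E6_cocycle (beta r) (beta i) * E6_cocycle (beta r) (beta s) * E6_cocycle (beta i) (beta s) = - of_int (c * d)"
proof -
  have "list_all (\<lambda>k. list_all (\<lambda>(c, i, s). list_all (\<lambda>(d, r, j).
    let bi = beta_coords i; bs = beta_coords s; br = beta_coords r in
    int6_add bi bs = int6_add br (beta_coords j)
     \<and> (r = i \<or> r = s \<or> lattice_form br bi = 1 \<and> lattice_form br bs = 1
          \<and> lattice_sign br bi * lattice_sign br bs * lattice_sign bi bs = - (c * d)))
     (zeta_pairs k)) (zeta_pairs k)) [1..<11]"
    by code_simp
  note this[unfolded list_all_iff set_index_10 Let_def, THEN bspec, OF assms(1), THEN bspec, OF assms(2),
      unfolded prod.case, THEN bspec, OF assms(3), unfolded prod.case]
  then have *: "int6_add (beta_coords i) (beta_coords s) = int6_add (beta_coords r) (beta_coords j)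
     \<and> (r = i \<or> r = s \<or> lattice_form (beta_coords r) (beta_coords i) = 1 \<and> lattice_form (beta_coords r) (beta_coords s) = 1
          \<and> lattice_sign (beta_coords r) (beta_coords i) * lattice_sign (beta_coords r) (beta_coords s)
            * lattice_sign (beta_coords i) (beta_coords s) = - (c * d))" .
  note range = zeta_pairs_hessian(3,4)[OF assms(1,2)] zeta_pairs_hessian(3,4)[OF assms(1,3)]
  show "beta i + beta s = beta r + beta j"
    using * range by (simp add: beta_lattice_vec lattice_vec_add del: One_nat_def)
  assume "r \<noteq> i" "r \<noteq> s"
  with * range show "E6_form (beta r) (beta i) = 1 \<and> E6_form (beta r) (beta s) = 1
      \<and> E6_cocycle (beta r) (beta i) * E6_cocycle (beta r) (beta s) * E6_cocycle (beta i) (beta s) = - of_int (c * d)"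
    by (simp add: beta_lattice_vec E6_form_lattice_vec E6_cocycle_lattice_vec del: One_nat_def flip: of_int_mult of_int_minus)
qed

text \<open>If \<beta>_r has product 1 with two orthogonal roots \<beta>_i and \<beta>_s, then
  \<beta>_i + \<beta>_s - \<beta>_r has norm 2, is orthogonal to \<beta>_r and has sixth coordinate
  1. It is thus a partner of \<beta>_r with the same sum, so no monomial is missing from the
  quadric.\<close>

lemma zeta_pairs_complete:
  assumes "k \<in> {1..10}" "(c, i, s) \<in> set (zeta_pairs k)" "r \<in> {1..16}"
    and "E6_form (beta r) (beta i) = 1" "E6_form (beta r) (beta s) = 1"
  shows "\<exists>d j. (d, r, j) \<in> set (zeta_pairs k)"
proof -
  have "list_all (\<lambda>k. list_all (\<lambda>(c, i, s). list_all (\<lambda>r.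
    lattice_form (beta_coords r) (beta_coords i) = 1 \<and> lattice_form (beta_coords r) (beta_coords s) = 1
    \<longrightarrow> list_ex (\<lambda>(d, r', j). r' = r) (zeta_pairs k)) index_16) (zeta_pairs k)) [1..<11]"
    by code_simp
  note this[unfolded list_all_iff list_ex_iff set_index_10 set_index_16, THEN bspec, OF assms(1),
      THEN bspec, OF assms(2), unfolded prod.case, THEN bspec, OF assms(3)]
  then show ?thesis
    using assms zeta_pairs_hessian(3,4)[OF assms(1,2)]
    by (force simp: beta_lattice_vec E6_form_lattice_vec simp del: One_nat_def)
qed

section \<open>The grading by the coefficient of the sixth simple root\<close>

text \<open>With sixth coordinate 1 the first five squares in the norm formula are squares of odd
  integers of absolute value at most 2, hence of 1 or -1. Integrality of the second and fifth
  coordinates is a parity condition that keeps 16 of the 32 sign choices: the half-spin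
  weights.\<close>

lemma grade_one_roots:
  assumes "\<alpha> \<in> Phi_E6" "\<alpha> $ 6 = 1"
  shows "\<exists>i\<in>{1..16}. \<alpha> = beta i"
proof -
  note b = Phi_E6_bounds[OF assms(1), unfolded assms(2)]
  have "\<alpha> $ 1 = 0 \<or> \<alpha> $ 1 = 1" "\<alpha> $ 3 - \<alpha> $ 1 = 0 \<or> \<alpha> $ 3 - \<alpha> $ 1 = 1"
    "\<alpha> $ 4 - \<alpha> $ 3 = 0 \<or> \<alpha> $ 4 - \<alpha> $ 3 = 1"
    "\<alpha> $ 5 + \<alpha> $ 2 - \<alpha> $ 4 = 0 \<or> \<alpha> $ 5 + \<alpha> $ 2 - \<alpha> $ 4 = 1"
    "\<alpha> $ 2 - \<alpha> $ 5 = 0 \<or> \<alpha> $ 2 - \<alpha> $ 5 = -1"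
    using b by presburger+
  moreover have "(k1, k2, k3, k4, k5, 1) \<in> set beta_table"
    if "k1 = 0 \<or> k1 = 1" "k3 - k1 = 0 \<or> k3 - k1 = 1" "k4 - k3 = 0 \<or> k4 - k3 = 1"
      "k5 + k2 - k4 = 0 \<or> k5 + k2 - k4 = 1" "k2 - k5 = 0 \<or> k2 - k5 = -1" for k1 k2 k3 k4 k5 :: int
  proof -
    have "k5 = k2 \<or> k5 = k2 + 1" using that(5) by auto
    then show ?thesis
      using that(1-4) unfolding beta_table_def
      by (elim disjE; simp; presburger)
  qed
  ultimately have "(\<alpha> $ 1, \<alpha> $ 2, \<alpha> $ 3, \<alpha> $ 4, \<alpha> $ 5, 1) \<in> set beta_table" by blast
  then obtain i where i: "i < 16" "(\<alpha> $ 1, \<alpha> $ 2, \<alpha> $ 3, \<alpha> $ 4, \<alpha> $ 5, 1) = beta_table ! i"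
  proof -
    have "length beta_table = 16" by (simp add: beta_table_def)
    with that show ?thesis
      using \<open>_ \<in> set beta_table\<close> unfolding in_set_conv_nth by metis
  qed
  have "\<alpha> = lattice_vec (\<alpha> $ 1, \<alpha> $ 2, \<alpha> $ 3, \<alpha> $ 4, \<alpha> $ 5, 1)"
    using lattice_vec_coords[of \<alpha>] assms(2) by simp
  also have "\<dots> = beta (Suc i)" using i beta_Suc_lattice_vec by simp
  finally show ?thesis using i(1) by (intro bexI[of _ "Suc i"]) auto
qed

lemma root_grade_cases:
  assumes "\<alpha> \<in> Phi_E6"
  obtains "\<alpha> $ 6 = 0" | i where "i \<in> {1..16}" "\<alpha> = beta i" | i where "i \<in> {1..16}" "\<alpha> = - beta i"
proof -
  have "\<alpha> $ 6 = 0 \<or> \<alpha> $ 6 = 1 \<or> (- \<alpha>) $ 6 = 1" using Phi_E6_bounds(6)[OF assms] by auto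
  then show ?thesis
    using that grade_one_roots[OF assms] grade_one_roots[OF Phi_E6_uminus[OF assms]] by (metis minus_minus)
qed

section \<open>The grading element\<close>

lemma E6_coeff_diff: "E6_coeff (u - v) a = E6_coeff u a - E6_coeff v a"
  by (simp add: lookup_minus)

lemma E6_coeff_cartan: "E6_coeff (cartan_elt h) a = 0"
  by (simp add: cartan_elt_def)

lemma E6_coeff_root_vector:
  "\<alpha> \<in> Phi_E6 \<Longrightarrow> E6_coeff (root_vector \<alpha>) a = (if root_vec a = \<alpha> then 1 else 0)"
  by (auto simp: root_vector_def E6_coeff_root_elt Root_inverse root_vec_inverse)

lemma fst_root_vector: "fst (root_vector \<alpha>) = 0"
  by (simp add: root_vector_def root_elt_def)

lemma fst_cartan_elt: "fst (cartan_elt h) = h"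
  by (simp add: cartan_elt_def)

lemma alpha_hat_eq: "alpha_hat = cartan_elt (complexify (lattice_vec (2, 3, 4, 6, 5, 4)))"
  unfolding alpha_hat_def
  by (rule arg_cong[where f = "\<lambda>x. cartan_elt (complexify x)"])
    (simp add: simple_root_nth simple_root_nth(1)[unfolded One_nat_def] vec_eq_iff forall_6)

text \<open>The coefficients of \<open>alpha_hat\<close> are three times those of the sixth
  fundamental weight, which is orthogonal to the other simple roots and has product 1 with
  \<alpha>_6.\<close>

lemma alpha_hat_bracket_root:
  assumes "\<alpha> \<in> Phi_E6"
  shows "E6_bracket alpha_hat (root_vector \<alpha>) = of_int (3 * \<alpha> $ 6) *\<^sub>C root_vector \<alpha>"
proof -
  have "E6_form (lattice_vec (2, 3, 4, 6, 5, 4)) \<alpha> = 3 * \<alpha> $ 6" by (simp add: E6_form_6)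
  then show ?thesis
    using assms by (simp add: alpha_hat_eq bracket_cartan_root E6_form_complexify)
qed

lemma alpha_hat_bracket_cartan: "E6_bracket alpha_hat (cartan_elt h) = 0"
  by (simp add: alpha_hat_eq bracket_cartan_cartan)

lemma alpha_hat_bracket_coeff:
  "E6_coeff (E6_bracket alpha_hat u) a = of_int (3 * root_vec a $ 6) * E6_coeff u a"
proof (induction u rule: E6_induct)
  case (root \<alpha>)
  then show ?case by (simp add: alpha_hat_bracket_root E6_coeff_scaleC E6_coeff_root_vector)
qed (simp_all add: alpha_hat_bracket_cartan E6_coeff_cartan E6_bracket_add_right lookup_add distrib_left
    E6_bracket_scale_right E6_coeff_scaleC)

lemma alpha_hat_bracket_fst: "fst (E6_bracket alpha_hat u) = 0"
  by (induction u rule: E6_induct)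
   (simp_all add: alpha_hat_bracket_root fst_scaleC fst_root_vector alpha_hat_bracket_cartan E6_bracket_add_right
     E6_bracket_scale_right)

lemma E6_eqI: "fst u = fst v \<Longrightarrow> (\<And>a. E6_coeff u a = E6_coeff v a) \<Longrightarrow> u = v"
  by (intro prod_eqI poly_mapping_eqI) auto

lemma alpha_hat_centralizer_iff:
  "E6_bracket alpha_hat u = 0 \<longleftrightarrow> (\<forall>a. root_vec a $ 6 \<noteq> 0 \<longrightarrow> E6_coeff u a = 0)"
proof
  assume "E6_bracket alpha_hat u = 0"
  then have "of_int (3 * root_vec a $ 6) * E6_coeff u a = 0" for a
    using alpha_hat_bracket_coeff[of u a] by simp
  then show "\<forall>a. root_vec a $ 6 \<noteq> 0 \<longrightarrow> E6_coeff u a = 0" by auto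
next
  assume "\<forall>a. root_vec a $ 6 \<noteq> 0 \<longrightarrow> E6_coeff u a = 0"
  then have "of_int (3 * root_vec a $ 6) * E6_coeff u a = 0" for a by auto
  then show "E6_bracket alpha_hat u = 0"
    by (intro E6_eqI) (simp_all only: alpha_hat_bracket_fst alpha_hat_bracket_coeff, simp_all)
qed

lemma Phi_D5_eq: "Phi_D5 = {\<alpha> \<in> Phi_E6. \<alpha> $ 6 = 0}"
proof -
  have "(\<Sum>i=1..5. k i *s simple_root i) = lattice_vec (k 1, k 2, k 3, k 4, k 5, 0)" for k
    unfolding atLeastAtMost_5
    by (simp add: simple_root_nth simple_root_nth(1)[unfolded One_nat_def] vec_eq_iff forall_6)
  then have "{\<Sum>i=1..5. k i *s simple_root i |k. True} = {\<alpha>. \<alpha> $ 6 = 0}"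
  proof (intro equalityI subsetI)
    fix \<alpha> :: "int ^ 6" assume "\<alpha> \<in> {\<alpha>. \<alpha> $ 6 = 0}"
    then have "\<alpha> = lattice_vec (\<alpha> $ of_nat 1, \<alpha> $ of_nat 2, \<alpha> $ of_nat 3, \<alpha> $ of_nat 4, \<alpha> $ of_nat 5, 0)"
      using lattice_vec_coords[of \<alpha>] by simp
    then show "\<alpha> \<in> {\<Sum>i=1..5. k i *s simple_root i |k. True}"
      using \<open>\<And>k. (\<Sum>i=1..5. k i *s simple_root i) = _ k\<close> by (auto intro!: exI[of _ "\<lambda>i. \<alpha> $ of_nat i"])
  qed auto
  then show ?thesis by (auto simp: Phi_D5_def)
qed

lemma cartan_elt_simple_roots:
  "cartan_elt h = (\<Sum>i=1..6. h $ of_nat i *\<^sub>C cartan_elt (complexify (simple_root i)))"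
proof -
  have six: "{1..6 :: nat} = {1, 2, 3, 4, 5, 6}"
    by (rule set_eqI, unfold atLeastAtMost_iff insert_iff empty_iff, presburger)
  have "h = (\<Sum>i=1..6. h $ of_nat i *\<^sub>C complexify (simple_root i))"
    unfolding six
    by (simp add: simple_root_nth simple_root_nth(1)[unfolded One_nat_def] vec_eq_iff forall_6 complexify_def
      scaleC_vec_def scaleC_complex_def)
  then have "cartan_elt h = cartan_elt (\<Sum>i=1..6. h $ of_nat i *\<^sub>C complexify (simple_root i))" by simp
  also have "\<dots> = (\<Sum>i=1..6. h $ of_nat i *\<^sub>C cartan_elt (complexify (simple_root i)))"
    by (subst clinear.linear_sum[of cartan_elt]) (auto intro!: clinearI simp: cartan_elt_add cartan_elt_scaleC)
  finally show ?thesis .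
qed

text \<open>Replaces a span by two linear conditions. The centralizer of \<open>alpha_hat\<close>
  still contains the whole Cartan subalgebra; the second condition removes the direction of
  \<alpha>_6.\<close>

lemma G_D5_iff: "u \<in> G_D5 \<longleftrightarrow> E6_bracket alpha_hat u = 0 \<and> fst u $ 6 = 0"
proof
  assume "u \<in> G_D5"
  then show "E6_bracket alpha_hat u = 0 \<and> fst u $ 6 = 0"
    unfolding G_D5_def
  proof (induction rule: complex_vector.span_induct)
    case base
    show ?case
      by (rule complex_vector.subspaceI)
        (simp_all add: E6_bracket_add_right E6_bracket_scale_right fst_scaleC scaleC_vec_def scaleC_complex_def)
  next
    case (step u)
    have "complexify (simple_root i) $ 6 = 0" if "i \<in> {1..5}" for i
      using that unfolding atLeastAtMost_5
      by (auto simp: complexify_def simple_root_nth simple_root_nth(1)[unfolded One_nat_def])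
    then show ?case
      using step by (auto simp: alpha_hat_bracket_cartan fst_cartan_elt Phi_D5_eq alpha_hat_bracket_root fst_root_vector
         simp del: One_nat_def)
  qed
next
  assume u: "E6_bracket alpha_hat u = 0 \<and> fst u $ 6 = 0"
  have "cartan_elt (fst u) = (\<Sum>i=1..5. fst u $ of_nat i *\<^sub>C cartan_elt (complexify (simple_root i)))"
  proof -
    have "{1..6 :: nat} = insert 6 {1..5}" by auto
    then show ?thesis using u by (subst cartan_elt_simple_roots) simp
  qed
  also have "\<dots> \<in> G_D5"
    unfolding G_D5_def
    by (intro complex_vector.span_sum complex_vector.span_scale complex_vector.span_base) auto
  finally have h: "cartan_elt (fst u) \<in> G_D5" .
  have "E6_coeff u a *\<^sub>C root_elt a \<in> G_D5" for a
  proof (cases "root_vec a $ 6 = 0")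
    case True
    then have "root_vec a \<in> Phi_D5" by (simp add: Phi_D5_eq)
    then have "root_elt a \<in> root_vector ` Phi_D5"
      by (intro image_eqI[of _ _ "root_vec a"]) (simp_all add: root_vector_def root_vec_inverse)
    then show ?thesis
      unfolding G_D5_def by (intro complex_vector.span_scale complex_vector.span_base) auto
  next
    case False
    then have "E6_coeff u a = 0" using u alpha_hat_centralizer_iff by blast
    then show ?thesis by (simp add: G_D5_def complex_vector.span_zero)
  qed
  then have "(\<Sum>a\<in>UNIV. E6_coeff u a *\<^sub>C root_elt a) \<in> G_D5"
    unfolding G_D5_def by (intro complex_vector.span_sum)
  with h have "cartan_elt (fst u) + (\<Sum>a\<in>UNIV. E6_coeff u a *\<^sub>C root_elt a) \<in> G_D5"
    unfolding G_D5_def by (rule complex_vector.span_add)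
  then show "u \<in> G_D5" using E6_expansion[of u] by simp
qed

lemma simple_root_6_nth: "complexify (simple_root 6) $ 6 = 1"
  by (simp add: complexify_def simple_root_nth)

text \<open>As the centralizer of \<open>alpha_hat\<close>, \<open>G_0\<close> is closed under the
  bracket and contains every [\<xi>_i, \<eta>_j], whose eigenvalue is 3 - 3 = 0.\<close>

lemma G_0_iff: "u \<in> G_0 \<longleftrightarrow> E6_bracket alpha_hat u = 0"
proof
  assume "u \<in> G_0"
  then show "E6_bracket alpha_hat u = 0"
    by (auto simp: G_0_def G_D5_iff E6_bracket_add_right E6_bracket_scale_right alpha_hat_bracket_cartan)
next
  assume u: "E6_bracket alpha_hat u = 0"
  let ?a = "cartan_elt (complexify (simple_root 6))"
  have "u - (fst u $ 6) *\<^sub>C ?a \<in> G_D5"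
    by (simp add: u G_D5_iff E6_bracket_diff_right E6_bracket_scale_right alpha_hat_bracket_cartan fst_scaleC
        scaleC_vec_def scaleC_complex_def fst_cartan_elt simple_root_6_nth)
  then show "u \<in> G_0"
    unfolding G_0_def by (intro CollectI exI[of _ "u - (fst u $ 6) *\<^sub>C ?a"] exI[of _ "fst u $ 6"]) simp
qed

lemma subspace_G_0: "csubspace G_0"
  by (rule complex_vector.subspaceI)
    (simp_all add: G_0_iff E6_bracket_add_right E6_bracket_scale_right)

lemma xi_eigen: "i \<in> {1..16} \<Longrightarrow> E6_bracket alpha_hat (xi i) = 3 *\<^sub>C xi i"
  by (simp add: xi_def alpha_hat_bracket_root beta_in_Phi_E6 beta_6 del: One_nat_def)

lemma eta_eigen: "i \<in> {1..16} \<Longrightarrow> E6_bracket alpha_hat (eta i) = (- 3) *\<^sub>C eta i"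
  by (simp add: eta_def alpha_hat_bracket_root beta_in_Phi_E6 beta_6 Phi_E6_uminus del: One_nat_def)

lemma G_0_bracket: "u \<in> G_0 \<Longrightarrow> v \<in> G_0 \<Longrightarrow> E6_bracket u v \<in> G_0"
  by (simp add: G_0_iff E6_bracket_bracket[of alpha_hat])

lemma xi_eta_bracket_in_G_0:
  assumes "i \<in> {1..16}" "j \<in> {1..16}"
  shows "E6_bracket (xi i) (eta j) \<in> G_0"
  using assms
  by (simp add: G_0_iff E6_bracket_bracket[of alpha_hat] xi_eigen eta_eigen E6_bracket_scale_left
      E6_bracket_scale_right E6_bracket_minus_right del: One_nat_def)

section \<open>Components of the three grades\<close>

lemma E6_coeff_xi:
  assumes "i \<in> {1..16}"
  shows "E6_coeff (xi i) a = (if root_vec a = beta i then 1 else 0)"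
  using assms by (simp add: xi_def E6_coeff_root_vector beta_in_Phi_E6)

lemma E6_coeff_eta:
  assumes "i \<in> {1..16}"
  shows "E6_coeff (eta i) a = (if root_vec a = - beta i then 1 else 0)"
  using assms by (simp add: eta_def E6_coeff_root_vector beta_in_Phi_E6 Phi_E6_uminus)

definition xi_coeff :: "nat \<Rightarrow> E6 \<Rightarrow> complex"
  where "xi_coeff i u = E6_coeff u (Root (beta i))"

definition eta_coeff :: "nat \<Rightarrow> E6 \<Rightarrow> complex"
  where "eta_coeff i u = E6_coeff u (Root (- beta i))"

definition G_0_part :: "E6 \<Rightarrow> E6"
  where "G_0_part u = u - (\<Sum>i=1..16. xi_coeff i u *\<^sub>C xi i) - (\<Sum>i=1..16. eta_coeff i u *\<^sub>C eta i)"

lemma coeff_xi_sum: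
  assumes "i \<in> {1..16}"
  shows "E6_coeff (\<Sum>j=1..16. z j *\<^sub>C xi j) (Root (beta i)) = z i"
    "E6_coeff (\<Sum>j=1..16. z j *\<^sub>C xi j) (Root (- beta i)) = 0"
    "E6_coeff (\<Sum>j=1..16. z j *\<^sub>C eta j) (Root (- beta i)) = z i"
    "E6_coeff (\<Sum>j=1..16. z j *\<^sub>C eta j) (Root (beta i)) = 0"
proof -
  have neg: "beta i \<noteq> - beta j" "- beta i \<noteq> beta j" if "j \<in> {1..16}" for j
  proof -
    have "beta i $ 6 \<noteq> (- beta j) $ 6" "(- beta i) $ 6 \<noteq> beta j $ 6"
      using assms that by (simp_all add: beta_6 del: One_nat_def)
    then show "beta i \<noteq> - beta j" "- beta i \<noteq> beta j" by metis+
  qed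
  show "E6_coeff (\<Sum>j=1..16. z j *\<^sub>C xi j) (Root (beta i)) = z i"
    "E6_coeff (\<Sum>j=1..16. z j *\<^sub>C xi j) (Root (- beta i)) = 0"
    "E6_coeff (\<Sum>j=1..16. z j *\<^sub>C eta j) (Root (- beta i)) = z i"
    "E6_coeff (\<Sum>j=1..16. z j *\<^sub>C eta j) (Root (beta i)) = 0"
    using assms neg
    by (simp_all add: E6_coeff_sum E6_coeff_scaleC E6_coeff_xi E6_coeff_eta Root_inverse beta_in_Phi_E6 Phi_E6_uminus
      beta_eq_iff if_distrib[of "\<lambda>x. _ * x"] del: One_nat_def cong: if_cong sum.cong_simp)
qed

lemma G_0_part_in: "G_0_part u \<in> G_0"
  unfolding G_0_iff alpha_hat_centralizer_iff
proof (intro allI impI)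
  fix a assume "root_vec a $ 6 \<noteq> 0"
  then show "E6_coeff (G_0_part u) a = 0"
  proof (cases rule: root_grade_cases[OF root_vec_in[of a]])
    case (2 i)
    then have a: "a = Root (beta i)" by (metis root_vec_inverse)
    show ?thesis
      using 2(1) unfolding a G_0_part_def E6_coeff_diff by (simp add: coeff_xi_sum xi_coeff_def del: One_nat_def)
  next
    case (3 i)
    then have a: "a = Root (- beta i)" by (metis root_vec_inverse)
    show ?thesis
      using 3(1) unfolding a G_0_part_def E6_coeff_diff by (simp add: coeff_xi_sum eta_coeff_def del: One_nat_def)
  qed simp
qed

lemma E6_decomposition:
  "u = G_0_part u + (\<Sum>i=1..16. xi_coeff i u *\<^sub>C xi i) + (\<Sum>i=1..16. eta_coeff i u *\<^sub>C eta i)"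
  by (simp add: G_0_part_def)

text \<open>Brackets with \<open>alpha_hat\<close> have no Cartan part and scale each root
  coefficient by three times its grade, so an eigenvector for -3 is supported on roots of grade
  -1.\<close>

lemma grade_minus_expansion:
  assumes "E6_bracket alpha_hat u = (- 3) *\<^sub>C u"
  shows "u = (\<Sum>i=1..16. eta_coeff i u *\<^sub>C eta i)"
proof (rule E6_eqI)
  have "fst u = 0"
    using alpha_hat_bracket_fst[of u] unfolding assms by (simp add: fst_scaleC)
  have "fst (\<Sum>i\<in>I. eta_coeff i u *\<^sub>C eta i) = 0" for I
    by (induction I rule: infinite_finite_induct) (simp_all add: fst_scaleC eta_def fst_root_vector)
  with \<open>fst u = 0\<close> show "fst u = fst (\<Sum>i=1..16. eta_coeff i u *\<^sub>C eta i)" by simp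
  fix a
  have "of_int (3 * root_vec a $ 6) * E6_coeff u a = of_int (-3) * E6_coeff u a"
    unfolding of_int_numeral of_int_neg_numeral
    by (rule alpha_hat_bracket_coeff[of u a, symmetric, unfolded assms E6_coeff_scaleC])
  then have "E6_coeff u a = 0 \<or> 3 * root_vec a $ 6 = (-3)"
    unfolding mult_cancel_right of_int_eq_iff by blast
  then have *: "E6_coeff u a = 0 \<or> root_vec a $ 6 = -1" by linarith
  show "E6_coeff u a = E6_coeff (\<Sum>i=1..16. eta_coeff i u *\<^sub>C eta i) a"
  proof (cases rule: root_grade_cases[OF root_vec_in[of a]])
    case 1
    have "root_vec a \<noteq> - beta i" if "i \<in> {1..16}" for i
    proof -
      have "root_vec a $ 6 \<noteq> (- beta i) $ 6" using 1 that by (simp add: beta_6 del: One_nat_def)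
      then show ?thesis by metis
    qed
    then show ?thesis
      using * 1 by (simp add: E6_coeff_sum E6_coeff_scaleC E6_coeff_eta del: One_nat_def)
  next
    case (2 i)
    then have a: "a = Root (beta i)" by (metis root_vec_inverse)
    show ?thesis using * 2 coeff_xi_sum(4)[OF 2(1)] unfolding a by (simp add: beta_6 Root_inverse beta_in_Phi_E6 del: One_nat_def)
  next
    case (3 i)
    then have a: "a = Root (- beta i)" by (metis root_vec_inverse)
    show ?thesis using coeff_xi_sum(3)[OF 3(1)] unfolding a by (simp add: eta_coeff_def)
  qed
qed

lemma grade_plus_expansion:
  assumes "E6_bracket alpha_hat u = 3 *\<^sub>C u"
  shows "u = (\<Sum>i=1..16. xi_coeff i u *\<^sub>C xi i)"
proof (rule E6_eqI)
  have "fst u = 0"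
    using alpha_hat_bracket_fst[of u] unfolding assms by (simp add: fst_scaleC)
  have "fst (\<Sum>i\<in>I. xi_coeff i u *\<^sub>C xi i) = 0" for I
    by (induction I rule: infinite_finite_induct) (simp_all add: fst_scaleC xi_def fst_root_vector)
  with \<open>fst u = 0\<close> show "fst u = fst (\<Sum>i=1..16. xi_coeff i u *\<^sub>C xi i)" by simp
  fix a
  have "of_int (3 * root_vec a $ 6) * E6_coeff u a = of_int 3 * E6_coeff u a"
    unfolding of_int_numeral of_int_neg_numeral
    by (rule alpha_hat_bracket_coeff[of u a, symmetric, unfolded assms E6_coeff_scaleC])
  then have "E6_coeff u a = 0 \<or> 3 * root_vec a $ 6 = 3"
    unfolding mult_cancel_right of_int_eq_iff by blast
  then have *: "E6_coeff u a = 0 \<or> root_vec a $ 6 = 1" by linarith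
  show "E6_coeff u a = E6_coeff (\<Sum>i=1..16. xi_coeff i u *\<^sub>C xi i) a"
  proof (cases rule: root_grade_cases[OF root_vec_in[of a]])
    case 1
    have "root_vec a \<noteq> beta i" if "i \<in> {1..16}" for i
      using 1 that beta_6 by auto
    then show ?thesis
      using * 1 by (simp add: E6_coeff_sum E6_coeff_scaleC E6_coeff_xi del: One_nat_def)
  next
    case (2 i)
    then have a: "a = Root (beta i)" by (metis root_vec_inverse)
    show ?thesis using coeff_xi_sum(1)[OF 2(1)] unfolding a by (simp add: xi_coeff_def)
  next
    case (3 i)
    then have a: "a = Root (- beta i)" by (metis root_vec_inverse)
    show ?thesis using * 3 coeff_xi_sum(2)[OF 3(1)] unfolding a
      by (simp add: beta_6 Root_inverse beta_in_Phi_E6 Phi_E6_uminus del: One_nat_def)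
  qed
qed

lemma bracket_eta_expansion:
  assumes "u \<in> G_0" "i \<in> {1..16}"
  shows "E6_bracket u (eta i) = (\<Sum>j=1..16. phi i j u *\<^sub>C eta j)"
proof -
  have "E6_bracket alpha_hat (E6_bracket u (eta i)) = (- 3) *\<^sub>C E6_bracket u (eta i)"
    using assms by (simp add: G_0_iff E6_bracket_bracket[of alpha_hat] eta_eigen E6_bracket_minus_right
        E6_bracket_scale_right del: One_nat_def)
  from grade_minus_expansion[OF this] show ?thesis by (simp add: phi_def eta_coeff_def)
qed

text \<open>Invariance of the bilinear form for which \<open>\<xi>\<^sub>i\<close> and \<open>\<eta>\<^sub>i\<close> are dual.\<close>

lemma xi_coeff_bracket:
  assumes "u \<in> G_0" "i \<in> {1..16}" "k \<in> {1..16}"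
  shows "xi_coeff i (E6_bracket u (xi k)) = - phi i k u"
proof -
  have cart: "xi_coeff i (E6_bracket (cartan_elt h) (xi k)) = - phi i k (cartan_elt h)" for h
    using assms(2,3)
    by (auto simp: xi_coeff_def phi_def xi_def eta_def bracket_cartan_root beta_in_Phi_E6 Phi_E6_uminus E6_coeff_scaleC
      E6_coeff_root_vector Root_inverse beta_eq_iff complexify_minus E6_form_simps simp del: One_nat_def)
  have root: "xi_coeff i (E6_bracket (root_vector \<gamma>) (xi k)) = - phi i k (root_vector \<gamma>)"
    if \<gamma>: "\<gamma> \<in> Phi_E6" "\<gamma> $ 6 = 0" for \<gamma>
  proof -
    note b = beta_in_Phi_E6[OF assms(2)] beta_in_Phi_E6[OF assms(3)]
    have nz: "\<gamma> + beta k \<noteq> 0" "\<gamma> + - beta i \<noteq> 0"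
    proof -
      have "(\<gamma> + beta k) $ 6 \<noteq> 0 $ 6" "(\<gamma> + - beta i) $ 6 \<noteq> 0 $ 6"
        using \<gamma> assms(2,3) by (simp_all add: beta_6 del: One_nat_def)
      then show "\<gamma> + beta k \<noteq> 0" "\<gamma> + - beta i \<noteq> 0" by metis+
    qed
    have l: "xi_coeff i (E6_bracket (root_vector \<gamma>) (xi k)) = (if \<gamma> + beta k = beta i then E6_cocycle \<gamma> (beta k) else 0)"
    proof (cases "E6_form \<gamma> (beta k) = -1")
      case True
      then have "\<gamma> + beta k \<in> Phi_E6" using Phi_E6_form_range(4)[OF \<gamma>(1) b(2)] by simp
      then show ?thesis
        using True nz b \<gamma> by (simp add: xi_coeff_def xi_def bracket_root_root E6_coeff_scaleC
            E6_coeff_root_vector Root_inverse)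
    next
      case False
      then have "\<gamma> + beta k \<noteq> beta i" using Phi_E6_form_range(4)[OF \<gamma>(1) b(2)] b by metis
      then show ?thesis using False nz b \<gamma> by (simp add: xi_coeff_def xi_def bracket_root_root)
    qed
    have r: "phi i k (root_vector \<gamma>) = (if \<gamma> + beta k = beta i then E6_cocycle \<gamma> (beta i) else 0)"
    proof (cases "E6_form \<gamma> (- beta i) = -1")
      case True
      then have in': "\<gamma> + - beta i \<in> Phi_E6" using Phi_E6_form_range(4)[OF \<gamma>(1) Phi_E6_uminus[OF b(1)]] by simp
      have "(- beta k = \<gamma> + - beta i) = (\<gamma> + beta k = beta i)" by (auto simp: algebra_simps)
      then show ?thesis
        using True nz b \<gamma> in' by (simp add: phi_def eta_def bracket_root_root E6_coeff_scaleC Phi_E6_uminus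
            E6_coeff_root_vector Root_inverse E6_cocycle_minus_right)
    next
      case False
      have "\<gamma> + beta k \<noteq> beta i"
      proof
        assume "\<gamma> + beta k = beta i"
        then have "\<gamma> + - beta i = - beta k" by (simp add: algebra_simps flip: \<open>\<gamma> + beta k = beta i\<close>)
        then show False using False Phi_E6_form_range(4)[OF \<gamma>(1) Phi_E6_uminus[OF b(1)]] Phi_E6_uminus[OF b(2)] by metis
      qed
      then show ?thesis using False nz b \<gamma> by (simp add: phi_def eta_def bracket_root_root Phi_E6_uminus)
    qed
    \<comment> \<open>The minus sign of the duality comes from F(\<gamma>, \<gamma>) = -1.\<close>
    have "E6_cocycle \<gamma> (\<gamma> + beta k) = - E6_cocycle \<gamma> (beta k)"
      using E6_cocycle_self[OF \<gamma>(1)] by (simp add: E6_cocycle_add_right)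
    then show ?thesis using l r by auto
  qed
  have lin: "xi_coeff i (E6_bracket (u + v) (xi k)) = xi_coeff i (E6_bracket u (xi k)) + xi_coeff i (E6_bracket v (xi k))"
    "xi_coeff i (E6_bracket (z *\<^sub>C u) (xi k)) = z * xi_coeff i (E6_bracket u (xi k))"
    "phi i k (u + v) = phi i k u + phi i k v" "phi i k (z *\<^sub>C u) = z * phi i k u" for u v z
    by (simp_all add: xi_coeff_def phi_def E6_bracket_add_left E6_bracket_scale_left lookup_add E6_coeff_scaleC)
  have zero: "xi_coeff i 0 = 0" "phi i k 0 = 0" by (simp_all add: xi_coeff_def phi_def)
  have "xi_coeff i (E6_bracket (\<Sum>a\<in>A. E6_coeff u a *\<^sub>C root_elt a) (xi k))
    = - phi i k (\<Sum>a\<in>A. E6_coeff u a *\<^sub>C root_elt a)" for A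
  proof (induction A rule: infinite_finite_induct)
    case (insert a A)
    have "xi_coeff i (E6_bracket (E6_coeff u a *\<^sub>C root_elt a) (xi k)) = - phi i k (E6_coeff u a *\<^sub>C root_elt a)"
    proof (cases "root_vec a $ 6 = 0")
      case True
      from root[OF root_vec_in True] show ?thesis
        by (simp add: lin root_vector_def root_vec_inverse)
    next
      case False
      then have "E6_coeff u a = 0" using assms(1) by (simp add: G_0_iff alpha_hat_centralizer_iff)
      then show ?thesis by (simp add: zero)
    qed
    with insert show ?case by (simp add: lin)
  qed (simp_all add: zero)
  then have "xi_coeff i (E6_bracket (cartan_elt (fst u) + (\<Sum>a\<in>UNIV. E6_coeff u a *\<^sub>C root_elt a)) (xi k))
    = - phi i k (cartan_elt (fst u) + (\<Sum>a\<in>UNIV. E6_coeff u a *\<^sub>C root_elt a))"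
    unfolding lin(1,3) cart by simp
  then show ?thesis using E6_expansion[of u] by simp
qed

lemma bracket_xi_expansion:
  assumes "u \<in> G_0" "k \<in> {1..16}"
  shows "E6_bracket u (xi k) = (\<Sum>i=1..16. (- phi i k u) *\<^sub>C xi i)"
proof -
  have "E6_bracket alpha_hat (E6_bracket u (xi k)) = 3 *\<^sub>C E6_bracket u (xi k)"
    using assms by (simp add: G_0_iff E6_bracket_bracket[of alpha_hat] xi_eigen
        E6_bracket_scale_right del: One_nat_def)
  from grade_plus_expansion[OF this] have "E6_bracket u (xi k) = (\<Sum>i=1..16. xi_coeff i (E6_bracket u (xi k)) *\<^sub>C xi i)" .
  also have "\<dots> = (\<Sum>i=1..16. (- phi i k u) *\<^sub>C xi i)"
    by (rule sum.cong) (use assms xi_coeff_bracket in auto)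
  finally show ?thesis .
qed

text \<open>A sum of two \<beta>'s has sixth coordinate 2, while roots have sixth coordinate at most
  1 in absolute value.\<close>

lemma bracket_xi_xi:
  assumes "i \<in> {1..16}" "j \<in> {1..16}"
  shows "E6_bracket (xi i) (xi j) = 0"
proof -
  have "(beta i + beta j) $ 6 = 2" using assms by (simp add: beta_6 del: One_nat_def)
  then have "beta i + beta j \<notin> Phi_E6" "beta i + beta j \<noteq> 0"
    using Phi_E6_bounds(6)[of "beta i + beta j"] by (linarith, metis zero_index zero_neq_numeral)
  moreover have b: "beta i \<in> Phi_E6" "beta j \<in> Phi_E6" using assms beta_in_Phi_E6 by blast+
  ultimately have "E6_form (beta i) (beta j) \<noteq> -1" using Phi_E6_form_range(4) by blast
  then show ?thesis
    unfolding xi_def bracket_root_root[OF b] using \<open>beta i + beta j \<noteq> 0\<close> by simp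
qed

lemma bracket_eta_eta:
  assumes "i \<in> {1..16}" "j \<in> {1..16}"
  shows "E6_bracket (eta i) (eta j) = 0"
proof -
  have "(- beta i + - beta j) $ 6 = -2" using assms by (simp add: beta_6 del: One_nat_def)
  then have "- beta i + - beta j \<notin> Phi_E6" "- beta i + - beta j \<noteq> 0"
    using Phi_E6_bounds(6)[of "- beta i + - beta j"] by (linarith, metis zero_index zero_neq_neg_numeral)
  moreover have b: "- beta i \<in> Phi_E6" "- beta j \<in> Phi_E6" using assms beta_in_Phi_E6 Phi_E6_uminus by blast+
  ultimately have "E6_form (- beta i) (- beta j) \<noteq> -1" using Phi_E6_form_range(4) by blast
  then show ?thesis
    unfolding eta_def bracket_root_root[OF b] using \<open>- beta i + - beta j \<noteq> 0\<close> by simp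
qed

section \<open>The differential operators\<close>

text \<open>Evaluates the double bracket [[\<xi>_r, \<eta>_i], \<eta>_s]. For i = r the inner
  bracket is the Cartan element of -\<beta>_r, acting on \<eta>_s by (\<beta>_r, \<beta>_s).
  Otherwise both brackets are between root vectors, and bimultiplicativity splits the outer sign
  F(\<beta>_r - \<beta>_i, -\<beta>_s) into two factors.\<close>

lemma phi_xi_eta:
  assumes r: "r \<in> {1..16}" and i: "i \<in> {1..16}" and s: "s \<in> {1..16}" and j: "j \<in> {1..16}"
  shows "phi s j (E6_bracket (xi r) (eta i)) =
    (if i = r then (if s = j then of_int (E6_form (beta r) (beta s)) else 0)
     else if E6_form (beta r) (beta i) = 1 \<and> E6_form (beta r) (beta s) - E6_form (beta i) (beta s) = 1
       \<and> beta r + beta j = beta i + beta s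
     then E6_cocycle (beta r) (beta i) * E6_cocycle (beta r) (beta s) * E6_cocycle (beta i) (beta s) else 0)"
proof (cases "i = r")
  case True
  have "E6_bracket (xi r) (eta i) = - cartan_elt (complexify (beta r))"
    using True r by (simp add: xi_def eta_def bracket_root_root beta_in_Phi_E6 Phi_E6_uminus)
  then show ?thesis
    using True s j by (simp add: phi_def eta_def E6_bracket_minus_left bracket_cartan_root beta_in_Phi_E6 Phi_E6_uminus
        complexify_minus E6_form_simps E6_form_complexify E6_coeff_scaleC E6_coeff_root_vector Root_inverse beta_eq_iff
        del: One_nat_def)
next
  case False
  note b = beta_in_Phi_E6[OF r] beta_in_Phi_E6[OF i] beta_in_Phi_E6[OF s] beta_in_Phi_E6[OF j]
  note b' = b[THEN Phi_E6_uminus]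
  have ne: "beta r + - beta i \<noteq> 0" using False beta_eq_iff[OF r i] by auto
  show ?thesis
  proof (cases "E6_form (beta r) (beta i) = 1")
    case True
    then have f: "E6_form (beta r) (- beta i) = -1" by (simp add: E6_form_simps)
    then have in1: "beta r + - beta i \<in> Phi_E6" using Phi_E6_form_range(4)[OF b(1) b'(2)] by simp
    have "E6_bracket (xi r) (eta i) = E6_cocycle (beta r) (- beta i) *\<^sub>C root_vector (beta r + - beta i)"
      unfolding xi_def eta_def bracket_root_root[OF b(1) b'(2)] using ne f by simp
    then have eq: "E6_bracket (E6_bracket (xi r) (eta i)) (eta s)
      = E6_cocycle (beta r) (- beta i) *\<^sub>C E6_bracket (root_vector (beta r + - beta i)) (root_vector (- beta s))"
      by (simp add: E6_bracket_scale_left eta_def)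
    have "(beta r + - beta i + - beta s) $ 6 \<noteq> 0" using r i s by (simp add: beta_6 del: One_nat_def)
    then have ne2: "beta r + - beta i + - beta s \<noteq> 0" by (metis zero_index)
    have rel: "(- beta j = beta r + - beta i + - beta s) \<longleftrightarrow> beta r + beta j = beta i + beta s"
      by (auto simp: algebra_simps)
    show ?thesis
    proof (cases "E6_form (beta r) (beta s) - E6_form (beta i) (beta s) = 1")
      case t: True
      then have f2: "E6_form (beta r + - beta i) (- beta s) = -1" by (simp add: E6_form_simps)
      then have in2: "beta r + - beta i + - beta s \<in> Phi_E6" using Phi_E6_form_range(4)[OF in1 b'(3)] by simp
      have "E6_bracket (root_vector (beta r + - beta i)) (root_vector (- beta s))
        = E6_cocycle (beta r + - beta i) (- beta s) *\<^sub>C root_vector (beta r + - beta i + - beta s)"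
        unfolding bracket_root_root[OF in1 b'(3)] using ne2 f2 by simp
      then have "phi s j (E6_bracket (xi r) (eta i)) = E6_cocycle (beta r) (- beta i) * (E6_cocycle (beta r + - beta i) (- beta s)
         * (if - beta j = beta r + - beta i + - beta s then 1 else 0))"
        unfolding phi_def eq by (simp only: E6_coeff_scaleC E6_coeff_root_vector[OF in2] Root_inverse[OF b'(4)])
      then show ?thesis using False True t unfolding rel
        by (simp add: E6_cocycle_minus_right E6_cocycle_diff_left)
    next
      case f: False
      then have "E6_form (beta r + - beta i) (- beta s) \<noteq> -1" by (simp add: E6_form_simps)
      then have "E6_bracket (root_vector (beta r + - beta i)) (root_vector (- beta s)) = 0"
        unfolding bracket_root_root[OF in1 b'(3)] using ne2 by simp
      then show ?thesis using False f unfolding phi_def eq by simp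
    qed
  next
    case f: False
    then have "E6_form (beta r) (- beta i) \<noteq> -1" by (simp add: E6_form_simps)
    then have "E6_bracket (xi r) (eta i) = 0"
      unfolding xi_def eta_def bracket_root_root[OF b(1) b'(2)] using ne by simp
    then show ?thesis using False f by (simp add: phi_def)
  qed
qed

lemma phi_xi_eta_hessian:
  assumes r: "r \<in> {1..16}" and i: "i \<in> {1..16}" and s: "s \<in> {1..16}" and j: "j \<in> {1..16}"
  shows "phi s j (E6_bracket (xi r) (eta i)) = of_int ((if i = r \<and> s = j then 1 else 0) + (if i = j \<and> s = r then 1 else 0)
    - (\<Sum>k=1..10. zeta_hessian k i s * zeta_hessian k r j))"
proof -
  have self: "E6_form (beta a) (beta a) = 2" "E6_cocycle (beta a) (beta a) = -1" if "a \<in> {1..16}" for a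
    using beta_in_Phi_E6[OF that] by (simp_all add: Phi_E6_def E6_cocycle_self)
  have form_2: "a = b" if "E6_form (beta a) (beta b) = 2" "a \<in> {1..16}" "b \<in> {1..16}" for a b
    using that Phi_E6_form_range(3)[OF beta_in_Phi_E6 beta_in_Phi_E6, of a b] beta_eq_iff by blast
  show ?thesis
  proof (cases "E6_form (beta i) (beta s) = 0")
    case False
    then have sum0: "(\<Sum>k=1..10. zeta_hessian k i s * zeta_hessian k r j) = 0"
      using beta_form_eq_0(3)[OF i s] by (intro sum.neutral) auto
    have i_s: "E6_form (beta i) (beta s) = 1 \<or> i = s"
      using False beta_form_eq_0(1)[OF i s] form_2[of i s] i s by auto
    \<comment> \<open>Here (\<beta>_i, \<beta>_s) is positive, so the second condition forces
      (\<beta>_r, \<beta>_s) = 2, that is r = s, and then i = j. The sign is 1 because F(\<beta>_r,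
      \<beta>_r) = -1 and F changes sign when \<beta>_r and \<beta>_i, with product 1, are
      exchanged.\<close>
    have off: "r = s \<and> i = j \<and> E6_cocycle (beta r) (beta i) * E6_cocycle (beta r) (beta s) * E6_cocycle (beta i) (beta s) = 1"
      if ir: "i \<noteq> r" and h: "E6_form (beta r) (beta i) = 1" "E6_form (beta r) (beta s) - E6_form (beta i) (beta s) = 1"
        "beta r + beta j = beta i + beta s"
    proof -
      have "i \<noteq> s" using h self[OF i] by auto
      then have "E6_form (beta r) (beta s) = 2" using i_s h by auto
      then have rs: "r = s" using form_2 r s by blast
      then have "beta i = beta j" using h by simp
      then have "i = j" using beta_eq_iff i j by blast
      moreover have "E6_cocycle (beta i) (beta r) = - E6_cocycle (beta r) (beta i)"
        using E6_cocycle_commute[of "beta i" "beta r"] h(1) by simp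
      ultimately show ?thesis using rs self[OF r] E6_cocycle_square[of "beta r" "beta i"] by simp
    qed
    show ?thesis
    proof (cases "i = r")
      case True
      \<comment> \<open>When s = j, the form value 2 corresponds to all four indices being equal,
        where both Kronecker terms contribute; the value 1 to the first of them alone.\<close>
      have "E6_form (beta i) (beta s) = 1 \<and> i \<noteq> s \<or> E6_form (beta i) (beta s) = 2 \<and> i = s"
        using i_s self(1)[OF i] by auto
      then show ?thesis
        unfolding sum0 phi_xi_eta[OF r i s j] using True by (elim disjE conjE; cases "s = j") auto
    next
      case False
      let ?c = "E6_form (beta r) (beta i) = 1 \<and> E6_form (beta r) (beta s) - E6_form (beta i) (beta s) = 1
        \<and> beta r + beta j = beta i + beta s"
      show ?thesis
      proof (cases "i = j \<and> s = r")
        case t: True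
        then have "E6_form (beta i) (beta r) = 1" using False i_s by auto
        then have "E6_form (beta r) (beta i) = 1" by (simp only: E6_form_commute)
        then have c: ?c using t \<open>E6_form (beta i) (beta r) = 1\<close> self(1)[OF r] by simp
        show ?thesis
          unfolding sum0 phi_xi_eta[OF r i s j] using c off[OF False] False t by simp
      next
        case f: False
        then have "\<not> ?c" using off[OF False] by blast
        then show ?thesis
          unfolding sum0 phi_xi_eta[OF r i s j] using False f by auto
      qed
    qed
  next
    case g0: True
    then have is_ne: "i \<noteq> s" using self[OF i] by auto
    obtain k where k: "k \<in> {1..10}" and hk: "zeta_hessian k i s \<noteq> 0"
      and others: "\<And>l. l \<in> {1..10} \<Longrightarrow> l \<noteq> k \<Longrightarrow> zeta_hessian l i s = 0"
      using beta_form_eq_0(2)[OF i s g0] by blast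
    have sum: "(\<Sum>l=1..10. zeta_hessian l i s * zeta_hessian l r j) = zeta_hessian k i s * zeta_hessian k r j"
    proof -
      have "(\<Sum>l=1..10. zeta_hessian l i s * zeta_hessian l r j)
        = (\<Sum>l=1..10. if l = k then zeta_hessian k i s * zeta_hessian k r j else 0)"
        by (rule sum.cong) (use others in auto)
      then show ?thesis using k by simp
    qed
    note p_is = zeta_hessian_pairs[OF k i s hk]
    have sq: "zeta_hessian k i s * zeta_hessian k i s = 1"
      using zeta_pairs_hessian(2)[OF k p_is] .
    have relation: "beta i + beta s = beta r + beta j" if "zeta_hessian k r j \<noteq> 0"
      using zeta_pairs_roots(1)[OF k p_is zeta_hessian_pairs[OF k r j that]] .
    \<comment> \<open>If r is i or s, the common root sum determines the partner of r, and the
      square of a Hessian entry cancels the Kronecker term. For other r the Kronecker terms are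
      absent and the sign table decides.\<close>
    consider "r = i" | "r = s" "r \<noteq> i" | "r \<noteq> i" "r \<noteq> s" by blast
    then show ?thesis
    proof cases
      case 1
      have "s = j" if "zeta_hessian k r j \<noteq> 0"
        using relation[OF that] 1 beta_eq_iff[OF s j] by simp
      then have prod: "zeta_hessian k i s * zeta_hessian k r j = (if s = j then 1 else 0)"
        using 1 sq by (cases "s = j") auto
      show ?thesis
        unfolding phi_xi_eta[OF r i s j] sum prod using 1 is_ne g0 by auto
    next
      case 2
      have "i = j" if "zeta_hessian k r j \<noteq> 0"
        using relation[OF that] 2 beta_eq_iff[OF i j] by simp
      then have prod: "zeta_hessian k i s * zeta_hessian k r j = (if i = j then 1 else 0)"
        using 2 sq zeta_hessian_commute[of k s i] by (cases "i = j") auto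
      have "E6_form (beta s) (beta i) = 0" using g0 by (simp only: E6_form_commute)
      then show ?thesis
        unfolding phi_xi_eta[OF r i s j] sum prod using 2 is_ne g0 by auto
    next
      case 3
      show ?thesis
      proof (cases "zeta_hessian k r j = 0")
        case True
        \<comment> \<open>Completeness yields a monomial x_r x_j' of the same quadric with the same
          root sum, hence j' = j, against the vanishing entry.\<close>
        have False if f: "E6_form (beta r) (beta i) = 1" "E6_form (beta r) (beta s) = 1"
          and eq: "beta r + beta j = beta i + beta s"
        proof -
          obtain d j' where p: "(d, r, j') \<in> set (zeta_pairs k)"
            using zeta_pairs_complete[OF k p_is r f] by blast
          note z = zeta_pairs_hessian[OF k p]
          have "beta i + beta s = beta r + beta j'" using zeta_pairs_roots(1)[OF k p_is p] .
          then have "beta j' = beta j" using eq by (metis add_left_cancel)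
          then have "j' = j" using beta_eq_iff[OF z(4) j] by simp
          with z True show False by simp
        qed
        then show ?thesis
          unfolding phi_xi_eta[OF r i s j] sum using 3 g0 True by auto
      next
        case False
        note p_rj = zeta_hessian_pairs[OF k r j False]
        note z = zeta_pairs_roots[OF k p_is p_rj]
        show ?thesis
          unfolding phi_xi_eta[OF r i s j] sum using 3 g0 z(1)[symmetric] z(2)[OF 3] by simp
      qed
    qed
  qed
qed

section \<open>Commutators of the operators\<close>

lemma derivation_P_op: "derivation (P_op i)"
  unfolding P_op_eq by (rule derivation_vector_field)

lemma derivation_restr_A: "derivation (restr_A u)"
  unfolding restr_A_eq by (rule derivation_vector_field)

lemma derivation_euler_D: "derivation euler_D"
  unfolding euler_D_eq by (rule derivation_vector_field)

lemma derivation_clinear: "derivation d \<Longrightarrow> clinear d"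
  by (simp add: derivation_def)

lemma derivation_mult: "derivation d \<Longrightarrow> d (f * g) = f * d g + d f * g"
  by (simp add: derivation_def)

lemma derivation_0_1: "derivation d \<Longrightarrow> d 0 = 0" "derivation d \<Longrightarrow> d 1 = 0"
  using derivation_const[of d 0] derivation_const[of d 1] by (simp_all add: const_poly_def single_one)

lemma restr_A_x_var: "i \<in> {1..16} \<Longrightarrow> restr_A u (x_var i) = (\<Sum>j=1..16. phi i j u *\<^sub>C x_var j)"
  unfolding restr_A_eq by (rule vector_field_x_var)

lemma euler_D_x_var: "i \<in> {1..16} \<Longrightarrow> euler_D (x_var i) = x_var i"
  unfolding euler_D_eq by (rule vector_field_x_var)

lemma pd_commute: "pd i (pd j f) = pd j (pd i f)"
  if "i \<in> {1..16}" "j \<in> {1..16}"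
proof -
  have "(\<lambda>f. pd i (pd j f) - pd j (pd i f)) f = (vector_field (\<lambda>_. 0)) f"
    by (rule derivation_eqI[OF derivation_commutator[OF derivation_pd derivation_pd] derivation_vector_field])
      (use that in \<open>simp add: pd_x_var derivation_0_1[OF derivation_pd] vector_field_def del: One_nat_def\<close>)
  then show ?thesis by (simp add: vector_field_def)
qed

lemma of_int_scaleC: "of_int a * f = of_int a *\<^sub>C f" for f :: poly16
proof -
  have "of_int a = of_int a *\<^sub>C (1 :: poly16)"
  proof (induction a rule: int_induct[of _ 0])
    case (step1 i)
    then show ?case by (simp add: scaleC_add_left scaleC_one)
  next
    case (step2 i)
    then show ?case by (simp add: complex_vector.scale_left_diff_distrib scaleC_one)
  qed simp
  then show ?thesis by (metis mult_scaleC_left mult_1)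
qed

text \<open>The polynomial part of the relation for [\<xi>_r, \<eta>_i]. On variables it is the
  Hessian identity for \<open>phi\<close>, which is where the definition of P_i is
  justified.\<close>

lemma pd_P_op_commutator:
  assumes r: "r \<in> {1..16}" and i: "i \<in> {1..16}"
  shows "pd r (P_op i f) - P_op i (pd r f) = restr_A (E6_bracket (xi r) (eta i)) f"
proof -
  have "(\<lambda>f. pd r (P_op i f) - P_op i (pd r f)) f = restr_A (E6_bracket (xi r) (eta i)) f"
  proof (rule derivation_eqI[OF derivation_commutator[OF derivation_pd derivation_P_op] derivation_restr_A])
    fix s :: nat assume s: "s \<in> {1..16}"
    have "P_op i (pd r (x_var s)) = 0"
      using r s by (simp add: pd_x_var derivation_0_1[OF derivation_P_op] del: One_nat_def)
    moreover have "pd r (P_op i (x_var s)) = restr_A (E6_bracket (xi r) (eta i)) (x_var s)"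
      unfolding pd_P_op_x_var[OF i s r] restr_A_x_var[OF s] of_int_scaleC
      by (rule sum.cong) (use phi_xi_eta_hessian[OF r i s] in auto)
    ultimately show "pd r (P_op i (x_var s)) - P_op i (pd r (x_var s)) = restr_A (E6_bracket (xi r) (eta i)) (x_var s)"
      by simp
  qed
  then show ?thesis .
qed

text \<open>The coefficients are those of [u, \<xi>_k] in the \<xi>_i: partial derivatives transform
  dually to the variables, as the \<xi>'s do to the \<eta>'s.\<close>

lemma restr_A_pd_commutator:
  assumes k: "k \<in> {1..16}"
  shows "restr_A u (pd k f) - pd k (restr_A u f) = (\<Sum>i=1..16. (- phi i k u) *\<^sub>C pd i f)"
proof -
  have vf: "(\<Sum>i=1..16. (- phi i k u) *\<^sub>C pd i f) = vector_field (\<lambda>i. (- phi i k u) *\<^sub>C 1) f" for f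
    by (simp add: vector_field_def mult_scaleC_left)
  have "(\<lambda>f. restr_A u (pd k f) - pd k (restr_A u f)) f = vector_field (\<lambda>i. (- phi i k u) *\<^sub>C 1) f"
  proof (rule derivation_eqI[OF derivation_commutator[OF derivation_restr_A derivation_pd] derivation_vector_field])
    fix s :: nat assume s: "s \<in> {1..16}"
    have "restr_A u (pd k (x_var s)) = 0"
      using k s by (simp add: pd_x_var derivation_0_1[OF derivation_restr_A] del: One_nat_def)
    moreover have "pd k (restr_A u (x_var s)) = phi s k u *\<^sub>C 1"
      using k s by (simp add: restr_A_x_var pd_sum pd_scaleC pd_x_var if_distrib[of "\<lambda>z. _ *\<^sub>C z"]
          del: One_nat_def cong: if_cong sum.cong_simp)
    ultimately show "restr_A u (pd k (x_var s)) - pd k (restr_A u (x_var s)) = vector_field (\<lambda>i. (- phi i k u) *\<^sub>C 1) (x_var s)"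
      using s by (simp add: vector_field_x_var del: One_nat_def)
  qed
  then show ?thesis using vf by simp
qed

lemma phi_bracket:
  assumes u: "u \<in> G_0" and v: "v \<in> G_0" and i: "i \<in> {1..16}"
  shows "phi i j (E6_bracket u v) = (\<Sum>k=1..16. phi i k v * phi k j u) - (\<Sum>k=1..16. phi i k u * phi k j v)"
proof -
  have two: "E6_bracket u (E6_bracket v (eta i)) = (\<Sum>k=1..16. phi i k v *\<^sub>C E6_bracket u (eta k))"
    if "v \<in> G_0" for u v
    using bracket_eta_expansion[OF that i] by (simp add: E6_bracket_sum_right E6_bracket_scale_right)
  have "E6_bracket (E6_bracket u v) (eta i)
    = (\<Sum>k=1..16. phi i k v *\<^sub>C E6_bracket u (eta k)) - (\<Sum>k=1..16. phi i k u *\<^sub>C E6_bracket v (eta k))"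
    using E6_bracket_bracket[of u v "eta i"] two[OF v, of u] two[OF u, of v] by (simp add: algebra_simps)
  then show ?thesis by (simp add: phi_def E6_coeff_sum E6_coeff_diff E6_coeff_scaleC lookup_minus)
qed

text \<open>On linear forms \<open>restr_A u\<close> is the bracket with u on the span of the
  \<eta>'s, with x_i in place of \<eta>_i. Compatibility with brackets is thus the Jacobi identity,
  in the matrix form \<open>phi_bracket\<close>.\<close>

lemma restr_A_bracket:
  assumes u: "u \<in> G_0" and v: "v \<in> G_0"
  shows "restr_A (E6_bracket u v) f = restr_A u (restr_A v f) - restr_A v (restr_A u f)"
proof -
  have two: "restr_A u (restr_A v (x_var s)) = (\<Sum>j=1..16. (\<Sum>k=1..16. phi s k v * phi k j u) *\<^sub>C x_var j)"
    if "s \<in> {1..16}" for u v s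
  proof -
    have "restr_A u (restr_A v (x_var s)) = (\<Sum>k=1..16. phi s k v *\<^sub>C restr_A u (x_var k))"
      unfolding restr_A_x_var[OF that]
      using derivation_clinear[OF derivation_restr_A] by (simp add: clinear.linear_sum clinear.linear_scale)
    also have "\<dots> = (\<Sum>k=1..16. \<Sum>j=1..16. (phi s k v * phi k j u) *\<^sub>C x_var j)"
      by (rule sum.cong) (simp_all add: restr_A_x_var complex_vector.scale_sum_right scaleC_scaleC del: One_nat_def)
    also have "\<dots> = (\<Sum>j=1..16. (\<Sum>k=1..16. phi s k v * phi k j u) *\<^sub>C x_var j)"
      by (subst sum.swap) (simp add: complex_vector.scale_sum_left)
    finally show ?thesis .
  qed
  have "restr_A (E6_bracket u v) f = (\<lambda>f. restr_A u (restr_A v f) - restr_A v (restr_A u f)) f"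
  proof (rule derivation_eqI[OF derivation_restr_A derivation_commutator[OF derivation_restr_A derivation_restr_A]])
    fix s :: nat assume s: "s \<in> {1..16}"
    show "restr_A (E6_bracket u v) (x_var s) = restr_A u (restr_A v (x_var s)) - restr_A v (restr_A u (x_var s))"
      unfolding two[OF s] unfolding restr_A_x_var[OF s] phi_bracket[OF u v s]
      by (simp add: complex_vector.scale_left_diff_distrib sum_subtractf)
  qed
  then show ?thesis .
qed

lemma euler_D_restr_A: "euler_D (restr_A u f) = restr_A u (euler_D f)"
proof -
  have "(\<lambda>f. euler_D (restr_A u f) - restr_A u (euler_D f)) f = (vector_field (\<lambda>_. 0)) f"
  proof (rule derivation_eqI[OF derivation_commutator[OF derivation_euler_D derivation_restr_A] derivation_vector_field])
    fix s :: nat assume s: "s \<in> {1..16}"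
    have "euler_D (restr_A u (x_var s)) = (\<Sum>j=1..16. phi s j u *\<^sub>C euler_D (x_var j))"
      unfolding restr_A_x_var[OF s]
      using derivation_clinear[OF derivation_euler_D] by (simp add: clinear.linear_sum clinear.linear_scale)
    also have "\<dots> = restr_A u (x_var s)"
      unfolding restr_A_x_var[OF s] by (rule sum.cong) (simp_all add: euler_D_x_var del: One_nat_def)
    finally show "euler_D (restr_A u (x_var s)) - restr_A u (euler_D (x_var s)) = vector_field (\<lambda>_. 0) (x_var s)"
      using s by (simp add: euler_D_x_var vector_field_def del: One_nat_def)
  qed
  then show ?thesis by (simp add: vector_field_def)
qed

lemma euler_D_zeta:
  assumes "k \<in> {1..10}"
  shows "euler_D (zeta k) = zeta k + zeta k"
proof -
  let ?t = "\<lambda>(c, a, b). of_int c * (x_var a * x_var b)"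
  have D: "euler_D (of_int c * (x_var a * x_var b)) = of_int c * (x_var a * x_var b) + of_int c * (x_var a * x_var b)"
    if "a \<in> {1..16}" "b \<in> {1..16}" for c a b
    using that clinear.linear_scale[OF derivation_clinear[OF derivation_euler_D]]
    by (simp add: of_int_scaleC derivation_mult[OF derivation_euler_D] euler_D_x_var mult_scaleC_left
        mult_scaleC_right scaleC_add_right del: One_nat_def)
  have "euler_D (zeta k) = (\<Sum>x\<leftarrow>zeta_terms k. euler_D (?t x))"
    unfolding zeta_terms[OF assms] by (rule clinear_sum_list[OF derivation_clinear[OF derivation_euler_D]])
  also have "\<dots> = (\<Sum>x\<leftarrow>zeta_terms k. ?t x + ?t x)"
  proof (rule arg_cong[where f = sum_list], rule map_cong[OF refl])
    fix x assume "x \<in> set (zeta_terms k)"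
    moreover obtain c a b where x: "x = (c, a, b)" by (cases x)
    ultimately have "a \<in> {1..16} \<and> b \<in> {1..16}" using zeta_terms_range[OF assms] by blast
    then show "euler_D (?t x) = ?t x + ?t x"
      unfolding x prod.case using D by blast
  qed
  also have "\<dots> = zeta k + zeta k" unfolding zeta_terms[OF assms] by (rule sum_list_addf)
  finally show ?thesis .
qed

text \<open>The coefficients of the vector field P_i are quadratic forms, so its commutator with the
  Euler field is P_i itself.\<close>

lemma euler_D_P_op:
  assumes i: "i \<in> {1..16}"
  shows "euler_D (P_op i f) = P_op i (euler_D f) + P_op i f"
proof -
  have "(\<lambda>f. euler_D (P_op i f) - P_op i (euler_D f)) f = P_op i f"
  proof (rule derivation_eqI[OF derivation_commutator[OF derivation_euler_D derivation_P_op] derivation_P_op])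
    fix s :: nat assume s: "s \<in> {1..16}"
    note lin = derivation_clinear[OF derivation_euler_D]
    have "euler_D (P_op i (x_var s)) = P_op i (x_var s) + P_op i (x_var s)"
      unfolding P_op_x_var[OF i s] clinear.linear_diff[OF lin] clinear.linear_sum[OF lin] of_int_scaleC
        clinear.linear_scale[OF lin]
      using i s
      by (simp add: derivation_mult[OF derivation_euler_D] euler_D_x_var euler_D_zeta mult_scaleC_right
          sum_distrib_left sum_negf del: One_nat_def)
    then show "euler_D (P_op i (x_var s)) - P_op i (euler_D (x_var s)) = P_op i (x_var s)"
      using s by (simp add: euler_D_x_var del: One_nat_def)
  qed
  then show ?thesis by (simp add: algebra_simps)
qed

section \<open>The identification of the orthogonal Lie algebra\<close>

lemma bij_betw_of_nat_10: "bij_betw (of_nat :: nat \<Rightarrow> 10) {1..10} UNIV"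
proof (rule bij_betw_imageI)
  have "\<exists>i\<in>{1..10}. k = (of_nat i :: 10)" for k
  proof (cases k)
    case (of_int z)
    then have z: "0 \<le> z" "z < 10" by auto
    show ?thesis
    proof (cases "z = 0")
      case True
      then have "k = of_nat 10" using of_int by simp
      then show ?thesis by (intro bexI[of _ 10]) auto
    next
      case False
      then have "nat z \<in> {1..10}" "k = of_nat (nat z)" using z of_int by (auto simp: of_nat_nat)
      then show ?thesis by blast
    qed
  qed
  then show surj: "(of_nat :: nat \<Rightarrow> 10) ` {1..10} = UNIV"
    by (metis UNIV_eq_I image_eqI)
  show "inj_on (of_nat :: nat \<Rightarrow> 10) {1..10}"
    by (rule eq_card_imp_inj_on) (simp_all add: surj del: One_nat_def)
qed

lemma of_nat_10_eq_iff:
  assumes "i \<in> {1..10}" "j \<in> {1..10}"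
  shows "(of_nat i :: 10) = of_nat j \<longleftrightarrow> i = j"
  using bij_betw_imp_inj_on[OF bij_betw_of_nat_10] assms by (auto dest: inj_onD)

lemma matrix_unit_nth:
  assumes "p \<in> {1..10}" "q \<in> {1..10}" "a \<in> {1..10}" "b \<in> {1..10}"
  shows "matrix_unit p q $ of_nat a $ of_nat b = (if a = p \<and> b = q then 1 else 0)"
  using assms by (simp add: matrix_unit_def of_nat_10_eq_iff del: One_nat_def)

lemma matrix_unit_mult:
  assumes "q \<in> {1..10}" "r \<in> {1..10}"
  shows "matrix_unit p q ** matrix_unit r s = (if q = r then matrix_unit p s else 0)"
proof -
  have "(\<Sum>k\<in>(UNIV :: 10 set). (if i = of_nat p \<and> k = of_nat q then 1 else 0) * (if k = of_nat r \<and> j = of_nat s then 1 else 0))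
    = (if q = r then if i = of_nat p \<and> j = of_nat s then 1 else 0 else (0 :: complex))" for i j :: 10
  proof -
    have "(\<Sum>k\<in>(UNIV :: 10 set). (if i = of_nat p \<and> k = of_nat q then 1 else 0) * (if k = of_nat r \<and> j = of_nat s then 1 else 0))
      = (\<Sum>k\<in>(UNIV :: 10 set). if k = of_nat q then (if i = of_nat p \<and> (of_nat q :: 10) = of_nat r \<and> j = of_nat s then 1 else 0) else (0 :: complex))"
      by (rule sum.cong) auto
    then show ?thesis using of_nat_10_eq_iff[OF assms] by simp
  qed
  then show ?thesis
    by (simp add: vec_eq_iff matrix_matrix_mult_def matrix_unit_def)
qed

text \<open>The index \<open>a\<close> stands for the weight \<open>\<epsilon>\<^sub>a\<close> of the vector representation, with
  \<open>\<epsilon>\<^bsub>5+i\<^esub> = -\<epsilon>\<^sub>i\<close>; doubled, since \<open>\<epsilon>\<^sub>i\<close> is only a half-integral combination of simple roots.\<close>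

definition dual_index :: "nat \<Rightarrow> nat"
  where "dual_index a = (if a \<le> 5 then a + 5 else a - 5)"

definition doubled_weight :: "nat \<Rightarrow> int6"
  where "doubled_weight a =
    [(2, 1, 2, 2, 1, 0),
     (0, 1, 2, 2, 1, 0),
     (0, 1, 0, 2, 1, 0),
     (0, 1, 0, 0, 1, 0),
     (0, 1, 0, 0, -1, 0),
     (-2, -1, -2, -2, -1, 0),
     (0, -1, -2, -2, -1, 0),
     (0, -1, 0, -2, -1, 0),
     (0, -1, 0, 0, -1, 0),
     (0, -1, 0, 0, 1, 0)] ! (a - 1)"

text \<open>The root \<epsilon>_a - \<epsilon>_b. All doubled weights agree modulo 2, so the
  divisions are exact.\<close>

definition weight_root :: "nat \<Rightarrow> nat \<Rightarrow> int6"
  where "weight_root a b = (case (doubled_weight a, doubled_weight b) of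
    ((a1, a2, a3, a4, a5, a6), (b1, b2, b3, b4, b5, b6)) \<Rightarrow>
      ((a1 - b1) div 2, (a2 - b2) div 2, (a3 - b3) div 2, (a4 - b4) div 2, (a5 - b5) div 2, (a6 - b6) div 2))"

text \<open>The signs are forced by the prescribed values of \<open>\<nu>\<close> on the generators.\<close>

definition nu_sign :: "nat \<Rightarrow> nat \<Rightarrow> int"
  where "nu_sign a b =
    [[0, 1, -1, 1, 1, 0, -1, 1, 1, -1],
     [-1, 0, 1, -1, -1, 1, 0, -1, -1, 1],
     [1, -1, 0, 1, 1, -1, 1, 0, 1, -1],
     [-1, 1, -1, 0, 1, -1, 1, -1, 0, 1],
     [-1, 1, -1, -1, 0, 1, -1, 1, -1, 0],
     [0, -1, 1, 1, -1, 0, 1, -1, 1, 1],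
     [1, 0, -1, -1, 1, -1, 0, 1, -1, -1],
     [-1, 1, 0, 1, -1, 1, -1, 0, 1, 1],
     [-1, 1, -1, 0, 1, -1, 1, -1, 0, 1],
     [1, -1, 1, -1, 0, -1, 1, -1, -1, 0]] ! (a - 1) ! (b - 1)"

text \<open>One notation for the three families spanning \<open>o10\<close>. Replacing (a, b) by
  (dual of b, dual of a) changes the sign; \<open>basis_pairs\<close> picks one pair from each such
  orbit on which the matrix is nonzero.\<close>

definition o10_elt :: "nat \<Rightarrow> nat \<Rightarrow> complex ^ 10 ^ 10"
  where "o10_elt a b = matrix_unit a b - matrix_unit (dual_index b) (dual_index a)"

text \<open>On the diagonal the value is the weight \<epsilon>_a as a Cartan element, whence the
  factor 1/2; the matrix with b dual to a is 0.\<close>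

definition nu_elt :: "nat \<Rightarrow> nat \<Rightarrow> E6"
  where "nu_elt a b = (if a = b then cartan_elt ((1 / 2) *\<^sub>C complexify (lattice_vec (doubled_weight a)))
    else if b = dual_index a then 0
    else of_int (nu_sign a b) *\<^sub>C root_vector (lattice_vec (weight_root a b)))"

definition root_pairs :: "(nat \<times> nat) list"
  where "root_pairs = [(i, j). i \<leftarrow> [1..<6], j \<leftarrow> [1..<6], i \<noteq> j]
    @ [(p, 5 + q). p \<leftarrow> [1..<6], q \<leftarrow> [1..<6], p < q] @ [(5 + p, q). p \<leftarrow> [1..<6], q \<leftarrow> [1..<6], p < q]"

definition basis_pairs :: "(nat \<times> nat) list"
  where "basis_pairs = [(i, i). i \<leftarrow> [1..<6]] @ root_pairs"

lemma basis_pairs_eq: "basis_pairs = [(1, 1), (2, 2), (3, 3), (4, 4), (5, 5)] @ root_pairs"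
  by (simp add: basis_pairs_def upt_rec)

lemma set_root_pairs: "set root_pairs = {(i, j) |i j. i \<in> {1..5} \<and> j \<in> {1..5} \<and> i \<noteq> j}
    \<union> {(p, 5 + q) |p q. 1 \<le> p \<and> p < q \<and> q \<le> 5} \<union> {(5 + p, q) |p q. 1 \<le> p \<and> p < q \<and> q \<le> 5}"
  by (auto simp: root_pairs_def)

lemma set_basis_pairs: "set basis_pairs = {(i, j) |i j. i \<in> {1..5} \<and> j \<in> {1..5}}
    \<union> {(p, 5 + q) |p q. 1 \<le> p \<and> p < q \<and> q \<le> 5} \<union> {(5 + p, q) |p q. 1 \<le> p \<and> p < q \<and> q \<le> 5}"
  by (auto simp: basis_pairs_def set_root_pairs)

lemma o10_eq_span: "o10 = cspan ((\<lambda>(a, b). o10_elt a b) ` set basis_pairs)"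
proof -
  have img: "(\<lambda>(a, b). o10_elt a b) ` {(g i j, h i j) |i j. P i j} = {m i j |i j. P i j}"
    if m: "\<And>i j. P i j \<Longrightarrow> o10_elt (g i j) (h i j) = m i j"
    for g h :: "nat \<Rightarrow> nat \<Rightarrow> nat" and P m
  proof (intro equalityI subsetI)
    fix x assume "x \<in> (\<lambda>(a, b). o10_elt a b) ` {(g i j, h i j) |i j. P i j}"
    then obtain i j where "P i j" "x = o10_elt (g i j) (h i j)" by auto
    then show "x \<in> {m i j |i j. P i j}" using m by blast
  next
    fix x assume "x \<in> {m i j |i j. P i j}"
    then obtain i j where ij: "P i j" "x = m i j" by blast
    then have "x = (\<lambda>(a, b). o10_elt a b) (g i j, h i j)" using m by simp
    then show "x \<in> (\<lambda>(a, b). o10_elt a b) ` {(g i j, h i j) |i j. P i j}" using ij(1) by blast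
  qed
  have "(\<lambda>(a, b). o10_elt a b) ` {(i, j) |i j. i \<in> {1..5} \<and> j \<in> {1..5}}
    = {matrix_unit i j - matrix_unit (5 + j) (5 + i) |i j. i \<in> {1..5} \<and> j \<in> {1..5}}"
    by (rule img) (simp add: o10_elt_def dual_index_def add.commute)
  moreover have "(\<lambda>(a, b). o10_elt a b) ` {(p, 5 + q) |p q. 1 \<le> p \<and> p < q \<and> q \<le> 5}
    = {matrix_unit p (5 + q) - matrix_unit q (5 + p) |p q. 1 \<le> p \<and> p < q \<and> q \<le> 5}"
    by (rule img) (simp add: o10_elt_def dual_index_def add.commute)
  moreover have "(\<lambda>(a, b). o10_elt a b) ` {(5 + p, q) |p q. 1 \<le> p \<and> p < q \<and> q \<le> 5}
    = {matrix_unit (5 + p) q - matrix_unit (5 + q) p |p q. 1 \<le> p \<and> p < q \<and> q \<le> 5}"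
    by (rule img) (simp add: o10_elt_def dual_index_def add.commute)
  ultimately show ?thesis unfolding o10_def set_basis_pairs image_Un by (simp only:)
qed

text \<open>On \<open>o10\<close> the entry at a basis pair (a, b) is the coordinate of its basis
  matrix, because the second matrix unit sits at a position that is not a basis pair. Reading
  entries makes the map linear on all matrices.\<close>

definition nu_map :: "complex ^ 10 ^ 10 \<Rightarrow> E6"
  where "nu_map A = (\<Sum>(a, b)\<leftarrow>basis_pairs. A $ of_nat a $ of_nat b *\<^sub>C nu_elt a b)"

abbreviation index_10 :: "nat list" where "index_10 \<equiv> [1..<11]"

lemma clinear_nu_map: "clinear nu_map"
proof (rule clinearI)
  have "(\<Sum>(a, b)\<leftarrow>xs. (A + B) $ of_nat a $ of_nat b *\<^sub>C nu_elt a b)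
    = (\<Sum>(a, b)\<leftarrow>xs. A $ of_nat a $ of_nat b *\<^sub>C nu_elt a b) + (\<Sum>(a, b)\<leftarrow>xs. B $ of_nat a $ of_nat b *\<^sub>C nu_elt a b)"
    for xs and A B :: "complex ^ 10 ^ 10"
    by (induction xs) (auto simp: scaleC_add_left)
  then show "nu_map (A + B) = nu_map A + nu_map B" for A B by (simp add: nu_map_def)
  have "(\<Sum>(a, b)\<leftarrow>xs. (z *\<^sub>C A) $ of_nat a $ of_nat b *\<^sub>C nu_elt a b)
    = z *\<^sub>C (\<Sum>(a, b)\<leftarrow>xs. A $ of_nat a $ of_nat b *\<^sub>C nu_elt a b)"
    for xs z and A :: "complex ^ 10 ^ 10"
    by (induction xs) (auto simp: scaleC_add_right scaleC_vec_def scaleC_scaleC scaleC_complex_def)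
  then show "nu_map (z *\<^sub>C A) = z *\<^sub>C nu_map A" for z A by (simp add: nu_map_def)
qed

section \<open>Values on basis matrices\<close>

lemma dual_index_range: "a \<in> {1..10} \<Longrightarrow> dual_index a \<in> {1..10}"
  by (auto simp: dual_index_def)

lemma sum_list_single:
  fixes g :: "'i \<Rightarrow> 'a::complex_vector"
  assumes "distinct xs"
  shows "(\<Sum>x\<leftarrow>xs. (if x = y then z else 0) *\<^sub>C g x) = (if y \<in> set xs then z *\<^sub>C g y else 0)"
  using assms by (induction xs) auto

lemma distinct_basis_pairs: "distinct basis_pairs"
  by code_simp

lemma basis_pairs_range: "(a, b) \<in> set basis_pairs \<Longrightarrow> a \<in> {1..10} \<and> b \<in> {1..10}"
  by (auto simp: set_basis_pairs)

lemma nu_map_matrix_unit: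
  assumes "p \<in> {1..10}" "q \<in> {1..10}"
  shows "nu_map (matrix_unit p q) = (if (p, q) \<in> set basis_pairs then nu_elt p q else 0)"
proof -
  have "nu_map (matrix_unit p q)
    = (\<Sum>x\<leftarrow>basis_pairs. (if x = (p, q) then 1 else 0) *\<^sub>C (\<lambda>(a, b). nu_elt a b) x)"
    unfolding nu_map_def
  proof (rule arg_cong[where f = sum_list], rule map_cong[OF refl])
    fix x assume x: "x \<in> set basis_pairs"
    obtain a b where ab: "x = (a, b)" by (cases x)
    then have "a \<in> {1..10}" "b \<in> {1..10}" using basis_pairs_range x by blast+
    then show "(case x of (a, b) \<Rightarrow> matrix_unit p q $ of_nat a $ of_nat b *\<^sub>C nu_elt a b)
      = (if x = (p, q) then 1 else 0) *\<^sub>C (\<lambda>(a, b). nu_elt a b) x"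
      using assms by (simp add: ab matrix_unit_nth del: One_nat_def)
  qed
  then show ?thesis
    by (simp add: sum_list_single[OF distinct_basis_pairs, of "(p, q)" 1 "\<lambda>(a, b). nu_elt a b"] scaleC_one
        del: One_nat_def)
qed

text \<open>The roots are invariant and the signs antisymmetric under the duality of index pairs, as
  required by the sign change of \<open>o10_elt\<close>.\<close>

lemma weight_tables:
  assumes "a \<in> {1..10}" "b \<in> {1..10}" "a \<noteq> b" "b \<noteq> dual_index a"
  shows "lattice_vec (weight_root a b) \<in> Phi_D5"
    and "nu_sign a b * nu_sign a b = 1"
    and "nu_sign (dual_index b) (dual_index a) = - nu_sign a b"
    and "weight_root (dual_index b) (dual_index a) = weight_root a b"
    and "(a, b) \<in> set basis_pairs \<longleftrightarrow> (dual_index b, dual_index a) \<notin> set basis_pairs"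
proof -
  have "list_all (\<lambda>a. list_all (\<lambda>b. a = b \<or> b = dual_index a \<or>
      (let r = weight_root a b in lattice_form r r = 2 \<and> snd (snd (snd (snd (snd r)))) = 0
        \<and> nu_sign a b * nu_sign a b = 1 \<and> nu_sign (dual_index b) (dual_index a) = - nu_sign a b
        \<and> weight_root (dual_index b) (dual_index a) = r
        \<and> ((a, b) \<in> set basis_pairs \<longleftrightarrow> (dual_index b, dual_index a) \<notin> set basis_pairs))) index_10) index_10"
    by code_simp
  note this[unfolded list_all_iff set_index_10 Let_def, THEN bspec, OF assms(1), THEN bspec, OF assms(2)]
  then have *: "lattice_form (weight_root a b) (weight_root a b) = 2"
    "snd (snd (snd (snd (snd (weight_root a b))))) = 0"
    and "nu_sign a b * nu_sign a b = 1"
    and "nu_sign (dual_index b) (dual_index a) = - nu_sign a b"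
    and "weight_root (dual_index b) (dual_index a) = weight_root a b"
    and "(a, b) \<in> set basis_pairs \<longleftrightarrow> (dual_index b, dual_index a) \<notin> set basis_pairs"
    using assms(3,4) by blast+
  then show "nu_sign a b * nu_sign a b = 1" "nu_sign (dual_index b) (dual_index a) = - nu_sign a b"
    "weight_root (dual_index b) (dual_index a) = weight_root a b"
    "(a, b) \<in> set basis_pairs \<longleftrightarrow> (dual_index b, dual_index a) \<notin> set basis_pairs" by blast+
  show "lattice_vec (weight_root a b) \<in> Phi_D5"
    using *(1,2) by (cases "weight_root a b") (simp add: Phi_D5_eq Phi_E6_def E6_form_lattice_vec)
qed

lemma doubled_weight_dual:
  assumes "a \<in> {1..10}"
  shows "lattice_vec (doubled_weight (dual_index a)) = - lattice_vec (doubled_weight a)"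
    and "dual_index (dual_index a) = a" and "dual_index a \<noteq> a"
    and "(a, a) \<in> set basis_pairs \<longleftrightarrow> (dual_index a, dual_index a) \<notin> set basis_pairs"
    and "(a, dual_index a) \<notin> set basis_pairs"
    and "lattice_vec (doubled_weight a) $ 6 = 0"
proof -
  have "list_all (\<lambda>a. int6_add (doubled_weight (dual_index a)) (doubled_weight a) = (0, 0, 0, 0, 0, 0)
     \<and> snd (snd (snd (snd (snd (doubled_weight a))))) = 0) index_10"
    by code_simp
  note * = this[unfolded list_all_iff set_index_10, THEN bspec, OF assms]
  have "lattice_vec (doubled_weight (dual_index a)) + lattice_vec (doubled_weight a) = 0"
    unfolding lattice_vec_add using * by (simp add: vec_eq_iff forall_6)
  then show "lattice_vec (doubled_weight (dual_index a)) = - lattice_vec (doubled_weight a)"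
    by (simp add: eq_neg_iff_add_eq_0)
  show "lattice_vec (doubled_weight a) $ 6 = 0"
    using * by (cases "doubled_weight a") simp
qed (use assms in \<open>auto simp: dual_index_def set_basis_pairs\<close>)

lemma nu_elt_dual:
  assumes "a \<in> {1..10}" "b \<in> {1..10}"
  shows "nu_elt (dual_index b) (dual_index a) = - nu_elt a b"
proof (cases "a = b \<or> b = dual_index a")
  case True
  then show ?thesis
    using doubled_weight_dual(1-3)[OF assms(1)]
    by (auto simp: nu_elt_def complexify_minus cartan_elt_scaleC cartan_elt_minus)
next
  case False
  moreover have "dual_index b \<noteq> dual_index a" "dual_index a \<noteq> dual_index (dual_index b)"
    using False doubled_weight_dual(2)[OF assms(1)] doubled_weight_dual(2)[OF assms(2)] by metis+
  ultimately show ?thesis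
    using weight_tables(3,4)[OF assms] by (simp add: nu_elt_def)
qed

lemma nu_map_o10_elt:
  assumes a: "a \<in> {1..10}" and b: "b \<in> {1..10}"
  shows "nu_map (o10_elt a b) = nu_elt a b"
proof -
  have eq: "nu_map (o10_elt a b) = (if (a, b) \<in> set basis_pairs then nu_elt a b else 0)
    - (if (dual_index b, dual_index a) \<in> set basis_pairs then - nu_elt a b else 0)"
    unfolding o10_elt_def clinear.linear_diff[OF clinear_nu_map] nu_map_matrix_unit[OF a b]
      nu_map_matrix_unit[OF dual_index_range[OF b] dual_index_range[OF a]] nu_elt_dual[OF a b] ..
  show ?thesis
  proof (cases "b = dual_index a")
    case True
    then have "nu_elt a b = 0" using doubled_weight_dual(3)[OF a] by (auto simp: nu_elt_def)
    then show ?thesis unfolding eq by simp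
  next
    case False
    have "(a, b) \<in> set basis_pairs \<longleftrightarrow> (dual_index b, dual_index a) \<notin> set basis_pairs"
    proof (cases "a = b")
      case True
      then show ?thesis using doubled_weight_dual(4)[OF a] by simp
    next
      case ne: False
      show ?thesis by (rule weight_tables(5)[OF a b ne False])
    qed
    then show ?thesis unfolding eq by auto
  qed
qed

text \<open>The two products consist of eight matrix-unit terms, governed by four index equalities;
  each equality collects two of them into a matrix of the same family.\<close>

lemma o10_elt_commutator:
  assumes "a \<in> {1..10}" "b \<in> {1..10}" "c \<in> {1..10}" "d \<in> {1..10}"
  shows "commutator (o10_elt a b) (o10_elt c d) = (if b = c then o10_elt a d else 0)
    - (if a = d then o10_elt c b else 0) - (if b = dual_index d then o10_elt a (dual_index c) else 0)
    + (if a = dual_index c then o10_elt (dual_index d) b else 0)"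
proof -
  note range = assms assms[THEN dual_index_range]
  note dd = doubled_weight_dual(2)[OF assms(1)] doubled_weight_dual(2)[OF assms(2)]
      doubled_weight_dual(2)[OF assms(3)] doubled_weight_dual(2)[OF assms(4)]
  have conds: "(dual_index a = c) = (a = dual_index c)"
    "(dual_index a = dual_index d) = (a = d)" "(d = a) = (a = d)" "(d = dual_index b) = (b = dual_index d)"
    "(dual_index c = a) = (a = dual_index c)" "(dual_index c = dual_index b) = (b = c)"
    using dd by metis+
  have mult_diff: "(A - B) ** (C - D) = A ** C - A ** D - B ** C + B ** D" for A B C D :: "complex ^ 10 ^ 10"
    by (simp add: vec_eq_iff matrix_matrix_mult_def sum_subtractf sum.distrib algebra_simps)
  have regroup: "(if p then A else 0) - (if r then B else 0) - (if s then C else 0) + (if q then D else 0)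
      - ((if q then E else 0) - (if r then F else 0) - (if s then G else 0) + (if p then H else 0))
    = (if p then A - H else 0) - (if q then E - D else 0) - (if r then B - F else 0) + (if s then G - C else 0)"
    for p q r s and A B C D E F G H :: "complex ^ 10 ^ 10"
    by auto
  show ?thesis
    unfolding commutator_def o10_elt_def mult_diff
      matrix_unit_mult[OF range(2) range(3)] matrix_unit_mult[OF range(2) range(8)]
      matrix_unit_mult[OF range(5) range(3)] matrix_unit_mult[OF range(5) range(8)]
      matrix_unit_mult[OF range(4) range(1)] matrix_unit_mult[OF range(4) range(6)]
      matrix_unit_mult[OF range(7) range(1)] matrix_unit_mult[OF range(7) range(6)] dd conds
    by (rule regroup)
qed

text \<open>The nonzero terms of the image of \<open>[X\<^sub>a\<^sub>b, X\<^sub>c\<^sub>d]\<close> under \<open>\<nu>\<close>.\<close>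

definition commutator_terms :: "nat \<Rightarrow> nat \<Rightarrow> nat \<Rightarrow> nat \<Rightarrow> (int \<times> nat \<times> nat) list"
  where "commutator_terms a b c d = filter (\<lambda>(z, x, y). y \<noteq> dual_index x)
    ((if b = c then [(1, a, d)] else []) @ (if a = d then [(-1, c, b)] else [])
     @ (if b = dual_index d then [(-1, a, dual_index c)] else []) @ (if a = dual_index c then [(1, dual_index d, b)] else []))"

lemma nu_map_commutator:
  assumes "a \<in> {1..10}" "b \<in> {1..10}" "c \<in> {1..10}" "d \<in> {1..10}"
  shows "nu_map (commutator (o10_elt a b) (o10_elt c d))
    = (\<Sum>(z, x, y)\<leftarrow>commutator_terms a b c d. of_int z *\<^sub>C nu_elt x y)"
proof -
  note range = assms assms[THEN dual_index_range]
  \<comment> \<open>The discarded terms belong to index pairs (x, dual of x), where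
    \<open>nu_elt\<close> is 0.\<close>
  have filter: "(\<Sum>(z, x, y)\<leftarrow>filter (\<lambda>(z, x, y). y \<noteq> dual_index x) xs. of_int z *\<^sub>C nu_elt x y)
    = (\<Sum>(z, x, y)\<leftarrow>xs. of_int z *\<^sub>C nu_elt x y)" if "\<forall>(z, x, y)\<in>set xs. x \<in> {1..10}" for xs
    using that
  proof (induction xs)
    case (Cons p xs)
    obtain z x y where p: "p = (z, x, y)" by (cases p)
    have "nu_elt x (dual_index x) = 0" if "x \<in> {1..10}"
      using doubled_weight_dual(3)[OF that] by (auto simp: nu_elt_def)
    with Cons p show ?case by auto
  qed simp
  show ?thesis
    unfolding commutator_terms_def
    by (subst filter)
      (use range in \<open>auto simp: o10_elt_commutator clinear.linear_add[OF clinear_nu_map] clinear.linear_diff[OF clinear_nu_map]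
        nu_map_o10_elt clinear.linear_0[OF clinear_nu_map] scaleC_one simp del: One_nat_def\<close>)
qed

definition int6_scale :: "int \<Rightarrow> int6 \<Rightarrow> int6"
  where "int6_scale z = (\<lambda>(a1, a2, a3, a4, a5, a6). (z * a1, z * a2, z * a3, z * a4, z * a5, z * a6))"

lemma lattice_vec_scale: "lattice_vec (int6_scale z x) = z *s lattice_vec x"
  by (cases x) (simp add: vec_eq_iff forall_6 int6_scale_def)

definition weight_sum :: "(int \<times> nat \<times> nat) list \<Rightarrow> int6"
  where "weight_sum ts = foldr (\<lambda>(z, x, y) w. int6_add (int6_scale z (doubled_weight x)) w) ts (0, 0, 0, 0, 0, 0)"

text \<open>The homomorphism property for two basis matrices in integer arithmetic, suitable for
  evaluating all 45 * 45 pairs. Diagonal values are doubled, hence the factors 2. For two root pairs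
  the branches are opposite roots, sum a root, and sum neither 0 nor a root. The case of a root pair
  against a diagonal pair is left to antisymmetry.\<close>

definition commutator_check :: "nat \<Rightarrow> nat \<Rightarrow> nat \<Rightarrow> nat \<Rightarrow> bool"
  where "commutator_check a b c d \<longleftrightarrow> (let ts = commutator_terms a b c d; q = weight_root c d in
    if a = b then
      if c = d then list_all (\<lambda>(z, x, y). x = y) ts \<and> weight_sum ts = (0, 0, 0, 0, 0, 0)
      else d \<noteq> dual_index c \<and> list_all (\<lambda>(z, x, y). x \<noteq> y \<and> y \<noteq> dual_index x \<and> weight_root x y = q) ts
        \<and> 2 * sum_list (map (\<lambda>(z, x, y). z * nu_sign x y) ts) = lattice_form (doubled_weight a) q * nu_sign c d
    else if c = d then True
    else b \<noteq> dual_index a \<and> d \<noteq> dual_index c \<and>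
     (let r = weight_root a b; s = int6_add r q; e = nu_sign a b * nu_sign c d in
      if s = (0, 0, 0, 0, 0, 0) then list_all (\<lambda>(z, x, y). x = y) ts \<and> weight_sum ts = int6_scale (- e) (int6_add r r)
      else if lattice_form r q = -1
      then length ts = 1 \<and> (case hd ts of (z, x, y) \<Rightarrow>
        x \<noteq> y \<and> y \<noteq> dual_index x \<and> weight_root x y = s \<and> z * nu_sign x y = e * lattice_sign r q)
      else ts = []))"

lemma commutator_check: "list_all (\<lambda>(a, b). list_all (\<lambda>(c, d). commutator_check a b c d) basis_pairs) basis_pairs"
  by code_simp

lemma zero_lattice_vec: "lattice_vec x = 0 \<longleftrightarrow> x = (0, 0, 0, 0, 0, 0)"
  by (cases x) (auto simp: vec_eq_iff forall_6)

lemma complexify_scale: "complexify (z *s x) = of_int z *\<^sub>C complexify x"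
  by (simp add: complexify_def vec_eq_iff scaleC_vec_def scaleC_complex_def)

lemma nu_elt_diag_sum:
  assumes "list_all (\<lambda>(z, x, y). x = y) ts"
  shows "(\<Sum>(z, x, y)\<leftarrow>ts. of_int z *\<^sub>C nu_elt x y)
    = cartan_elt ((1 / 2) *\<^sub>C complexify (lattice_vec (weight_sum ts)))"
  using assms
proof (induction ts)
  case Nil
  then show ?case
    using zero_lattice_vec[of "(0, 0, 0, 0, 0, 0)"] by (simp add: weight_sum_def complexify_zero cartan_elt_zero)
next
  case (Cons t ts)
  obtain z x y where t: "t = (z, x, y)" by (cases t)
  have "weight_sum (t # ts) = int6_add (int6_scale z (doubled_weight x)) (weight_sum ts)"
    by (simp add: t weight_sum_def)
  then have "lattice_vec (weight_sum (t # ts)) = z *s lattice_vec (doubled_weight x) + lattice_vec (weight_sum ts)"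
    by (simp flip: lattice_vec_add lattice_vec_scale)
  then show ?case
    using Cons by (simp add: t nu_elt_def complexify_add complexify_scale scaleC_add_right cartan_elt_add
        cartan_elt_scaleC scaleC_scaleC mult.commute)
qed

lemma nu_bracket_basis:
  assumes ab: "(a, b) \<in> set basis_pairs" and cd: "(c, d) \<in> set basis_pairs"
  shows "nu_map (commutator (o10_elt a b) (o10_elt c d)) = E6_bracket (nu_elt a b) (nu_elt c d)"
proof -
  have check: "commutator_check a b c d" if "(a, b) \<in> set basis_pairs" "(c, d) \<in> set basis_pairs" for a b c d
    using commutator_check[unfolded list_all_iff, THEN bspec, OF that(1), unfolded prod.case, THEN bspec, OF that(2)]
    by simp
  have range: "a \<in> {1..10}" "b \<in> {1..10}" if "(a, b) \<in> set basis_pairs" for a b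
    using basis_pairs_range[OF that] by auto
  have in_Phi: "lattice_vec (weight_root a b) \<in> Phi_E6"
    if "(a, b) \<in> set basis_pairs" "a \<noteq> b" "b \<noteq> dual_index a" for a b
    using weight_tables(1)[OF range[OF that(1)] that(2,3)] by (simp add: Phi_D5_eq)
  have diag: "nu_map (commutator (o10_elt a a) (o10_elt c d)) = E6_bracket (nu_elt a a) (nu_elt c d)"
    if aa: "(a, a) \<in> set basis_pairs" and cd: "(c, d) \<in> set basis_pairs" for a c d
  proof -
    let ?ts = "commutator_terms a a c d"
    note map = nu_map_commutator[OF range[OF aa] range[OF cd]]
    note ck = check[OF aa cd, unfolded commutator_check_def Let_def]
    show ?thesis
    proof (cases "c = d")
      case True
      have "list_all (\<lambda>(z, x, y). x = y) ?ts \<and> weight_sum ?ts = (0, 0, 0, 0, 0, 0)" using ck True by simp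
      then show ?thesis
        using zero_lattice_vec[of "(0, 0, 0, 0, 0, 0)"]
        by (simp add: map nu_elt_diag_sum complexify_zero cartan_elt_zero) (simp add: nu_elt_def True bracket_cartan_cartan)
    next
      case False
      have 1: "d \<noteq> dual_index c"
        and 2: "list_all (\<lambda>(z, x, y). x \<noteq> y \<and> y \<noteq> dual_index x \<and> weight_root x y = weight_root c d) ?ts"
        and 3: "2 * sum_list (map (\<lambda>(z, x, y). z * nu_sign x y) ?ts)
          = lattice_form (doubled_weight a) (weight_root c d) * nu_sign c d"
        using ck False by auto
      have "(\<Sum>(z, x, y)\<leftarrow>ts. of_int z *\<^sub>C nu_elt x y)
        = of_int (sum_list (map (\<lambda>(z, x, y). z * nu_sign x y) ts)) *\<^sub>C root_vector (lattice_vec (weight_root c d))"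
        if "list_all (\<lambda>(z, x, y). x \<noteq> y \<and> y \<noteq> dual_index x \<and> weight_root x y = weight_root c d) ts" for ts
        using that by (induction ts) (auto simp: nu_elt_def scaleC_scaleC scaleC_add_left)
      note sum = this[OF 2]
      have "of_int (2 * sum_list (map (\<lambda>(z, x, y). z * nu_sign x y) ?ts))
        = (of_int (lattice_form (doubled_weight a) (weight_root c d) * nu_sign c d) :: complex)"
        unfolding 3 ..
      then have eq: "of_int (sum_list (map (\<lambda>(z, x, y). z * nu_sign x y) ?ts))
        = (1 / 2 * of_int (lattice_form (doubled_weight a) (weight_root c d)) * of_int (nu_sign c d) :: complex)"
        by (simp add: mult.commute[of _ 2])
      \<comment> \<open>The factor 1/2 in the diagonal value undoes the doubling of the weight in
        the integer identity.\<close>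
      have "E6_bracket (nu_elt a a) (nu_elt c d) = of_int (nu_sign c d) *\<^sub>C (1 / 2 *
        of_int (lattice_form (doubled_weight a) (weight_root c d))) *\<^sub>C root_vector (lattice_vec (weight_root c d))"
        using False 1
        by (simp add: nu_elt_def E6_bracket_scale_right bracket_cartan_root[OF in_Phi[OF cd False 1]]
            E6_form_scale_left E6_form_complexify E6_form_lattice_vec)
      then show ?thesis
        unfolding map sum eq by (simp add: scaleC_scaleC mult_ac)
    qed
  qed
  show ?thesis
  proof (cases "a = b")
    case True
    then show ?thesis using diag ab cd by simp
  next
    case ab_ne: False
    show ?thesis
    proof (cases "c = d")
      case True
      have "commutator (o10_elt a b) (o10_elt c d) = - commutator (o10_elt c d) (o10_elt a b)"
        by (simp add: commutator_def)
      then show ?thesis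
        using diag[of c a b] ab cd True E6_bracket_antisym[of "nu_elt a b" "nu_elt c d"]
        by (simp add: clinear.linear_neg[OF clinear_nu_map])
    next
      case cd_ne: False
      let ?ts = "commutator_terms a b c d" and ?r = "weight_root a b" and ?q = "weight_root c d"
      let ?e = "nu_sign a b * nu_sign c d"
      note map = nu_map_commutator[OF range[OF ab] range[OF cd]]
      note ck = check[OF ab cd, unfolded commutator_check_def Let_def if_not_P[OF ab_ne] if_not_P[OF cd_ne]]
      then have ne: "b \<noteq> dual_index a" "d \<noteq> dual_index c" by blast+
      note r = in_Phi[OF ab ab_ne ne(1)] and q = in_Phi[OF cd cd_ne ne(2)]
      have br: "E6_bracket (nu_elt a b) (nu_elt c d)
        = of_int ?e *\<^sub>C E6_bracket (root_vector (lattice_vec ?r)) (root_vector (lattice_vec ?q))"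
        using ab_ne cd_ne ne by (simp add: nu_elt_def E6_bracket_scale_left E6_bracket_scale_right scaleC_scaleC)
      show ?thesis
      proof (cases "int6_add ?r ?q = (0, 0, 0, 0, 0, 0)")
        case True
        then have ts: "list_all (\<lambda>(z, x, y). x = y) ?ts" "weight_sum ?ts = int6_scale (- ?e) (int6_add ?r ?r)"
          using ck by auto
        have "E6_bracket (root_vector (lattice_vec ?r)) (root_vector (lattice_vec ?q)) = - cartan_elt (complexify (lattice_vec ?r))"
          unfolding bracket_root_root[OF r q] lattice_vec_add zero_lattice_vec using True by simp
        \<comment> \<open>The doubled weights add up to minus the sign times r + r, so halving gives
          the Cartan element of r with that coefficient.\<close>
        moreover have "(1 / 2) *\<^sub>C of_int (- ?e) *\<^sub>C (h + h) = of_int (- ?e) *\<^sub>C h" for h :: "complex ^ 6"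
          unfolding scaleC_scaleC scaleC_add_right scaleC_add_left[symmetric] by simp
        then have "nu_map (commutator (o10_elt a b) (o10_elt c d)) = cartan_elt (of_int (- ?e) *\<^sub>C complexify (lattice_vec ?r))"
          unfolding map nu_elt_diag_sum[OF ts(1)] ts(2) lattice_vec_scale lattice_vec_add[symmetric] complexify_scale
            complexify_add by simp
        ultimately show ?thesis
          unfolding br by (simp add: cartan_elt_scaleC cartan_elt_minus)
      next
        case nz: False
        show ?thesis
        proof (cases "lattice_form ?r ?q = -1")
          case True
          obtain z x y where hd: "hd ?ts = (z, x, y)" by (cases "hd ?ts")
          have "length ?ts = 1" and ts': "x \<noteq> y" "y \<noteq> dual_index x" "weight_root x y = int6_add ?r ?q"
              "z * nu_sign x y = ?e * lattice_sign ?r ?q"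
            using ck nz True hd by auto
          from \<open>length ?ts = 1\<close> hd have ts: "?ts = [(z, x, y)]" by (cases ?ts) auto
          have "E6_bracket (root_vector (lattice_vec ?r)) (root_vector (lattice_vec ?q))
            = of_int (lattice_sign ?r ?q) *\<^sub>C root_vector (lattice_vec (int6_add ?r ?q))"
            unfolding bracket_root_root[OF r q] lattice_vec_add zero_lattice_vec E6_form_lattice_vec
              E6_cocycle_lattice_vec using nz True by simp
          moreover have "nu_map (commutator (o10_elt a b) (o10_elt c d))
            = of_int (z * nu_sign x y) *\<^sub>C root_vector (lattice_vec (weight_root x y))"
            unfolding map ts using ts'(1,2) by (simp add: nu_elt_def scaleC_scaleC)
          ultimately show ?thesis
            unfolding br ts'(3,4) by (simp add: scaleC_scaleC)
        next
          case False
          have "E6_bracket (root_vector (lattice_vec ?r)) (root_vector (lattice_vec ?q)) = 0"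
            unfolding bracket_root_root[OF r q] lattice_vec_add zero_lattice_vec E6_form_lattice_vec
            using nz False by simp
          moreover have "?ts = []" using ck nz False by auto
          ultimately show ?thesis unfolding map br by simp
        qed
      qed
    qed
  qed
qed

lemma scaleC_nth: "(z *\<^sub>C x) $ i = z * x $ i" for x :: "complex ^ 'n"
  by (simp add: scaleC_vec_def scaleC_complex_def)

lemma complexify_nth: "complexify x $ i = of_int (x $ i)"
  by (simp add: complexify_def)

lemma commutator_add_left: "commutator (A + A') B = commutator A B + commutator A' B"
  and commutator_add_right: "commutator B (A + A') = commutator B A + commutator B A'"
  and commutator_scale_left: "commutator (z *\<^sub>C A) B = z *\<^sub>C commutator A B"
  and commutator_scale_right: "commutator B (z *\<^sub>C A) = z *\<^sub>C commutator B A"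
  for A A' B :: "complex ^ 'n ^ 'n"
  by (simp_all add: commutator_def vec_eq_iff matrix_matrix_mult_def sum.distrib sum_subtractf scaleC_vec_def
      scaleC_complex_def sum_distrib_left algebra_simps)

lemma clinear_commutator: "clinear (commutator A)" "clinear (\<lambda>A. commutator A B)"
  for A B :: "complex ^ 'n ^ 'n"
  by (rule clinearI, rule commutator_add_right commutator_add_left,
    rule commutator_scale_right commutator_scale_left)+

lemma nu_map_commutator_o10:
  assumes "A \<in> o10" "B \<in> o10"
  shows "nu_map (commutator A B) = E6_bracket (nu_map A) (nu_map B)"
proof -
  note nu = clinear_nu_map
  have basis: "nu_map (commutator A B) = E6_bracket (nu_map A) (nu_map B)"
    if "A \<in> (\<lambda>(a, b). o10_elt a b) ` set basis_pairs" "B \<in> (\<lambda>(a, b). o10_elt a b) ` set basis_pairs" for A B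
  proof -
    obtain a b c d where *: "(a, b) \<in> set basis_pairs" "A = o10_elt a b" "(c, d) \<in> set basis_pairs" "B = o10_elt c d"
      using \<open>A \<in> _\<close> \<open>B \<in> _\<close> by auto
    then show ?thesis
      using nu_bracket_basis[OF *(1,3)] basis_pairs_range[OF *(1)] basis_pairs_range[OF *(3)]
      by (simp add: nu_map_o10_elt del: One_nat_def)
  qed
  have right: "nu_map (commutator A B) = E6_bracket (nu_map A) (nu_map B)"
    if "A \<in> (\<lambda>(a, b). o10_elt a b) ` set basis_pairs" "B \<in> o10" for A B
    by (rule clinear.linear_eq_on[where f = "\<lambda>B. nu_map (commutator A B)" and g = "\<lambda>B. E6_bracket (nu_map A) (nu_map B)",
      OF _ _ that(2)[unfolded o10_eq_span] basis[OF that(1)]])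
      (auto intro: clinear_comp[OF nu] clinear_comp[OF linear_E6_bracket_right] clinear_commutator nu)
  show ?thesis
    by (rule clinear.linear_eq_on[where f = "\<lambda>A. nu_map (commutator A B)" and g = "\<lambda>A. E6_bracket (nu_map A) (nu_map B)",
      OF _ _ assms(1)[unfolded o10_eq_span] right[OF _ assms(2)]])
      (auto intro: clinear_comp[OF nu] clinear_comp[OF linear_E6_bracket_left] clinear_commutator nu)
qed

text \<open>The diagonal coefficients are the coordinates of the Cartan part in the orthogonal basis
  \<epsilon>_1, ..., \<epsilon>_5, using \<alpha>_1, \<alpha>_3, \<alpha>_4, \<alpha>_5 as
  consecutive differences and \<alpha>_2 = \<epsilon>_4 + \<epsilon>_5. Each sign is its own
  inverse.\<close>

definition nu_inverse :: "E6 \<Rightarrow> complex ^ 10 ^ 10"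
  where "nu_inverse u = fst u $ 1 *\<^sub>C o10_elt 1 1 + (fst u $ 3 - fst u $ 1) *\<^sub>C o10_elt 2 2
    + (fst u $ 4 - fst u $ 3) *\<^sub>C o10_elt 3 3 + (fst u $ 5 + fst u $ 2 - fst u $ 4) *\<^sub>C o10_elt 4 4
    + (fst u $ 2 - fst u $ 5) *\<^sub>C o10_elt 5 5
    + (\<Sum>(a, b)\<leftarrow>root_pairs. (of_int (nu_sign a b) * E6_coeff u (Root (lattice_vec (weight_root a b)))) *\<^sub>C o10_elt a b)"

lemma clinear_nu_inverse: "clinear nu_inverse"
proof -
  have 1: "(\<Sum>(a, b)\<leftarrow>xs. (of_int (nu_sign a b) * E6_coeff (u + v) (Root (lattice_vec (weight_root a b)))) *\<^sub>C o10_elt a b)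
    = (\<Sum>(a, b)\<leftarrow>xs. (of_int (nu_sign a b) * E6_coeff u (Root (lattice_vec (weight_root a b)))) *\<^sub>C o10_elt a b)
    + (\<Sum>(a, b)\<leftarrow>xs. (of_int (nu_sign a b) * E6_coeff v (Root (lattice_vec (weight_root a b)))) *\<^sub>C o10_elt a b)" for xs u v
    by (induction xs) (auto simp: lookup_add distrib_left scaleC_add_left)
  have 2: "(\<Sum>(a, b)\<leftarrow>xs. (of_int (nu_sign a b) * E6_coeff (z *\<^sub>C u) (Root (lattice_vec (weight_root a b)))) *\<^sub>C o10_elt a b)
    = z *\<^sub>C (\<Sum>(a, b)\<leftarrow>xs. (of_int (nu_sign a b) * E6_coeff u (Root (lattice_vec (weight_root a b)))) *\<^sub>C o10_elt a b)" for xs z u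
    by (induction xs) (auto simp: E6_coeff_scaleC scaleC_add_right scaleC_scaleC mult_ac)
  show ?thesis
  proof (rule clinearI)
    show "nu_inverse (u + v) = nu_inverse u + nu_inverse v" for u v
      unfolding nu_inverse_def 1 by (simp add: scaleC_add_left complex_vector.scale_left_diff_distrib)
    show "nu_inverse (z *\<^sub>C u) = z *\<^sub>C nu_inverse u" for z u
      unfolding nu_inverse_def 2
      by (simp add: fst_scaleC scaleC_add_right scaleC_nth scaleC_scaleC right_diff_distrib distrib_left)
  qed
qed

section \<open>Bijectivity of the identification\<close>

lemma root_pairs_props:
  assumes "(a, b) \<in> set root_pairs"
  shows "a \<noteq> b" "b \<noteq> dual_index a" "a \<in> {1..10}" "b \<in> {1..10}"
  using assms by (auto simp: set_root_pairs dual_index_def)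

lemma weight_root_inj:
  assumes "(a, b) \<in> set root_pairs" "(c, d) \<in> set root_pairs"
  shows "weight_root a b = weight_root c d \<longleftrightarrow> (a, b) = (c, d)"
proof -
  have "distinct (map (\<lambda>(a, b). weight_root a b) root_pairs)" by code_simp
  then have "inj_on (\<lambda>(a, b). weight_root a b) (set root_pairs)" by (simp add: distinct_map)
  from inj_on_eq_iff[OF this assms] show ?thesis by simp
qed

lemma distinct_root_pairs: "distinct root_pairs"
  using distinct_basis_pairs by (simp add: basis_pairs_def)

lemma root_in_root_pairs:
  assumes "(a, b) \<in> set root_pairs"
  shows "lattice_vec (weight_root a b) \<in> Phi_E6"
  using weight_tables(1)[OF root_pairs_props(3,4,1,2)[OF assms]] by (simp add: Phi_D5_eq)

lemma nu_inverse_nu_elt: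
  assumes "(a, b) \<in> set basis_pairs"
  shows "nu_inverse (nu_elt a b) = o10_elt a b"
proof (cases "(a, b) \<in> set root_pairs")
  case True
  note ab = root_pairs_props[OF True]
  have nu: "nu_elt a b = of_int (nu_sign a b) *\<^sub>C root_vector (lattice_vec (weight_root a b))"
    using ab by (simp add: nu_elt_def)
  have "(\<Sum>(c, d)\<leftarrow>root_pairs. (of_int (nu_sign c d) * E6_coeff (nu_elt a b) (Root (lattice_vec (weight_root c d)))) *\<^sub>C o10_elt c d)
    = (\<Sum>x\<leftarrow>root_pairs. (if x = (a, b) then 1 else 0) *\<^sub>C (\<lambda>(c, d). o10_elt c d) x)"
  proof (rule arg_cong[where f = sum_list], rule map_cong[OF refl])
    fix x assume x: "x \<in> set root_pairs"
    obtain c d where cd: "x = (c, d)" by (cases x)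
    have "E6_coeff (nu_elt a b) (Root (lattice_vec (weight_root c d))) = (if (c, d) = (a, b) then of_int (nu_sign a b) else 0)"
      unfolding nu E6_coeff_scaleC E6_coeff_root_vector[OF root_in_root_pairs[OF True]]
        Root_inverse[OF root_in_root_pairs[OF x[unfolded cd]]] lattice_vec_eq_iff weight_root_inj[OF x[unfolded cd] True]
      by simp
    moreover have "of_int (nu_sign a b) * of_int (nu_sign a b) = (1 :: complex)"
      using weight_tables(2)[OF ab(3,4,1,2)] by (metis of_int_1 of_int_mult)
    ultimately show "(case x of (c, d) \<Rightarrow> (of_int (nu_sign c d) * E6_coeff (nu_elt a b) (Root (lattice_vec (weight_root c d)))) *\<^sub>C o10_elt c d)
      = (if x = (a, b) then 1 else 0) *\<^sub>C (\<lambda>(c, d). o10_elt c d) x"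
      by (auto simp: cd)
  qed
  also have "\<dots> = o10_elt a b"
    using sum_list_single[OF distinct_root_pairs, of "(a, b)" 1 "\<lambda>(c, d). o10_elt c d"] True by (simp add: scaleC_one)
  finally show ?thesis
    unfolding nu_inverse_def by (simp add: nu fst_scaleC fst_root_vector)
next
  case False
  have zero: "(\<Sum>(a, b)\<leftarrow>xs. (of_int (nu_sign a b) * E6_coeff (cartan_elt h) (Root (lattice_vec (weight_root a b)))) *\<^sub>C o10_elt a b) = 0"
    for xs h by (induction xs) (auto simp: E6_coeff_cartan)
  from assms False have "(a, b) \<in> {(1, 1), (2, 2), (3, 3), (4, 4), (5, 5)}" by (auto simp: basis_pairs_eq)
  then show ?thesis
    by (elim insertE emptyE; simp only: prod.inject; elim conjE; hypsubst)
      (simp_all add: nu_inverse_def nu_elt_def zero fst_cartan_elt scaleC_nth complexify_nth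
        doubled_weight_def scaleC_one)
qed

lemma nu_inverse_nu_map: "A \<in> o10 \<Longrightarrow> nu_inverse (nu_map A) = A"
proof -
  assume A: "A \<in> o10"
  have "(\<lambda>A. nu_inverse (nu_map A)) A = id A"
  proof (rule clinear.linear_eq_on[OF _ _ A[unfolded o10_eq_span]])
    show "clinear (\<lambda>A. nu_inverse (nu_map A))" by (rule clinear_comp[OF clinear_nu_inverse clinear_nu_map])
    show "clinear (id :: complex ^ 10 ^ 10 \<Rightarrow> _)" by (rule clinear_id)
    fix B assume "B \<in> (\<lambda>(a, b). o10_elt a b) ` set basis_pairs"
    then obtain a b where *: "(a, b) \<in> set basis_pairs" "B = o10_elt a b" by auto
    then show "nu_inverse (nu_map B) = id B"
      using basis_pairs_range[OF *(1)] by (simp add: nu_map_o10_elt nu_inverse_nu_elt del: One_nat_def)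
  qed
  then show ?thesis by simp
qed

text \<open>In the orthogonal basis a root of D5 is an integer vector of squared length 2, that is a
  sum or difference of two distinct basis vectors with signs; the enumeration runs over entries -1,
  0, 1.\<close>

lemma Phi_D5_weight_roots:
  assumes "\<alpha> \<in> Phi_D5"
  shows "\<exists>(a, b)\<in>set root_pairs. \<alpha> = lattice_vec (weight_root a b)"
proof -
  from assms have \<alpha>: "\<alpha> \<in> Phi_E6" "\<alpha> $ 6 = 0" by (auto simp: Phi_D5_eq)
  define e1 e2 e3 e4 e5 where "e1 = \<alpha> $ 1" and "e2 = \<alpha> $ 3 - \<alpha> $ 1" and "e3 = \<alpha> $ 4 - \<alpha> $ 3"
    and "e4 = \<alpha> $ 5 + \<alpha> $ 2 - \<alpha> $ 4" and "e5 = \<alpha> $ 2 - \<alpha> $ 5"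
  note e = e1_def e2_def e3_def e4_def e5_def
  have "e1 * e1 + e2 * e2 + e3 * e3 + e4 * e4 + e5 * e5 = 2"
    using E6_form_squares[of \<alpha>] \<alpha> by (simp add: Phi_E6_def e power2_eq_square algebra_simps)
  moreover have "e1 \<in> set [-1, 0, 1]" "e2 \<in> set [-1, 0, 1]" "e3 \<in> set [-1, 0, 1]" "e4 \<in> set [-1, 0, 1]" "e5 \<in> set [-1, 0, 1]"
    using Phi_E6_bounds(1-5)[OF \<alpha>(1)] unfolding \<alpha>(2) e by auto
  moreover have "list_all (\<lambda>e1. list_all (\<lambda>e2. list_all (\<lambda>e3. list_all (\<lambda>e4. list_all (\<lambda>e5.
    e1 * e1 + e2 * e2 + e3 * e3 + e4 * e4 + e5 * e5 = (2 :: int) \<longrightarrow>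
      (e1, (e1 + e2 + e3 + e4 + e5) div 2, e1 + e2, e1 + e2 + e3, (e1 + e2 + e3 + e4 - e5) div 2, 0)
        \<in> set (map (\<lambda>(a, b). weight_root a b) root_pairs)) [-1, 0, 1]) [-1, 0, 1]) [-1, 0, 1]) [-1, 0, 1]) [-1, 0, 1]"
    by code_simp
  ultimately have "(e1, (e1 + e2 + e3 + e4 + e5) div 2, e1 + e2, e1 + e2 + e3, (e1 + e2 + e3 + e4 - e5) div 2, 0)
        \<in> set (map (\<lambda>(a, b). weight_root a b) root_pairs)"
    unfolding list_all_iff by blast
  \<comment> \<open>The sum e1 + e2 + e3 + e4 telescopes to the sum of the second and fifth
    coordinates, and e5 is their difference, so both numerators are exactly twice a
    coordinate.\<close>
  moreover have "(e1, (e1 + e2 + e3 + e4 + e5) div 2, e1 + e2, e1 + e2 + e3, (e1 + e2 + e3 + e4 - e5) div 2, 0)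
    = (\<alpha> $ 1, \<alpha> $ 2, \<alpha> $ 3, \<alpha> $ 4, \<alpha> $ 5, \<alpha> $ 6)"
    using \<alpha>(2) by (simp add: e)
  ultimately have "(\<alpha> $ 1, \<alpha> $ 2, \<alpha> $ 3, \<alpha> $ 4, \<alpha> $ 5, \<alpha> $ 6) \<in> (\<lambda>(a, b). weight_root a b) ` set root_pairs"
    by simp
  then obtain p where p: "p \<in> set root_pairs"
    "(\<alpha> $ 1, \<alpha> $ 2, \<alpha> $ 3, \<alpha> $ 4, \<alpha> $ 5, \<alpha> $ 6) = (\<lambda>(a, b). weight_root a b) p"
    by (rule imageE)
  have "\<alpha> = lattice_vec ((\<lambda>(a, b). weight_root a b) p)"
    unfolding p(2)[symmetric] by (rule lattice_vec_coords[symmetric])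
  then show ?thesis using p(1) by (intro bexI[of _ p]) (simp_all add: case_prod_unfold)
qed

text \<open>The simple roots are differences of consecutive weights, or \<epsilon>_4 + \<epsilon>_5,
  and every root vector of D5 is up to sign the image of a basis matrix; together these reach all
  generators.\<close>

lemma nu_map_image: "nu_map ` o10 = G_D5"
proof -
  let ?g = "(\<lambda>(a, b). nu_elt a b) ` set basis_pairs"
  have "nu_map ` (\<lambda>(a, b). o10_elt a b) ` set basis_pairs = ?g"
    unfolding image_image
    by (rule image_cong[OF refl]) (use basis_pairs_range in \<open>force simp: nu_map_o10_elt simp del: One_nat_def\<close>)
  then have image: "nu_map ` o10 = cspan ?g"
    unfolding o10_eq_span by (metis clinear.linear_span_image clinear_nu_map)
  have "?g \<subseteq> G_D5"
  proof (rule image_subsetI)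
    fix x assume "x \<in> set basis_pairs"
    moreover obtain a b where x: "x = (a, b)" by (cases x)
    ultimately have ab: "(a, b) \<in> set basis_pairs" by simp
    note r = basis_pairs_range[OF ab, THEN conjunct1] basis_pairs_range[OF ab, THEN conjunct2]
    consider "a = b" | "b = dual_index a" "a \<noteq> b" | "a \<noteq> b" "b \<noteq> dual_index a" by blast
    then have "nu_elt a b \<in> G_D5"
    proof cases
      case 1
      then show ?thesis
        using doubled_weight_dual(6)[OF r(1)]
        by (simp add: G_D5_iff nu_elt_def alpha_hat_bracket_cartan fst_cartan_elt scaleC_vec_def complexify_def)
    next
      case 2
      then show ?thesis by (simp add: nu_elt_def G_D5_iff)
    next
      case 3
      have "root_vector (lattice_vec (weight_root a b)) \<in> G_D5"
        unfolding G_D5_def by (rule complex_vector.span_base) (use weight_tables(1)[OF r 3] in blast)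
      then show ?thesis using 3 unfolding G_D5_def by (simp add: nu_elt_def complex_vector.span_scale)
    qed
    then show "(\<lambda>(a, b). nu_elt a b) x \<in> G_D5" by (simp add: x)
  qed
  then have sub: "cspan ?g \<subseteq> G_D5"
    unfolding G_D5_def by (metis complex_vector.span_mono complex_vector.span_span)
  have diag: "nu_elt i i \<in> cspan ?g" if "i \<in> {1, 2, 3, 4, 5}" for i
    by (rule complex_vector.span_base) (use that in \<open>force simp: basis_pairs_eq\<close>)
  have "cartan_elt (complexify (simple_root i)) \<in> cspan ?g" if "i \<in> {1..5}" for i
  proof -
    have eq: "cartan_elt (complexify (simple_root 1)) = nu_elt 1 1 - nu_elt 2 2"
      "cartan_elt (complexify (simple_root 3)) = nu_elt 2 2 - nu_elt 3 3"
      "cartan_elt (complexify (simple_root 4)) = nu_elt 3 3 - nu_elt 4 4"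
      "cartan_elt (complexify (simple_root 5)) = nu_elt 4 4 - nu_elt 5 5"
      "cartan_elt (complexify (simple_root 2)) = nu_elt 4 4 + nu_elt 5 5"
      unfolding nu_elt_def simple_root_nth
      by (simp_all add: doubled_weight_def flip: cartan_elt_diff cartan_elt_add,
        simp_all add: cartan_elt_def vec_eq_iff forall_6 scaleC_vec_def scaleC_complex_def complexify_def)
    from that have "i \<in> {1, 2, 3, 4, 5}" by (simp only: atLeastAtMost_5)
    then show ?thesis
      by (elim insertE emptyE; hypsubst; unfold eq; intro complex_vector.span_diff complex_vector.span_add diag; simp)
  qed
  moreover have "root_vector \<alpha> \<in> cspan ?g" if \<alpha>: "\<alpha> \<in> Phi_D5" for \<alpha>
  proof -
    obtain a b where ab: "(a, b) \<in> set root_pairs" "\<alpha> = lattice_vec (weight_root a b)"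
      using Phi_D5_weight_roots[OF \<alpha>] by auto
    note p = root_pairs_props[OF ab(1)]
    have "of_int (nu_sign a b) * of_int (nu_sign a b) = (1 :: complex)"
      using weight_tables(2)[OF p(3,4,1,2)] by (metis of_int_1 of_int_mult)
    then have "root_vector \<alpha> = of_int (nu_sign a b) *\<^sub>C nu_elt a b"
      using p ab(2) by (simp add: nu_elt_def scaleC_scaleC scaleC_one)
    moreover have "(a, b) \<in> set basis_pairs" using ab(1) by (simp add: basis_pairs_def)
    ultimately show ?thesis
      by (metis (mono_tags, lifting) case_prod_conv complex_vector.span_base complex_vector.span_scale image_eqI)
  qed
  ultimately have "G_D5 \<subseteq> cspan ?g"
    unfolding G_D5_def by (intro complex_vector.span_minimal) (auto simp: complex_vector.subspace_span simp del: One_nat_def)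
  with sub image show ?thesis by blast
qed

text \<open>The hypothesis is part of the notion of a module over \<open>o10\<close>. Closure of
  \<open>G_D5\<close> under the bracket is transported from \<open>o10\<close> along the
  map.\<close>

lemma is_nu_nu_map:
  assumes "lie_algebra o10 commutator"
  shows "is_nu nu_map"
proof -
  have "lie_algebra G_D5 E6_bracket"
  proof (rule lie_algebra.intro)
    show "csubspace G_D5" unfolding G_D5_def by (rule complex_vector.subspace_span)
    show "E6_bracket x y \<in> G_D5" if xy: "x \<in> G_D5" "y \<in> G_D5" for x y
    proof -
      obtain A B where "x = nu_map A" "y = nu_map B" "A \<in> o10" "B \<in> o10"
        using xy nu_map_image by blast
      then show ?thesis
        using nu_map_image nu_map_commutator_o10 lie_algebra.bracket_closed[OF assms] by (metis imageI)
    qed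
  qed (use lie_algebra_E6 in \<open>auto simp: lie_algebra_def\<close>)
  then have iso: "lie_algebra_iso o10 commutator G_D5 E6_bracket nu_map"
  proof (intro lie_algebra_iso.intro lie_algebra_iso_axioms.intro assms)
    show "bij_betw nu_map o10 G_D5"
      unfolding bij_betw_def using nu_map_image nu_inverse_nu_map by (metis inj_on_inverseI)
  qed (simp_all add: clinear.linear_add[OF clinear_nu_map] clinear.linear_scale[OF clinear_nu_map] nu_map_commutator_o10)
  have val: "nu_map (matrix_unit a b - matrix_unit a' b') = u"
    if "a \<in> {1..10}" "b \<in> {1..10}" "a' = dual_index b" "b' = dual_index a" "nu_elt a b = u" for a b a' b' u
    using nu_map_o10_elt[OF that(1,2)] that(3-5) by (simp add: o10_elt_def)
  have minus: "- simple_root 1 = lattice_vec (-1, 0, 0, 0, 0, 0)" "- simple_root 2 = lattice_vec (0, -1, 0, 0, 0, 0)"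
    "- simple_root 3 = lattice_vec (0, 0, -1, 0, 0, 0)" "- simple_root 4 = lattice_vec (0, 0, 0, -1, 0, 0)"
    "- simple_root 5 = lattice_vec (0, 0, 0, 0, -1, 0)"
    unfolding simple_root_nth by (simp_all add: vec_eq_iff forall_6)
  show ?thesis
    unfolding is_nu_def
    by (intro conjI iso val; (unfold minus)?; (unfold simple_root_nth)?;
      simp add: dual_index_def nu_elt_def nu_sign_def weight_root_def doubled_weight_def scaleC_one)
qed

section \<open>The action of the degree-zero part on the module\<close>

text \<open>The explicit map shows that the choice defining \<open>nu\<close> succeeds, so
  \<open>nu\<close> is an isomorphism with the prescribed values.\<close>

lemma is_nu_nu: "lie_algebra o10 commutator \<Longrightarrow> is_nu nu"
  unfolding nu_def by (rule someI[of is_nu nu_map]) (rule is_nu_nu_map)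

definition nu_inv :: "E6 \<Rightarrow> complex ^ 10 ^ 10"
  where "nu_inv = inv_into o10 nu"

definition D5_part :: "E6 \<Rightarrow> E6"
  where "D5_part u = u - alpha_hat_coeff u *\<^sub>C alpha_hat"

lemma fst_alpha_hat_6: "fst alpha_hat $ 6 = 4"
  by (simp add: alpha_hat_eq fst_cartan_elt complexify_nth)

lemma alpha_hat_coeff_add: "alpha_hat_coeff (u + v) = alpha_hat_coeff u + alpha_hat_coeff v"
  and alpha_hat_coeff_scaleC: "alpha_hat_coeff (z *\<^sub>C u) = z * alpha_hat_coeff u"
  by (simp_all add: alpha_hat_coeff_def fst_scaleC scaleC_nth add_divide_distrib)

lemma D5_part_add: "D5_part (u + v) = D5_part u + D5_part v"
  and D5_part_scaleC: "D5_part (z *\<^sub>C u) = z *\<^sub>C D5_part u"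
  by (simp_all add: D5_part_def alpha_hat_coeff_add alpha_hat_coeff_scaleC scaleC_add_left
      complex_vector.scale_right_diff_distrib scaleC_scaleC)

lemma alpha_hat_bracket_self: "E6_bracket alpha_hat alpha_hat = 0"
  by (subst (2) alpha_hat_eq) (rule alpha_hat_bracket_cartan)

lemma D5_part_in: "u \<in> G_0 \<Longrightarrow> D5_part u \<in> G_D5"
  by (simp add: G_D5_iff G_0_iff D5_part_def E6_bracket_diff_right E6_bracket_scale_right alpha_hat_bracket_self
      fst_scaleC scaleC_nth alpha_hat_coeff_def fst_alpha_hat_6)

text \<open>\<open>alpha_hat\<close> is central in \<open>G_0\<close>.\<close>

lemma bracket_D5_part:
  assumes "u \<in> G_0" "v \<in> G_0"
  shows "E6_bracket u v = E6_bracket (D5_part u) (D5_part v)"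
proof -
  have "E6_bracket x alpha_hat = 0" if "x \<in> G_0" for x
    using that E6_bracket_antisym[of x alpha_hat] by (simp add: G_0_iff)
  then show ?thesis
    using assms by (simp add: D5_part_def E6_bracket_diff_left E6_bracket_diff_right E6_bracket_scale_left
        E6_bracket_scale_right G_0_iff alpha_hat_bracket_self)
qed

lemma varrho_eq: "varrho c \<rho> u v = \<rho> (nu_inv (D5_part u)) v + (alpha_hat_coeff u * (2 * c)) *\<^sub>C v"
  by (simp add: varrho_def Let_def nu_inv_def D5_part_def scaleC_scaleC)

context
  assumes o10: "lie_algebra o10 commutator"
begin

interpretation iso: lie_algebra_iso o10 commutator G_D5 E6_bracket nu
  using is_nu_nu[OF o10] by (simp add: is_nu_def)

lemma nu_inv_in: "x \<in> G_D5 \<Longrightarrow> nu_inv x \<in> o10"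
  unfolding nu_inv_def using iso.bij by (metis bij_betw_imp_surj_on inv_into_into)

lemma nu_nu_inv: "x \<in> G_D5 \<Longrightarrow> nu (nu_inv x) = x"
  unfolding nu_inv_def using iso.bij by (metis bij_betw_inv_into_right)

lemma nu_inv_eqI: "A \<in> o10 \<Longrightarrow> nu A = x \<Longrightarrow> nu_inv x = A"
  unfolding nu_inv_def using iso.bij by (metis bij_betw_inv_into_left)

lemma nu_inv_add: "x \<in> G_D5 \<Longrightarrow> y \<in> G_D5 \<Longrightarrow> nu_inv (x + y) = nu_inv x + nu_inv y"
  by (rule nu_inv_eqI)
    (simp_all add: nu_inv_in nu_nu_inv iso.iso_add complex_vector.subspace_add[OF iso.A.subspace])

lemma nu_inv_scaleC: "x \<in> G_D5 \<Longrightarrow> nu_inv (z *\<^sub>C x) = z *\<^sub>C nu_inv x"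
  by (rule nu_inv_eqI)
    (simp_all add: nu_inv_in nu_nu_inv iso.iso_scale complex_vector.subspace_scale[OF iso.A.subspace])

lemma nu_inv_bracket: "x \<in> G_D5 \<Longrightarrow> y \<in> G_D5 \<Longrightarrow> nu_inv (E6_bracket x y) = commutator (nu_inv x) (nu_inv y)"
  by (rule nu_inv_eqI) (simp_all add: nu_inv_in nu_nu_inv iso.iso_bracket iso.A.bracket_closed)

text \<open>Brackets in \<open>G_0\<close> depend only on the D5 parts and stay in
  \<open>G_D5\<close>. This agrees with scalars commuting: c cannot appear in the image of a
  bracket.\<close>

lemma alpha_hat_coeff_bracket:
  assumes "u \<in> G_0" "v \<in> G_0"
  shows "alpha_hat_coeff (E6_bracket u v) = 0"
proof -
  have "E6_bracket (D5_part u) (D5_part v) \<in> G_D5"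
    using assms by (simp add: iso.B.bracket_closed D5_part_in)
  then show ?thesis
    using assms by (simp add: bracket_D5_part G_D5_iff alpha_hat_coeff_def)
qed

end

context
  fixes \<rho> :: "complex ^ 10 ^ 10 \<Rightarrow> 'm::complex_vector \<Rightarrow> 'm"
  assumes M: "lie_module o10 commutator \<rho>"
begin

interpretation M: lie_module o10 commutator \<rho> by (rule M)

lemmas o10_alg = M.lie_algebra_axioms

lemma clinear_varrho:
  assumes "u \<in> G_0"
  shows "clinear (varrho c \<rho> u)"
proof -
  note lin = M.act_linear[OF nu_inv_in[OF o10_alg D5_part_in[OF assms]]]
  show ?thesis
    by (rule clinearI)
      (simp_all add: varrho_eq clinear.linear_add[OF lin] clinear.linear_scale[OF lin] scaleC_add_right scaleC_scaleC mult_ac)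
qed

lemma varrho_add:
  assumes "u \<in> G_0" "u' \<in> G_0"
  shows "varrho c \<rho> (u + u') v = varrho c \<rho> u v + varrho c \<rho> u' v"
  using assms
  by (simp add: varrho_eq D5_part_add nu_inv_add[OF o10_alg] D5_part_in M.act_add nu_inv_in[OF o10_alg] alpha_hat_coeff_add
      distrib_right scaleC_add_left)

lemma varrho_scaleC:
  assumes "u \<in> G_0"
  shows "varrho c \<rho> (z *\<^sub>C u) v = z *\<^sub>C varrho c \<rho> u v"
  using assms
  by (simp add: varrho_eq D5_part_scaleC nu_inv_scaleC[OF o10_alg] D5_part_in M.act_scale nu_inv_in[OF o10_alg]
      alpha_hat_coeff_scaleC scaleC_add_right scaleC_scaleC mult.assoc)

lemma varrho_bracket:
  assumes u: "u \<in> G_0" and u': "u' \<in> G_0"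
  shows "varrho c \<rho> (E6_bracket u u') v = varrho c \<rho> u (varrho c \<rho> u' v) - varrho c \<rho> u' (varrho c \<rho> u v)"
proof -
  note D = D5_part_in[OF u] D5_part_in[OF u']
  have "D5_part (E6_bracket u u') = E6_bracket (D5_part u) (D5_part u')"
    using alpha_hat_coeff_bracket[OF o10_alg u u'] bracket_D5_part[OF u u'] by (simp add: D5_part_def)
  then have "varrho c \<rho> (E6_bracket u u') v = \<rho> (commutator (nu_inv (D5_part u)) (nu_inv (D5_part u'))) v"
    by (simp add: varrho_eq alpha_hat_coeff_bracket[OF o10_alg u u'] nu_inv_bracket[OF o10_alg D])
  then show ?thesis
    using nu_inv_in[OF o10_alg D(1)] nu_inv_in[OF o10_alg D(2)]
    by (simp add: M.act_bracket varrho_eq clinear.linear_add[OF M.act_linear] clinear.linear_scale[OF M.act_linear]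
        scaleC_add_right scaleC_scaleC mult_ac)
qed

end

lemma varrho_hom:
  assumes "lie_module_hom o10 commutator \<rho> \<sigma> g" "u \<in> G_0"
  shows "g (varrho c \<rho> u v) = varrho c \<sigma> u (g v)"
proof -
  interpret lie_module_hom o10 commutator \<rho> \<sigma> g by (rule assms)
  show ?thesis
    using nu_inv_in[OF M.lie_algebra_axioms D5_part_in[OF assms(2)]]
    by (simp add: varrho_eq clinear.linear_add[OF hom_linear] clinear.linear_scale[OF hom_linear] hom_act)
qed

section \<open>Existence and uniqueness of the action\<close>

lemma xi_coeff_linear: "xi_coeff i (u + v) = xi_coeff i u + xi_coeff i v" "xi_coeff i (z *\<^sub>C u) = z * xi_coeff i u"
  and eta_coeff_linear: "eta_coeff i (u + v) = eta_coeff i u + eta_coeff i v" "eta_coeff i (z *\<^sub>C u) = z * eta_coeff i u"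
  by (simp_all add: xi_coeff_def eta_coeff_def lookup_add E6_coeff_scaleC)

lemma G_0_part_linear: "G_0_part (u + v) = G_0_part u + G_0_part v" "G_0_part (z *\<^sub>C u) = z *\<^sub>C G_0_part u"
  by (simp_all add: G_0_part_def xi_coeff_linear eta_coeff_linear scaleC_add_left sum.distrib
      complex_vector.scale_right_diff_distrib complex_vector.scale_sum_right scaleC_scaleC)

lemma coeff_G_0:
  assumes "u \<in> G_0" "i \<in> {1..16}"
  shows "xi_coeff i u = 0" "eta_coeff i u = 0"
proof -
  have "root_vec (Root (beta i)) $ 6 \<noteq> 0" "root_vec (Root (- beta i)) $ 6 \<noteq> 0"
    using assms(2) by (simp_all add: Root_inverse beta_in_Phi_E6 Phi_E6_uminus beta_6 del: One_nat_def)
  then show "xi_coeff i u = 0" "eta_coeff i u = 0"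
    using assms(1) by (simp_all add: G_0_iff alpha_hat_centralizer_iff xi_coeff_def eta_coeff_def)
qed

lemma coeff_xi_eta:
  assumes "i \<in> {1..16}" "j \<in> {1..16}"
  shows "xi_coeff i (xi j) = (if i = j then 1 else 0)" "eta_coeff i (xi j) = 0"
    "eta_coeff i (eta j) = (if i = j then 1 else 0)" "xi_coeff i (eta j) = 0"
proof -
  have "xi j = (\<Sum>k=1..16. (if k = j then 1 else 0) *\<^sub>C xi k)" "eta j = (\<Sum>k=1..16. (if k = j then 1 else 0) *\<^sub>C eta k)"
    using assms(2) by (simp_all add: if_distrib[of "\<lambda>z. z *\<^sub>C _"] scaleC_one cong: if_cong)
  then show "xi_coeff i (xi j) = (if i = j then 1 else 0)" "eta_coeff i (xi j) = 0"
    "eta_coeff i (eta j) = (if i = j then 1 else 0)" "xi_coeff i (eta j) = 0"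
    using coeff_xi_sum[OF assms(1), of "\<lambda>k. if k = j then 1 else 0"] by (simp_all add: xi_coeff_def eta_coeff_def)
qed

text \<open>The defining formulas of the action are given separately for the three grades, so
  statements linear in u are proved grade by grade.\<close>

lemma graded_induct [case_names G_0 xi eta add scaleC]:
  assumes "\<And>u. u \<in> G_0 \<Longrightarrow> P u" "\<And>i. i \<in> {1..16} \<Longrightarrow> P (xi i)" "\<And>i. i \<in> {1..16} \<Longrightarrow> P (eta i)"
    and add: "\<And>u v. P u \<Longrightarrow> P v \<Longrightarrow> P (u + v)" and scale: "\<And>z u. P u \<Longrightarrow> P (z *\<^sub>C u)"
  shows "P u"
proof -
  have 0: "P 0" using scale[of "xi 1" 0] assms(2)[of 1] by simp
  have sum: "P (\<Sum>i\<in>I. f i)" if "\<And>i. i \<in> I \<Longrightarrow> P (f i)" for I :: "nat set" and f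
    using that by (induction I rule: infinite_finite_induct) (simp_all add: 0 add)
  show ?thesis
    by (subst E6_decomposition) (intro add sum scale assms(1-3) G_0_part_in)
qed

definition hat_G_0 :: "complex \<Rightarrow> (complex ^ 10 ^ 10 \<Rightarrow> 'm \<Rightarrow> 'm) \<Rightarrow> E6 \<Rightarrow> (poly16, 'm::complex_vector) tensor \<Rightarrow> (poly16, 'm) tensor"
  where "hat_G_0 c \<rho> u w = tensor_map (restr_A u) id w + tensor_map id (varrho c \<rho> u) w"

definition hat_eta :: "complex \<Rightarrow> (complex ^ 10 ^ 10 \<Rightarrow> 'm \<Rightarrow> 'm) \<Rightarrow> nat \<Rightarrow> (poly16, 'm::complex_vector) tensor \<Rightarrow> (poly16, 'm) tensor"
  where "hat_eta c \<rho> i w = tensor_map (P_op i) id w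
    + (\<Sum>r=1..16. tensor_map ((*) (x_var r)) (varrho c \<rho> (E6_bracket (xi r) (eta i))) w)"

text \<open>The witness for \<open>hat_formulas\<close>: prescribe the action on each component of
  the graded decomposition and add.\<close>

definition hat_action :: "complex \<Rightarrow> (complex ^ 10 ^ 10 \<Rightarrow> 'm \<Rightarrow> 'm) \<Rightarrow> E6 \<Rightarrow> (poly16, 'm::complex_vector) tensor \<Rightarrow> (poly16, 'm) tensor"
  where "hat_action c \<rho> u w = hat_G_0 c \<rho> (G_0_part u) w + (\<Sum>i=1..16. xi_coeff i u *\<^sub>C tensor_map (pd i) id w)
    + (\<Sum>i=1..16. eta_coeff i u *\<^sub>C hat_eta c \<rho> i w)"

lemma clinear_mult_poly: "clinear ((*) g)" for g :: poly16
  by (rule clinearI) (simp_all add: distrib_left mult_scaleC_right)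

lemma clinear_plus: "clinear f \<Longrightarrow> clinear g \<Longrightarrow> clinear (\<lambda>x. f x + g x)"
  by (rule clinearI) (simp_all add: clinear.linear_add clinear.linear_scale scaleC_add_right)

lemma clinear_sum: "(\<And>i. i \<in> I \<Longrightarrow> clinear (f i)) \<Longrightarrow> clinear (\<lambda>x. \<Sum>i\<in>I. f i x)"
  by (rule clinearI) (simp_all add: clinear.linear_add clinear.linear_scale sum.distrib complex_vector.scale_sum_right)

lemma clinear_scaleC: "clinear f \<Longrightarrow> clinear (\<lambda>x. z *\<^sub>C f x)"
  by (rule clinearI) (simp_all add: clinear.linear_add clinear.linear_scale scaleC_add_right scaleC_scaleC mult.commute)

lemma clinear_minus: "clinear f \<Longrightarrow> clinear g \<Longrightarrow> clinear (\<lambda>x. f x - g x)"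
  by (rule clinearI) (simp_all add: clinear.linear_add clinear.linear_scale complex_vector.scale_right_diff_distrib)

lemma clinear_zero: "clinear (\<lambda>x. 0)"
  by (rule clinearI) simp_all

lemma hat_formulasD:
  assumes "hat_formulas c \<rho> T"
  shows "clinear (T u)" and "clinear (\<lambda>u. T u w)"
    and "i \<in> {1..16} \<Longrightarrow> T (xi i) (f \<otimes>\<^sub>C v) = pd i f \<otimes>\<^sub>C v"
    and "u \<in> G_0 \<Longrightarrow> T u (f \<otimes>\<^sub>C v) = restr_A u f \<otimes>\<^sub>C v + f \<otimes>\<^sub>C varrho c \<rho> u v"
    and "i \<in> {1..16} \<Longrightarrow> T (eta i) (f \<otimes>\<^sub>C v) =
      P_op i f \<otimes>\<^sub>C v + (\<Sum>r=1..16. (x_var r * f) \<otimes>\<^sub>C varrho c \<rho> (E6_bracket (xi r) (eta i)) v)"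
proof -
  note h1 = assms[unfolded hat_formulas_def]
  note h2 = h1[THEN conjunct2]
  note h3 = h2[THEN conjunct2]
  note h4 = h3[THEN conjunct2]
  show "clinear (T u)" by (rule h1[THEN conjunct1, THEN spec])
  show "clinear (\<lambda>u. T u w)" by (rule h2[THEN conjunct1, THEN spec])
  show "T (xi i) (f \<otimes>\<^sub>C v) = pd i f \<otimes>\<^sub>C v" if "i \<in> {1..16}"
    by (rule h3[THEN conjunct1, THEN bspec, OF that, THEN spec, THEN spec])
  show "T u (f \<otimes>\<^sub>C v) = restr_A u f \<otimes>\<^sub>C v + f \<otimes>\<^sub>C varrho c \<rho> u v" if "u \<in> G_0"
    by (rule h4[THEN conjunct1, THEN bspec, OF that, THEN spec, THEN spec])
  show "T (eta i) (f \<otimes>\<^sub>C v) =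
      P_op i f \<otimes>\<^sub>C v + (\<Sum>r=1..16. (x_var r * f) \<otimes>\<^sub>C varrho c \<rho> (E6_bracket (xi r) (eta i)) v)"
    if "i \<in> {1..16}"
    by (rule h4[THEN conjunct2, THEN bspec, OF that, THEN spec, THEN spec])
qed

lemma restr_A_linear: "restr_A (u + v) f = restr_A u f + restr_A v f" "restr_A (z *\<^sub>C u) f = z *\<^sub>C restr_A u f"
  by (simp_all add: restr_A_def phi_def E6_bracket_add_left lookup_add scaleC_add_left sum.distrib E6_bracket_scale_left
      E6_coeff_scaleC complex_vector.scale_sum_right scaleC_scaleC)

context
  fixes \<rho> :: "complex ^ 10 ^ 10 \<Rightarrow> 'm::complex_vector \<Rightarrow> 'm" and c :: complex
  assumes M: "lie_module o10 commutator \<rho>"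
begin

lemma clinear_restr_A: "clinear (restr_A u)"
  by (rule derivation_clinear[OF derivation_restr_A])

lemma clinear_P_op: "clinear (P_op i)"
  by (rule derivation_clinear[OF derivation_P_op])

lemma hat_G_0_pure: "u \<in> G_0 \<Longrightarrow> hat_G_0 c \<rho> u (f \<otimes>\<^sub>C v) = restr_A u f \<otimes>\<^sub>C v + f \<otimes>\<^sub>C varrho c \<rho> u v"
  by (simp add: hat_G_0_def tensor_map_pure clinear_restr_A clinear_id clinear_varrho[OF M])

lemma hat_eta_pure:
  assumes "i \<in> {1..16}"
  shows "hat_eta c \<rho> i (f \<otimes>\<^sub>C v) =
    P_op i f \<otimes>\<^sub>C v + (\<Sum>r=1..16. (x_var r * f) \<otimes>\<^sub>C varrho c \<rho> (E6_bracket (xi r) (eta i)) v)"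
  using assms
  by (simp add: hat_eta_def tensor_map_pure clinear_P_op clinear_id clinear_mult_poly clinear_varrho[OF M]
      xi_eta_bracket_in_G_0 del: One_nat_def)

lemma clinear_hat_G_0: "u \<in> G_0 \<Longrightarrow> clinear (hat_G_0 c \<rho> u)"
  unfolding hat_G_0_def
  by (intro clinear_plus clinear_tensor_map clinear_restr_A clinear_id clinear_varrho[OF M])

lemma clinear_hat_eta: "i \<in> {1..16} \<Longrightarrow> clinear (hat_eta c \<rho> i)"
  unfolding hat_eta_def
  by (intro clinear_plus clinear_sum clinear_tensor_map clinear_P_op clinear_id clinear_mult_poly clinear_varrho[OF M]
      xi_eta_bracket_in_G_0)

lemma clinear_hat_action: "clinear (hat_action c \<rho> u)"
  unfolding hat_action_def
  by (intro clinear_plus clinear_sum clinear_scaleC clinear_tensor_map clinear_pd clinear_id clinear_hat_G_0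
      clinear_hat_eta G_0_part_in)

lemma hat_G_0_add:
  assumes "u \<in> G_0" "u' \<in> G_0"
  shows "hat_G_0 c \<rho> (u + u') w = hat_G_0 c \<rho> u w + hat_G_0 c \<rho> u' w"
proof -
  have in_G: "u + u' \<in> G_0"
    using assms subspace_G_0 by (simp add: complex_vector.subspace_add)
  show ?thesis
    by (rule clinear_eq_tensorI)
      (use assms in_G in \<open>simp_all add: hat_G_0_pure clinear_hat_G_0 clinear_plus restr_A_linear varrho_add[OF M]
        tensor_add_left tensor_add_right\<close>)
qed

lemma hat_G_0_scaleC:
  assumes "u \<in> G_0"
  shows "hat_G_0 c \<rho> (z *\<^sub>C u) w = z *\<^sub>C hat_G_0 c \<rho> u w"
proof -
  have in_G: "z *\<^sub>C u \<in> G_0"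
    using assms subspace_G_0 by (simp add: complex_vector.subspace_scale)
  show ?thesis
    by (rule clinear_eq_tensorI)
      (use assms in_G in \<open>simp_all add: hat_G_0_pure clinear_hat_G_0 clinear_scaleC restr_A_linear varrho_scaleC[OF M]
        tensor_scale_left tensor_scale_right scaleC_add_right\<close>)
qed

lemma clinear_hat_action_left: "clinear (\<lambda>u. hat_action c \<rho> u w)"
  by (rule clinearI)
    (simp_all add: hat_action_def G_0_part_linear hat_G_0_add hat_G_0_scaleC G_0_part_in xi_coeff_linear eta_coeff_linear
      scaleC_add_left sum.distrib scaleC_add_right complex_vector.scale_sum_right scaleC_scaleC)

lemma hat_action_formulas: "hat_formulas c \<rho> (hat_action c \<rho>)"
  unfolding hat_formulas_def
proof (intro conjI allI ballI clinear_hat_action clinear_hat_action_left)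
  have G_0_part_xi: "G_0_part (xi i) = 0" "G_0_part (eta i) = 0" if "i \<in> {1..16}" for i
    using that by (simp_all add: G_0_part_def coeff_xi_eta if_distrib[of "\<lambda>z. z *\<^sub>C _"] scaleC_one
      del: One_nat_def cong: if_cong sum.cong_simp)
  have "0 \<in> G_0" by (rule complex_vector.subspace_0[OF subspace_G_0])
  then have zero: "hat_G_0 c \<rho> 0 w = 0" for w using hat_G_0_scaleC[of 0 0] by simp
  show "hat_action c \<rho> (xi i) (f \<otimes>\<^sub>C v) = pd i f \<otimes>\<^sub>C v" if "i \<in> {1..16}" for i f v
    using that by (simp add: hat_action_def G_0_part_xi zero coeff_xi_eta if_distrib[of "\<lambda>z. z *\<^sub>C _"] scaleC_one
      tensor_map_pure clinear_pd clinear_id del: One_nat_def cong: if_cong sum.cong_simp)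
  show "hat_action c \<rho> u (f \<otimes>\<^sub>C v) = restr_A u f \<otimes>\<^sub>C v + f \<otimes>\<^sub>C varrho c \<rho> u v" if "u \<in> G_0" for u f v
  proof -
    have "G_0_part u = u" using that by (simp add: G_0_part_def coeff_G_0 del: One_nat_def)
    then show ?thesis using that by (simp add: hat_action_def coeff_G_0 hat_G_0_pure del: One_nat_def)
  qed
  show "hat_action c \<rho> (eta i) (f \<otimes>\<^sub>C v) = P_op i f \<otimes>\<^sub>C v
    + (\<Sum>r=1..16. (x_var r * f) \<otimes>\<^sub>C varrho c \<rho> (E6_bracket (xi r) (eta i)) v)" if "i \<in> {1..16}" for i f v
    using that by (simp add: hat_action_def G_0_part_xi zero coeff_xi_eta if_distrib[of "\<lambda>z. z *\<^sub>C _"] scaleC_one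
      hat_eta_pure del: One_nat_def cong: if_cong sum.cong_simp)
qed

text \<open>The formulas fix T on pure tensors for u in each grade, and T is linear in both
  arguments.\<close>

lemma hat_formulas_unique:
  assumes T: "hat_formulas c \<rho> T" and S: "hat_formulas c \<rho> S"
  shows "T = S"
proof (intro ext)
  fix u w
  note D = hat_formulasD[OF T] hat_formulasD[OF S]
  show "T u w = S u w"
  proof (induction u rule: graded_induct)
    case (G_0 u)
    show ?case by (rule clinear_eq_tensorI[OF D(1,6)]) (simp only: D(4,9)[OF G_0])
  next
    case (xi i)
    show ?case by (rule clinear_eq_tensorI[OF D(1,6)]) (simp only: D(3,8)[OF xi])
  next
    case (eta i)
    show ?case by (rule clinear_eq_tensorI[OF D(1,6)]) (simp only: D(5,10)[OF eta])
  qed (simp_all add: clinear.linear_add[OF D(2)] clinear.linear_add[OF D(7)] clinear.linear_scale[OF D(2)]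
      clinear.linear_scale[OF D(7)])
qed

lemma ex1_hat_formulas: "\<exists>!T. hat_formulas c \<rho> T"
  using hat_action_formulas hat_formulas_unique by blast

lemma hat_act_formulas: "hat_formulas c \<rho> (hat_act c \<rho>)"
  unfolding hat_act_def by (rule theI'[OF ex1_hat_formulas])

end

section \<open>The module axioms\<close>

text \<open>Take w with a monomial of degree m as polynomial factor. The Euler operator on C w is
  the sum of x_r \<partial>_r, and each \<partial>_r passes through C to degree m - 1, where C
  vanishes by induction, or gives 0 outright. The degree hypothesis evaluates the same vector as (m
  + d) C w, and m + d is positive even for constants.\<close>

lemma clinear_annihilator:
  fixes C :: "(poly16, 'm::complex_vector) tensor \<Rightarrow> (poly16, 'm) tensor"
  assumes C: "clinear C"
    and pd: "\<And>r w. r \<in> {1..16} \<Longrightarrow> tensor_map (pd r) id (C w) = C (tensor_map (pd r) id w)"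
    and deg: "\<And>w. tensor_map euler_D id (C w) = C (tensor_map euler_D id w) + of_nat d *\<^sub>C C w"
    and d: "d > 0"
  shows "C w = 0"
proof -
  note lin = clinear_tensor_map[OF clinear_pd clinear_id] clinear_tensor_map[OF clinear_mult_poly clinear_id]
  have euler: "tensor_map euler_D id w = (\<Sum>r=1..16. tensor_map ((*) (x_var r)) id (tensor_map (pd r) id w))"
    for w :: "(poly16, 'm) tensor"
  proof (rule clinear_eq_tensorI[where s = "tensor_map euler_D id"
        and t = "\<lambda>w. \<Sum>r=1..16. tensor_map ((*) (x_var r)) id (tensor_map (pd r) id w)"])
    show "clinear (tensor_map euler_D (id :: 'm \<Rightarrow> 'm))"
      by (intro clinear_tensor_map derivation_clinear derivation_euler_D clinear_id)
    show "clinear (\<lambda>w :: (poly16, 'm) tensor. \<Sum>r=1..16. tensor_map ((*) (x_var r)) id (tensor_map (pd r) id w))"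
      by (rule clinear_sum, rule clinear_comp[OF lin(2) lin(1)])
    show "tensor_map euler_D id (f \<otimes>\<^sub>C v) = (\<Sum>r=1..16. tensor_map ((*) (x_var r)) id (tensor_map (pd r) id (f \<otimes>\<^sub>C v)))"
      for f and v :: 'm
      by (simp add: tensor_map_pure derivation_clinear derivation_euler_D clinear_id clinear_mult_poly clinear_pd
          euler_D_def tensor_sum_left)
  qed
  have monomial: "C (Poly_Mapping.single m z \<otimes>\<^sub>C v) = 0" for m z v
  proof (induction "monomial_degree m" arbitrary: m z rule: less_induct)
    case less
    let ?w = "Poly_Mapping.single m z \<otimes>\<^sub>C v"
    have "C (tensor_map (pd r) id ?w) = 0" for r
    proof (cases "Poly_Mapping.lookup m (of_nat r) = 0")
      case True
      then show ?thesis
        by (simp add: tensor_map_pure clinear_pd clinear_id pd_single clinear.linear_0[OF C])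
    next
      case False
      let ?m = "m - Poly_Mapping.single (of_nat r) 1"
      have "monomial_degree m = monomial_degree ?m + 1"
        using decompose_monomial[OF False] by (metis monomial_degree_add monomial_degree_single)
      then have "C (Poly_Mapping.single ?m z' \<otimes>\<^sub>C v) = 0" for z' by (intro less) simp
      then show ?thesis by (simp add: tensor_map_pure clinear_pd clinear_id pd_single del: One_nat_def)
    qed
    then have "tensor_map (pd r) id (C ?w) = 0" if "r \<in> {1..16}" for r using pd[OF that] by simp
    then have "tensor_map euler_D id (C ?w) = 0"
      by (simp add: euler clinear.linear_0[OF clinear_tensor_map[OF clinear_mult_poly clinear_id]] del: One_nat_def)
    moreover have "tensor_map euler_D id ?w = of_nat (monomial_degree m) *\<^sub>C ?w"
      by (simp add: tensor_map_pure derivation_clinear derivation_euler_D clinear_id euler_D_monomial tensor_scale_left)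
    ultimately have "of_nat (monomial_degree m + d) *\<^sub>C C ?w = 0"
      using deg[of ?w] by (simp add: clinear.linear_scale[OF C] scaleC_add_left)
    then show ?case using d by (simp del: of_nat_add)
  qed
  have "C (f \<otimes>\<^sub>C v) = 0" for f v
    by (induction f rule: poly_mapping_induct)
      (simp_all add: monomial tensor_add_left clinear.linear_add[OF C])
  then show ?thesis
    using clinear_eq_tensorI[OF C clinear_zero] by blast
qed

context
  fixes \<rho> :: "complex ^ 10 ^ 10 \<Rightarrow> 'm::complex_vector \<Rightarrow> 'm" and c :: complex
    and T :: "E6 \<Rightarrow> (poly16, 'm) tensor \<Rightarrow> (poly16, 'm) tensor"
  assumes M: "lie_module o10 commutator \<rho>" and T: "hat_formulas c \<rho> T"
begin

lemmas T_clinear = hat_formulasD(1)[OF T] and T_clinear_left = hat_formulasD(2)[OF T]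
  and T_xi = hat_formulasD(3)[OF T] and T_G_0 = hat_formulasD(4)[OF T] and T_eta = hat_formulasD(5)[OF T]

lemmas T_lin = clinear.linear_add[OF T_clinear] clinear.linear_scale[OF T_clinear] clinear.linear_0[OF T_clinear]
  clinear.linear_diff[OF T_clinear] clinear.linear_sum[OF T_clinear] clinear.linear_neg[OF T_clinear]
lemmas T_lin_left = clinear.linear_add[OF T_clinear_left] clinear.linear_scale[OF T_clinear_left]
  clinear.linear_0[OF T_clinear_left] clinear.linear_diff[OF T_clinear_left] clinear.linear_sum[OF T_clinear_left]
  clinear.linear_neg[OF T_clinear_left]

definition compatible :: "E6 \<Rightarrow> E6 \<Rightarrow> bool"
  where "compatible x y \<longleftrightarrow> (\<forall>w. T (E6_bracket x y) w = T x (T y w) - T y (T x w))"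

lemma compatible_sym: "compatible x y \<Longrightarrow> compatible y x"
  unfolding compatible_def E6_bracket_antisym[of y x] by (simp add: T_lin_left)

lemma compatible_zero: "compatible x 0"
  by (simp add: compatible_def T_lin_left T_lin)

lemma compatible_add: "compatible x y \<Longrightarrow> compatible x z \<Longrightarrow> compatible x (y + z)"
  by (simp add: compatible_def E6_bracket_add_right T_lin_left T_lin)

lemma compatible_scaleC: "compatible x y \<Longrightarrow> compatible x (a *\<^sub>C y)"
  by (simp add: compatible_def E6_bracket_scale_right T_lin_left T_lin complex_vector.scale_right_diff_distrib)

lemma compatible_sum: "(\<And>i. i \<in> I \<Longrightarrow> compatible x (f i)) \<Longrightarrow> compatible x (\<Sum>i\<in>I. a i *\<^sub>C f i)"
  by (induction I rule: infinite_finite_induct)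
    (simp_all add: compatible_zero compatible_add compatible_scaleC)

lemma compatibleI:
  assumes "\<And>f v. T (E6_bracket x y) (f \<otimes>\<^sub>C v) = T x (T y (f \<otimes>\<^sub>C v)) - T y (T x (f \<otimes>\<^sub>C v))"
  shows "compatible x y"
  unfolding compatible_def
proof
  fix w
  show "T (E6_bracket x y) w = T x (T y w) - T y (T x w)"
    by (rule clinear_eq_tensorI[OF T_clinear clinear_minus[OF clinear_comp[OF T_clinear T_clinear]
      clinear_comp[OF T_clinear T_clinear]] assms])
qed

lemma compatible_xi_xi: "i \<in> {1..16} \<Longrightarrow> j \<in> {1..16} \<Longrightarrow> compatible (xi i) (xi j)"
  by (rule compatibleI) (simp add: bracket_xi_xi T_lin_left T_xi pd_commute[of i j] del: One_nat_def)

lemma compatible_G_0_G_0: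
  assumes "u \<in> G_0" "u' \<in> G_0"
  shows "compatible u u'"
  by (rule compatibleI)
    (use assms in \<open>simp add: T_G_0 G_0_bracket restr_A_bracket varrho_bracket[OF M] T_lin tensor_diff_left
      tensor_diff_right algebra_simps\<close>)

lemma compatible_G_0_xi:
  assumes "u \<in> G_0" "k \<in> {1..16}"
  shows "compatible u (xi k)"
proof (rule compatibleI)
  fix f v
  have "T (E6_bracket u (xi k)) (f \<otimes>\<^sub>C v) = (\<Sum>i=1..16. (- phi i k u) *\<^sub>C pd i f) \<otimes>\<^sub>C v"
    using assms by (simp add: bracket_xi_expansion T_lin_left T_xi tensor_sum_left tensor_scale_left tensor_minus_left del: One_nat_def
        cong: sum.cong_simp)
  then show "T (E6_bracket u (xi k)) (f \<otimes>\<^sub>C v) = T u (T (xi k) (f \<otimes>\<^sub>C v)) - T (xi k) (T u (f \<otimes>\<^sub>C v))"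
    using assms restr_A_pd_commutator[OF assms(2), of u f]
    by (simp add: T_G_0 T_xi T_lin tensor_diff_left[symmetric] del: One_nat_def)
qed

lemma compatible_xi_eta:
  assumes r: "r \<in> {1..16}" and i: "i \<in> {1..16}"
  shows "compatible (xi r) (eta i)"
proof (rule compatibleI)
  fix f v
  let ?b = "\<lambda>s. E6_bracket (xi s) (eta i)"
  have "T (xi r) (T (eta i) (f \<otimes>\<^sub>C v))
    = pd r (P_op i f) \<otimes>\<^sub>C v + (\<Sum>s=1..16. pd r (x_var s * f) \<otimes>\<^sub>C varrho c \<rho> (?b s) v)"
    using r i by (simp add: T_eta T_xi T_lin del: One_nat_def)
  \<comment> \<open>Differentiating the factor x_r contributes one extra term, which is exactly the
    module part of the action of [\<xi>_r, \<eta>_i].\<close>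
  also have "(\<Sum>s=1..16. pd r (x_var s * f) \<otimes>\<^sub>C varrho c \<rho> (?b s) v)
    = (\<Sum>s=1..16. (x_var s * pd r f) \<otimes>\<^sub>C varrho c \<rho> (?b s) v + (if s = r then f \<otimes>\<^sub>C varrho c \<rho> (?b r) v else 0))"
    by (rule sum.cong) (use r in \<open>auto simp: pd_mult pd_x_var tensor_add_left simp del: One_nat_def\<close>)
  also have "\<dots> = (\<Sum>s=1..16. (x_var s * pd r f) \<otimes>\<^sub>C varrho c \<rho> (?b s) v) + f \<otimes>\<^sub>C varrho c \<rho> (?b r) v"
    using r by (simp add: sum.distrib)
  finally have "T (xi r) (T (eta i) (f \<otimes>\<^sub>C v)) - T (eta i) (T (xi r) (f \<otimes>\<^sub>C v))
    = (pd r (P_op i f) - P_op i (pd r f)) \<otimes>\<^sub>C v + f \<otimes>\<^sub>C varrho c \<rho> (?b r) v"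
    using r i by (simp add: T_eta T_xi tensor_diff_left del: One_nat_def)
  then show "T (?b r) (f \<otimes>\<^sub>C v) = T (xi r) (T (eta i) (f \<otimes>\<^sub>C v)) - T (eta i) (T (xi r) (f \<otimes>\<^sub>C v))"
    using r i by (simp add: T_G_0 xi_eta_bracket_in_G_0 pd_P_op_commutator del: One_nat_def)
qed

text \<open>By the Jacobi identity the defect of compatibility of \<open>u\<close> and \<open>y\<close> commutes with \<open>x\<close>.\<close>

lemma defect_commutes:
  assumes "compatible x u" "compatible x y" "compatible x (E6_bracket u y)"
    "compatible (E6_bracket x u) y" "compatible u (E6_bracket x y)"
  defines "C \<equiv> \<lambda>w. T u (T y w) - T y (T u w) - T (E6_bracket u y) w"
  shows "T x (C w) = C (T x w)"
proof -
  have swap: "T x (T z w) = T (E6_bracket x z) w + T z (T x w)" if "compatible x z" for x z w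
    using that by (simp add: compatible_def)
  have "T (E6_bracket x (E6_bracket u y)) w
    = (T (E6_bracket x u) (T y w) - T y (T (E6_bracket x u) w)) + (T u (T (E6_bracket x y) w) - T (E6_bracket x y) (T u w))"
    using assms(4,5) by (simp add: E6_bracket_bracket[of x u y] T_lin_left compatible_def)
  then show ?thesis
    unfolding C_def by (simp add: T_lin swap[OF assms(1)] swap[OF assms(2)] swap[OF assms(3)])
qed

section \<open>Degrees of the operators and the remaining relations\<close>

lemma T_xi_eq: "r \<in> {1..16} \<Longrightarrow> T (xi r) w = tensor_map (pd r) id w"
  by (rule clinear_eq_tensorI[OF T_clinear clinear_tensor_map[OF clinear_pd clinear_id]])
    (simp add: T_xi tensor_map_pure clinear_pd clinear_id)

abbreviation degree_op :: "(poly16, 'm) tensor \<Rightarrow> (poly16, 'm) tensor"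
  where "degree_op \<equiv> tensor_map euler_D id"

lemma clinear_degree_op: "clinear degree_op"
  by (intro clinear_tensor_map derivation_clinear derivation_euler_D clinear_id)

lemma degree_op_pure: "degree_op (f \<otimes>\<^sub>C v) = euler_D f \<otimes>\<^sub>C v"
  by (simp add: tensor_map_pure derivation_clinear derivation_euler_D clinear_id)

lemma degree_G_0:
  assumes "u \<in> G_0"
  shows "degree_op (T u w) = T u (degree_op w)"
  by (rule clinear_eq_tensorI[OF clinear_comp[OF clinear_degree_op T_clinear] clinear_comp[OF T_clinear clinear_degree_op]])
    (use assms in \<open>simp add: T_G_0 degree_op_pure clinear.linear_add[OF clinear_degree_op] euler_D_restr_A\<close>)

text \<open>Both P_i and multiplication by x_r raise the degree by one.\<close>

lemma degree_eta:
  assumes i: "i \<in> {1..16}"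
  shows "degree_op (T (eta i) w) = T (eta i) (degree_op w) + T (eta i) w"
proof (rule clinear_eq_tensorI[OF clinear_comp[OF clinear_degree_op T_clinear]
      clinear_plus[OF clinear_comp[OF T_clinear clinear_degree_op] T_clinear]])
  fix f :: poly16 and v :: 'm
  have "euler_D (x_var r * f) = x_var r * euler_D f + x_var r * f" if "r \<in> {1..16}" for r
    using that by (simp add: derivation_mult[OF derivation_euler_D] euler_D_x_var del: One_nat_def)
  then have "(\<Sum>r=1..16. euler_D (x_var r * f) \<otimes>\<^sub>C varrho c \<rho> (E6_bracket (xi r) (eta i)) v)
    = (\<Sum>r=1..16. (x_var r * euler_D f) \<otimes>\<^sub>C varrho c \<rho> (E6_bracket (xi r) (eta i)) v)
      + (\<Sum>r=1..16. (x_var r * f) \<otimes>\<^sub>C varrho c \<rho> (E6_bracket (xi r) (eta i)) v)"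
    unfolding sum.distrib[symmetric] by (intro sum.cong refl) (simp add: tensor_add_left del: One_nat_def)
  then show "degree_op (T (eta i) (f \<otimes>\<^sub>C v)) = T (eta i) (degree_op (f \<otimes>\<^sub>C v)) + T (eta i) (f \<otimes>\<^sub>C v)"
    unfolding T_eta[OF i] degree_op_pure clinear.linear_add[OF clinear_degree_op]
      clinear.linear_sum[OF clinear_degree_op] euler_D_P_op[OF i] tensor_add_left
    by (simp add: algebra_simps)
qed

lemma clinear_defect: "clinear (\<lambda>w. T u (T y w) - T y (T u w) - T z w)"
  by (rule clinear_minus[OF clinear_minus[OF clinear_comp[OF T_clinear T_clinear] clinear_comp[OF T_clinear T_clinear]]
    T_clinear])

lemma compatible_G_0_eta:
  assumes u: "u \<in> G_0" and i: "i \<in> {1..16}"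
  shows "compatible u (eta i)"
proof -
  let ?C = "\<lambda>w. T u (T (eta i) w) - T (eta i) (T u w) - T (E6_bracket u (eta i)) w"
  have "?C w = 0" for w
  \<comment> \<open>The element u preserves the degree and both \<eta>_i and [u, \<eta>_i] raise it
    by one, so the whole defect does.\<close>
  proof (rule clinear_annihilator[where d = 1 and C = "?C"])
    show "clinear ?C" by (rule clinear_defect)
    show "tensor_map (pd r) id (?C w) = ?C (tensor_map (pd r) id w)" if r: "r \<in> {1..16}" for r w
      unfolding T_xi_eq[OF r, symmetric]
    proof (rule defect_commutes)
      show "compatible (xi r) u" using compatible_G_0_xi[OF u r] by (rule compatible_sym)
      show "compatible (xi r) (eta i)" by (rule compatible_xi_eta[OF r i])
      show "compatible (xi r) (E6_bracket u (eta i))"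
        unfolding bracket_eta_expansion[OF u i] by (rule compatible_sum) (rule compatible_xi_eta[OF r])
      \<comment> \<open>[\<xi>_r, u] is again a combination of \<xi>'s, so its compatibility with
        \<eta>_i is already known.\<close>
      have "E6_bracket (xi r) u = (\<Sum>k=1..16. phi k r u *\<^sub>C xi k)"
        using E6_bracket_antisym[of "xi r" u] bracket_xi_expansion[OF u r] by (simp add: sum_negf)
      then have "compatible (eta i) (E6_bracket (xi r) u)"
        by (simp only:) (rule compatible_sum, rule compatible_sym, rule compatible_xi_eta[OF _ i])
      then show "compatible (E6_bracket (xi r) u) (eta i)" by (rule compatible_sym)
      show "compatible u (E6_bracket (xi r) (eta i))"
        by (rule compatible_G_0_G_0[OF u xi_eta_bracket_in_G_0[OF r i]])
    qed
    have deg: "degree_op (T (E6_bracket u (eta i)) w) = T (E6_bracket u (eta i)) (degree_op w) + T (E6_bracket u (eta i)) w" for w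
      unfolding bracket_eta_expansion[OF u i]
      by (simp add: T_lin_left clinear.linear_sum[OF clinear_degree_op] clinear.linear_scale[OF clinear_degree_op]
          degree_eta scaleC_add_right sum.distrib del: One_nat_def cong: sum.cong_simp)
    show "degree_op (?C w) = ?C (degree_op w) + of_nat 1 *\<^sub>C ?C w" for w
      unfolding clinear.linear_diff[OF clinear_degree_op] degree_eta[OF i] degree_G_0[OF u] deg T_lin
      by (simp add: scaleC_one algebra_simps)
  qed simp
  then show ?thesis by (simp add: compatible_def)
qed

text \<open>The defect has degree 2. That it commutes with \<partial>_r rests on the relations
  between \<open>G_0\<close> and the \<eta>'s, since [\<xi>_r, \<eta>_i] lies in
  \<open>G_0\<close>.\<close>

lemma compatible_eta_eta:
  assumes i: "i \<in> {1..16}" and j: "j \<in> {1..16}"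
  shows "compatible (eta i) (eta j)"
proof -
  let ?C = "\<lambda>w. T (eta i) (T (eta j) w) - T (eta j) (T (eta i) w) - T (E6_bracket (eta i) (eta j)) w"
  have "?C w = 0" for w
  proof (rule clinear_annihilator[where d = 2 and C = "?C"])
    show "clinear ?C" by (rule clinear_defect)
    show "tensor_map (pd r) id (?C w) = ?C (tensor_map (pd r) id w)" if r: "r \<in> {1..16}" for r w
      unfolding T_xi_eq[OF r, symmetric]
    proof (rule defect_commutes)
      show "compatible (xi r) (E6_bracket (eta i) (eta j))"
        unfolding bracket_eta_eta[OF i j] by (rule compatible_zero)
      show "compatible (E6_bracket (xi r) (eta i)) (eta j)"
        by (rule compatible_G_0_eta[OF xi_eta_bracket_in_G_0[OF r i] j])
      show "compatible (eta i) (E6_bracket (xi r) (eta j))"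
        by (rule compatible_sym, rule compatible_G_0_eta[OF xi_eta_bracket_in_G_0[OF r j] i])
    qed (rule compatible_xi_eta[OF r i] compatible_xi_eta[OF r j])+
    show "degree_op (?C w) = ?C (degree_op w) + of_nat 2 *\<^sub>C ?C w" for w
    proof -
      have two: "of_nat 2 *\<^sub>C x = x + x" for x :: "(poly16, 'm) tensor"
        using scaleC_add_left[of 1 1 x] by (simp add: scaleC_one)
      show ?thesis
        unfolding two clinear.linear_diff[OF clinear_degree_op] degree_eta[OF i] degree_eta[OF j] T_lin
          bracket_eta_eta[OF i j] T_lin_left clinear.linear_0[OF clinear_degree_op]
        by (simp add: algebra_simps)
    qed
  qed simp
  then show ?thesis by (simp add: compatible_def)
qed

lemma compatible: "compatible x y"
proof (induction x rule: graded_induct)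
  case u: (G_0 u)
  show ?case
    by (induction y rule: graded_induct)
      (use u in \<open>simp_all add: compatible_G_0_G_0 compatible_G_0_xi compatible_G_0_eta compatible_add compatible_scaleC\<close>)
next
  case i: (xi i)
  show ?case
    by (induction y rule: graded_induct)
      (use i in \<open>simp_all add: compatible_sym[OF compatible_G_0_xi] compatible_xi_xi compatible_xi_eta
        compatible_add compatible_scaleC del: One_nat_def\<close>)
next
  case i: (eta i)
  show ?case
    by (induction y rule: graded_induct)
      (use i in \<open>simp_all add: compatible_sym[OF compatible_G_0_eta] compatible_sym[OF compatible_xi_eta]
        compatible_eta_eta compatible_add compatible_scaleC del: One_nat_def\<close>)
next
  case (add u v)
  then show ?case by (metis compatible_add compatible_sym)
next
  case (scaleC z u)
  then show ?case by (metis compatible_scaleC compatible_sym)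
qed

lemma lie_module_T: "lie_module UNIV E6_bracket T"
proof (intro lie_module.intro lie_algebra_E6 lie_module_axioms.intro)
  show "T (E6_bracket x y) w = T x (T y w) - T y (T x w)" for x y w
    using compatible[of x y] by (simp add: compatible_def)
qed (simp_all add: T_clinear T_lin_left)

end

section \<open>The functor on objects and morphisms\<close>

lemma lie_module_hat_act:
  assumes "lie_module o10 commutator \<rho>"
  shows "lie_module UNIV E6_bracket (hat_act c \<rho>)"
  by (rule lie_module_T[OF assms hat_act_formulas[OF assms]])

text \<open>The polynomial operators act on the other tensor factor, and g intertwines the two
  actions of \<open>G_0\<close> through \<open>varrho\<close>, scalars included; the three grades
  are then compared on pure tensors.\<close>

lemma lie_module_hom_tensor_map:
  assumes "lie_module_hom o10 commutator \<rho> \<sigma> g"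
  shows "lie_module_hom UNIV E6_bracket (hat_act c \<rho>) (hat_act c \<sigma>) (tensor_map id g)"
proof -
  interpret g: lie_module_hom o10 commutator \<rho> \<sigma> g by (rule assms)
  note M = g.M.lie_module_axioms and N = g.N.lie_module_axioms
  note S = hat_act_formulas[OF M, of c] and T = hat_act_formulas[OF N, of c]
  note G = clinear_tensor_map[OF clinear_id g.hom_linear] and pure = tensor_map_pure[OF clinear_id g.hom_linear]
  note eqI = clinear_eq_tensorI[OF clinear_comp[OF G hat_formulasD(1)[OF S]] clinear_comp[OF hat_formulasD(1)[OF T] G]]
  have "tensor_map id g (hat_act c \<rho> u w) = hat_act c \<sigma> u (tensor_map id g w)" for u w
  proof (induction u rule: graded_induct)
    case (G_0 u)
    show ?case
      by (rule eqI) (use G_0 in \<open>simp add: hat_formulasD(4)[OF S] hat_formulasD(4)[OF T] pure clinear.linear_add[OF G] varrho_hom[OF assms]\<close>)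
  next
    case (xi i)
    show ?case
      by (rule eqI) (use xi in \<open>simp add: hat_formulasD(3)[OF S] hat_formulasD(3)[OF T] pure\<close>)
  next
    case (eta i)
    show ?case
      by (rule eqI) (use eta in \<open>simp add: hat_formulasD(5)[OF S] hat_formulasD(5)[OF T] pure clinear.linear_add[OF G]
        clinear.linear_sum[OF G] varrho_hom[OF assms] xi_eta_bracket_in_G_0 del: One_nat_def cong: sum.cong_simp\<close>)
  next
    case (add u v)
    then show ?case
      unfolding clinear.linear_add[OF hat_formulasD(2)[OF S]] clinear.linear_add[OF hat_formulasD(2)[OF T]]
        clinear.linear_add[OF G] by (simp only:)
  next
    case (scaleC z u)
    then show ?case
      unfolding clinear.linear_scale[OF hat_formulasD(2)[OF S]] clinear.linear_scale[OF hat_formulasD(2)[OF T]]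
        clinear.linear_scale[OF G] by (simp only:)
  qed
  then show ?thesis
    by (intro lie_module_hom.intro lie_module_hom_axioms.intro lie_module_hat_act M N G)
qed

text \<open>Unique existence of T shows that the formulas are consistent and that
  \<open>hat_act\<close> denotes the action they describe. The remaining clauses give the functor:
  modules, homomorphisms, identities and composites.\<close>

theorem theorem5p1:
  fixes c :: complex
  shows
    "(\<forall>\<rho> :: complex ^ 10 ^ 10 \<Rightarrow> 'm::complex_vector \<Rightarrow> 'm.
        lie_module o10 commutator \<rho> \<longrightarrow>
          (\<exists>!T. hat_formulas c \<rho> T) \<and> lie_module UNIV E6_bracket (hat_act c \<rho>))
   \<and> (\<forall>(\<rho> :: complex ^ 10 ^ 10 \<Rightarrow> 'm \<Rightarrow> 'm) (\<sigma> :: complex ^ 10 ^ 10 \<Rightarrow> 'n::complex_vector \<Rightarrow> 'n) g.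
        lie_module_hom o10 commutator \<rho> \<sigma> g \<longrightarrow>
          lie_module_hom UNIV E6_bracket (hat_act c \<rho>) (hat_act c \<sigma>) (tensor_map id g))
   \<and> tensor_map (id :: poly16 \<Rightarrow> poly16) (id :: 'm \<Rightarrow> 'm) = id
   \<and> (\<forall>(\<rho> :: complex ^ 10 ^ 10 \<Rightarrow> 'm \<Rightarrow> 'm) (\<sigma> :: complex ^ 10 ^ 10 \<Rightarrow> 'n \<Rightarrow> 'n)
         (\<tau> :: complex ^ 10 ^ 10 \<Rightarrow> 'k::complex_vector \<Rightarrow> 'k) g h.
        lie_module_hom o10 commutator \<rho> \<sigma> g \<longrightarrow> lie_module_hom o10 commutator \<sigma> \<tau> h \<longrightarrow>
          tensor_map (id :: poly16 \<Rightarrow> poly16) (h \<circ> g) = tensor_map id h \<circ> tensor_map id g)"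
proof (intro conjI allI impI)
  fix \<rho> :: "complex ^ 10 ^ 10 \<Rightarrow> 'm \<Rightarrow> 'm" and \<sigma> :: "complex ^ 10 ^ 10 \<Rightarrow> 'n \<Rightarrow> 'n"
    and \<tau> :: "complex ^ 10 ^ 10 \<Rightarrow> 'k \<Rightarrow> 'k" and g h
  assume "lie_module_hom o10 commutator \<rho> \<sigma> g" "lie_module_hom o10 commutator \<sigma> \<tau> h"
  then have "clinear g" "clinear h" by (simp_all add: lie_module_hom_def lie_module_hom_axioms_def)
  then show "tensor_map (id :: poly16 \<Rightarrow> poly16) (h \<circ> g) = tensor_map id h \<circ> tensor_map id g"
    using tensor_map_comp[OF clinear_id clinear_id, of g h] by simp
qed (simp_all add: ex1_hat_formulas lie_module_hat_act lie_module_hom_tensor_map tensor_map_id)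

end
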